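(* Assume $\mathbb{E}(|\nu_v|^{2+\varepsilon}+|\omega_e|^{2+\varepsilon})<\infty$ for some $\varepsilon>0$. Let $k=k_n$ be integers such that $k/n\to t\in(0,1)$ as $n\to\infty$. Let $\mathfrak{m}$ be a matching of $\mathcal{G}_n$ chosen from the Gibbs measure $\mu$, and let $U_{[1:k]}$ and $U_{[k+1:n]}$ denote the number of unpaired vertices of $\mathfrak{m}$ whose $G_n$-coordinates are in $[1,k]$ and $[k+1,n]$, respectively. Let $\sigma_Q^2$ be the deterministic limit in probability of $n^{-1}(\langle U^2\rangle_n-\langle U\rangle_n^2)$, where $U$ is the total number of unpaired vertices (this limit exists). Then, as $n\to\infty$, $$n^{-1/2}\bigl(U_{[1:k]}-\langle U_{[1:k]}\rangle_n,\ U_{[k+1:n]}-\langle U_{[k+1:n]}\rangle_n\bigr)\to N^2\bigl(0,\ \sigma_Q^2\cdot\operatorname{Diag}(t,1-t)\bigr)$$ in distribution under $\mu$, in probability with respect to the weights; that is, for every bounded continuous $\varphi:\mathbb{R}^2\to\mathbb{R}$, the Gibbs average of $\varphi$ of the vector on the left converges in probability to $\mathbb{E}\,\varphi(Y)$, where $Y$ is a centered bivariate Gaussian vector with covariance matrix $\sigma_Q^2\operatorname{Diag}(t,1-t)$.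
   Context: Let $H=(V_H,E_H)$ be a fixed finite graph with $|V_H|=h\ge 1$, and let $G_n$ be the line graph (path) on the $n$ vertices $1,\dots,n$ with $i\sim i+1$. The cylinder graph $\mathcal{G}_n=G_n\times H$ is the Cartesian product: its vertex set is $V=\{1,\dots,n\}\times V_H$, and $(i,j)\sim(i',j')$ iff either $i\sim i'$ in $G_n$ and $j=j'$, or $i=i'$ and $j\sim j'$ in $H$; $i$ is called the $G_n$-coordinate of $(i,j)$. Let $E$ be its edge set. The vertex weights $\{\nu_v\}_{v\in V}$ are i.i.d. real random variables; the edge weights $\{\omega_e\}_{e\in E}$ are i.i.d. real random variables, independent of the vertex weights, possibly with a different law; the two laws do not depend on $n$. A matching $\mathfrak{m}\subseteq E$ is a (possibly empty) set of pairwise vertex-disjoint edges; $\mathcal{M}$ is the set of all matchings of $\mathcal{G}_n$; $v\notin\mathfrak{m}$ ($v$ is unpaired) means that $v$ is not covered by any edge of $\mathfrak{m}$. The Hamiltonian is $\mathcal{H}(\mathfrak{m})=\sum_{v\notin\mathfrak{m}}\nu_v+\sum_{e\in\mathfrak{m}}\omega_e$, the partition function is $Z_n=\sum_{\mathfrak{m}\in\mathcal{M}}\exp(\mathcal{H}(\mathfrak{m}))$, and the (random) Gibbs measure is $\mu(\mathfrak{m})=Z_n^{-1}\exp(\mathcal{H}(\mathfrak{m}))$. For $X:\mathcal{M}\to\mathbb{R}$, $\langle X\rangle_n=\sum_{\mathfrak{m}\in\mathcal{M}}X(\mathfrak{m})\mu(\mathfrak{m})$ is its Gibbs average, a random variable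 depending on the weights. *)

theory Defs
  imports "HOL-Probability.Probability"
begin

text \<open>Undirected edges are two-element sets of vertices.\<close>

definition finite_simple_graph :: "'a set \<Rightarrow> 'a set set \<Rightarrow> bool" where
  "finite_simple_graph V E \<longleftrightarrow> finite V \<and> (\<forall>e\<in>E. e \<subseteq> V \<and> card e = 2)"

text \<open>The path coordinate is an \<open>int\<close>, so that it can be compared with integer cut points.\<close>

definition cyl_vertices :: "'a set \<Rightarrow> nat \<Rightarrow> (int \<times> 'a) set" where
  "cyl_vertices VH n = {1..int n} \<times> VH"

definition cyl_edges :: "'a set \<Rightarrow> 'a set set \<Rightarrow> nat \<Rightarrow> (int \<times> 'a) set set" where
  "cyl_edges VH EH n = {{(i, j), (i', j')} | i j i' j'.
     (i, j) \<in> cyl_vertices VH n \<and> (i', j') \<in> cyl_vertices VH n \<and>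
     ((\<bar>i - i'\<bar> = 1 \<and> j = j') \<or> (i = i' \<and> {j, j'} \<in> EH))}"

definition matchings :: "'v set set \<Rightarrow> 'v set set set" where
  "matchings E = {m. m \<subseteq> E \<and> pairwise disjnt m}"

definition unpaired :: "'v set \<Rightarrow> 'v set set \<Rightarrow> 'v set" where
  "unpaired V m = V - \<Union>m"

definition hamiltonian ::
    "'v set \<Rightarrow> ('v \<Rightarrow> real) \<Rightarrow> ('v set \<Rightarrow> real) \<Rightarrow> 'v set set \<Rightarrow> real" where
  "hamiltonian V nu om m = (\<Sum>v\<in>unpaired V m. nu v) + (\<Sum>e\<in>m. om e)"

definition partition_function ::
    "'v set \<Rightarrow> 'v set set \<Rightarrow> ('v \<Rightarrow> real) \<Rightarrow> ('v set \<Rightarrow> real) \<Rightarrow> real" where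
  "partition_function V E nu om = (\<Sum>m\<in>matchings E. exp (hamiltonian V nu om m))"

definition gibbs_weight ::
    "'v set \<Rightarrow> 'v set set \<Rightarrow> ('v \<Rightarrow> real) \<Rightarrow> ('v set \<Rightarrow> real) \<Rightarrow> 'v set set \<Rightarrow> real" where
  "gibbs_weight V E nu om m = exp (hamiltonian V nu om m) / partition_function V E nu om"

definition gibbs_average ::
    "'v set \<Rightarrow> 'v set set \<Rightarrow> ('v \<Rightarrow> real) \<Rightarrow> ('v set \<Rightarrow> real) \<Rightarrow> ('v set set \<Rightarrow> real) \<Rightarrow> real" where
  "gibbs_average V E nu om X = (\<Sum>m\<in>matchings E. X m * gibbs_weight V E nu om m)"

definition cyl_average ::
    "'a set \<Rightarrow> 'a set set \<Rightarrow> nat \<Rightarrow> (int \<times> 'a \<Rightarrow> real) \<Rightarrow> ((int \<times> 'a) set \<Rightarrow> real) \<Rightarrow>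
     ((int \<times> 'a) set set \<Rightarrow> real) \<Rightarrow> real" where
  "cyl_average VH EH n = gibbs_average (cyl_vertices VH n) (cyl_edges VH EH n)"

definition num_unpaired :: "'a set \<Rightarrow> nat \<Rightarrow> (int \<times> 'a) set set \<Rightarrow> real" where
  "num_unpaired VH n m = real (card (unpaired (cyl_vertices VH n) m))"

definition num_unpaired_in :: "'a set \<Rightarrow> nat \<Rightarrow> int set \<Rightarrow> (int \<times> 'a) set set \<Rightarrow> real" where
  "num_unpaired_in VH n I m = real (card {v \<in> unpaired (cyl_vertices VH n) m. fst v \<in> I})"

text \<open>All vertex and edge weights together form one independent family; the vertex weights have
  common law \<open>Lnu\<close> and the edge weights common law \<open>Lom\<close>.\<close>

definition iid_weights ::
    "'w measure \<Rightarrow> 'v set \<Rightarrow> 'v set set \<Rightarrow> ('w \<Rightarrow> 'v \<Rightarrow> real) \<Rightarrow> ('w \<Rightarrow> 'v set \<Rightarrow> real) \<Rightarrow>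
     real measure \<Rightarrow> real measure \<Rightarrow> bool" where
  "iid_weights P V E nu om Lnu Lom \<longleftrightarrow>
     prob_space P \<and>
     prob_space.indep_vars P (\<lambda>_. borel)
       (\<lambda>x w. case x of Inl v \<Rightarrow> nu w v | Inr e \<Rightarrow> om w e) (Inl ` V \<union> Inr ` E) \<and>
     (\<forall>v\<in>V. distr P borel (\<lambda>w. nu w v) = Lnu) \<and>
     (\<forall>e\<in>E. distr P borel (\<lambda>w. om w e) = Lom)"

text \<open>The random variables \<open>X n\<close> may live on different probability spaces \<open>P n\<close>; the (irrelevant)
  index \<open>n = 0\<close> is exempted from measurability.\<close>

definition tendsto_in_probability ::
    "(nat \<Rightarrow> 'w measure) \<Rightarrow> (nat \<Rightarrow> 'w \<Rightarrow> real) \<Rightarrow> real \<Rightarrow> bool" where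
  "tendsto_in_probability P X c \<longleftrightarrow>
     (\<forall>n\<ge>1. X n \<in> borel_measurable (P n)) \<and>
     (\<forall>d>0. (\<lambda>n. measure (P n) {w \<in> space (P n). \<bar>X n w - c\<bar> > d}) \<longlonglongrightarrow> 0)"

text \<open>Variance zero is allowed and gives the point mass.\<close>

definition normal_law :: "real \<Rightarrow> real \<Rightarrow> real measure" where
  "normal_law a s2 =
     (if s2 = 0 then return borel a else density lborel (normal_density a (sqrt s2)))"

text \<open>\<open>N\<close> is the centered Gaussian law with covariance matrix \<open>S\<close>: every linear functional
  \<open>x \<mapsto> u \<bullet> x\<close> is normal with mean 0 and variance \<open>u\<^sup>T S u\<close>.\<close>

definition centered_gaussian_law :: "(real^'n) measure \<Rightarrow> real^'n^'n \<Rightarrow> bool" where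
  "centered_gaussian_law N S \<longleftrightarrow>
     prob_space N \<and> sets N = sets borel \<and> transpose S = S \<and>
     (\<forall>u. distr N borel (\<lambda>x. u \<bullet> x) = normal_law 0 (u \<bullet> (S *v u)))"

definition diag_matrix :: "real^'n \<Rightarrow> real^'n^'n" where
  "diag_matrix d = (\<chi> i j. if i = j then d $ i else 0)"

end

theory Submission
  imports Defs "HOL-Complex_Analysis.Complex_Analysis"
begin

text \<open>Add \<open>z c\<^sub>v\<close> to every vertex weight, where \<open>c\<close> is constant on each of the two halves of the
  cylinder. By Heilmann and Lieb the partition function has no zero for \<open>\<bar>Im z\<bar> \<le> 1\<close>, \<open>\<bar>c\<^sub>v\<bar> \<le> 1\<close>,
  and its logarithmic derivative is \<open>O(n)\<close> there, uniformly in the weights. Cauchy's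
  inequalities then bound all cumulants of \<open>\<Sum>\<^sub>v c\<^sub>v 1[v unpaired]\<close> by \<open>O(n)\<close>. Two consequences are
  deterministic: a linear statistic is Gaussian up to \<open>O(n\<^sup>-\<^sup>1\<^sup>/\<^sup>2)\<close> once its quenched variance is known,
  and that variance is, up to \<open>O(s n)\<close>, the second difference of step \<open>s\<close> of the free energy.

  Only the free energy needs probability. It splits at a layer into two independent parts up to a
  boundary term with bounded mean, so the gain of free energy caused by a tilt obeys a law of
  large numbers by cutting the cylinder into blocks, and the two halves contribute \<open>t\<close> and \<open>1 - t\<close>
  times the same function. Hence the quenched covariance matrix converges to
  \<open>\<sigma>\<^sup>2 Diag(t, 1 - t)\<close>.\<close>

section \<open>Matching polynomials and the Heilmann--Lieb theorem\<close>

text \<open>The strip |Im z| at most 1 comes from the vertex activities: the phase of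
  \<open>exp (nu v + z * c v)\<close> is at most 1 < pi/3 there, so the activity lies in the right
  half-plane, where Heilmann and Lieb apply, with real part at least half its modulus. This holds
  for all real weights, hence the deterministic bounds.

  Convergence of free energies alone does not give convergence of second derivatives. The
  third-order error is uniform in n and in the weights, so n may go to infinity with the step
  \<open>s\<close> fixed, and \<open>s\<close> to 0 afterwards.

  A gain is a difference of two free energies and therefore bounded by the number of vertices,
  whatever the weights. Block gains have variances for this reason, and moments of the weights enter
  through the mean cost of a cut bond. Different n may use unrelated probability spaces, so limits
  are extracted from expectations and not from pathwise arguments.

  Asymptotic independence of the halves is not proved directly: the limiting variance of
  \<open>u * U1 + v * U2\<close>, with \<open>U1\<close>, \<open>U2\<close> the two counts, has no
  term in \<open>u * v\<close>, and characteristic functions do the rest.\<close>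

definition matching_poly :: "('v set \<Rightarrow> 'b::comm_semiring_1) \<Rightarrow> 'v set set \<Rightarrow> 'b" where
  "matching_poly r E = (\<Sum>m\<in>matchings E. \<Prod>e\<in>m. r e)"

lemma finite_matchings: "finite E \<Longrightarrow> finite (matchings E)"
  unfolding matchings_def by (rule finite_subset[of _ "Pow E"]) auto

lemma finite_in_matchings: "finite E \<Longrightarrow> m \<in> matchings E \<Longrightarrow> finite m"
  unfolding matchings_def by (blast intro: finite_subset)

lemma empty_in_matchings: "{} \<in> matchings E"
  by (simp add: matchings_def)

lemma matching_poly_empty [simp]:
  fixes r :: "'b set \<Rightarrow> 'c::comm_semiring_1"
  shows "matching_poly r {} = 1"
proof -
  have "matchings ({} :: 'b set set) = {{}}" by (auto simp: matchings_def)
  then show ?thesis by (simp add: matching_poly_def)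
qed

lemma matchings_insert:
  assumes "e \<notin> E"
  shows "matchings (insert e E) = matchings E \<union> insert e ` matchings {f \<in> E. disjnt f e}"
proof (intro equalityI subsetI)
  fix m assume m: "m \<in> matchings (insert e E)"
  show "m \<in> matchings E \<union> insert e ` matchings {f \<in> E. disjnt f e}"
  proof (cases "e \<in> m")
    case True
    have "m - {e} \<in> matchings {f \<in> E. disjnt f e}"
      using m True by (auto simp: matchings_def pairwise_def)
    moreover have "m = insert e (m - {e})" using True by auto
    ultimately show ?thesis by blast
  next
    case False
    then show ?thesis using m by (auto simp: matchings_def)
  qed
next
  fix m assume "m \<in> matchings E \<union> insert e ` matchings {f \<in> E. disjnt f e}"
  then show "m \<in> matchings (insert e E)"
    by (fastforce simp: matchings_def pairwise_insert disjnt_sym)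
qed

text \<open>A matching avoids \<open>e\<close>, or consists of \<open>e\<close> and a matching of
  the edges disjoint from it. This recurrence is behind the factorisation, the star expansion and
  the cut bound below.\<close>

lemma matching_poly_insert:
  assumes "finite E" "e \<notin> E"
  shows "matching_poly r (insert e E)
    = matching_poly r E + r e * matching_poly r {f \<in> E. disjnt f e}"
proof -
  let ?D = "{f \<in> E. disjnt f e}"
  have notin: "e \<notin> m" if "m \<in> matchings E \<or> m \<in> matchings ?D" for m
    using that assms(2) by (auto simp: matchings_def)
  have inj: "inj_on (insert e) (matchings ?D)"
  proof (rule inj_onI)
    fix m m' assume "m \<in> matchings ?D" "m' \<in> matchings ?D" and eq: "insert e m = insert e m'"
    then have "e \<notin> m" "e \<notin> m'" using notin by auto
    then show "m = m'" using eq by (simp add: insert_ident)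
  qed
  have disj: "matchings E \<inter> insert e ` matchings ?D = {}"
    using notin by blast
  have "matching_poly r (insert e E)
    = (\<Sum>m\<in>matchings E. \<Prod>e\<in>m. r e) + (\<Sum>m\<in>insert e ` matchings ?D. \<Prod>e\<in>m. r e)"
    unfolding matching_poly_def matchings_insert[OF assms(2)]
    by (rule sum.union_disjoint) (use assms disj in \<open>simp_all add: finite_matchings\<close>)
  also have "(\<Sum>m\<in>insert e ` matchings ?D. \<Prod>e\<in>m. r e) = (\<Sum>m\<in>matchings ?D. r e * (\<Prod>e\<in>m. r e))"
    unfolding sum.reindex[OF inj] o_def
  proof (intro sum.cong refl prod.insert)
    fix m assume m: "m \<in> matchings ?D"
    show "finite m" by (rule finite_in_matchings[OF _ m]) (use assms in simp)
    show "e \<notin> m" using m notin by simp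
  qed
  finally show ?thesis by (simp add: matching_poly_def sum_distrib_left)
qed

text \<open>Induction on the number of edges and not on the set: the recurrence leads to the edges
  disjoint from \<open>e\<close>, which may be far fewer. Distinctness is asked for separately
  because the empty set is disjoint from itself.\<close>

lemma matching_poly_union_disjnt:
  assumes "finite E1" "finite E2" "\<And>e f. e \<in> E1 \<Longrightarrow> f \<in> E2 \<Longrightarrow> disjnt e f \<and> e \<noteq> f"
  shows "matching_poly r (E1 \<union> E2) = matching_poly r E1 * matching_poly r E2"
  using assms
proof (induction "card E1" arbitrary: E1 rule: less_induct)
  case less
  show ?case
  proof (cases "E1 = {}")
    case False
    then obtain e E where E1: "E1 = insert e E" "e \<notin> E" by (metis Set.set_insert equals0I)
    let ?D = "{f \<in> E. disjnt f e}"
    have fin: "finite E" using less.prems(1) E1 by auto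
    have "e \<notin> E \<union> E2" using E1 less.prems(3) by auto
    moreover have "{f \<in> E \<union> E2. disjnt f e} = ?D \<union> E2"
      using less.prems(3) E1 by (auto simp: disjnt_sym)
    ultimately have "matching_poly r (E1 \<union> E2)
       = matching_poly r (E \<union> E2) + r e * matching_poly r (?D \<union> E2)"
      using matching_poly_insert[of "E \<union> E2" e r] fin less.prems(2) E1 by simp
    moreover have "matching_poly r (E \<union> E2) = matching_poly r E * matching_poly r E2"
      by (rule less.hyps) (use less.prems E1 fin in auto)
    moreover have "matching_poly r (?D \<union> E2) = matching_poly r ?D * matching_poly r E2"
      by (rule less.hyps) (use less.prems E1 fin in \<open>auto intro!: le_imp_less_Suc card_mono\<close>)
    moreover have "matching_poly r E1 = matching_poly r E + r e * matching_poly r ?D"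
      using matching_poly_insert[of E e r] fin E1 by simp
    ultimately show ?thesis by (simp add: algebra_simps)
  qed simp
qed

text \<open>At most one of several pairwise meeting edges belongs to a matching. The case of
  interest is the star of edges at one vertex; with \<open>e = f\<close> the hypothesis says that
  the edges of \<open>S\<close> are nonempty.\<close>

lemma matching_poly_star:
  assumes "finite S" "finite E" "S \<inter> E = {}" "\<And>e f. e \<in> S \<Longrightarrow> f \<in> S \<Longrightarrow> \<not> disjnt e f"
  shows "matching_poly r (E \<union> S)
    = matching_poly r E + (\<Sum>e\<in>S. r e * matching_poly r {f \<in> E. disjnt f e})"
  using assms
proof (induction S rule: finite_induct)
  case (insert e S)
  have "{f \<in> E \<union> S. disjnt f e} = {f \<in> E. disjnt f e}" using insert.prems by auto
  moreover have "matching_poly r (insert e (E \<union> S))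
     = matching_poly r (E \<union> S) + r e * matching_poly r {f \<in> E \<union> S. disjnt f e}"
    by (rule matching_poly_insert) (use insert in auto)
  moreover have "matching_poly r (E \<union> S)
     = matching_poly r E + (\<Sum>e\<in>S. r e * matching_poly r {f \<in> E. disjnt f e})"
    by (rule insert.IH) (use insert.prems in auto)
  ultimately show ?case using insert by (simp add: algebra_simps)
qed simp

lemma matching_poly_mono:
  fixes r :: "'v set \<Rightarrow> real"
  assumes "finite F" "E \<subseteq> F" "\<And>e. e \<in> F \<Longrightarrow> r e \<ge> 0"
  shows "matching_poly r E \<le> matching_poly r F"
  unfolding matching_poly_def
proof (rule sum_mono2)
  show "finite (matchings F)" using assms by (simp add: finite_matchings)
  show "matchings E \<subseteq> matchings F" using assms by (auto simp: matchings_def)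
  show "0 \<le> prod r m" if "m \<in> matchings F - matchings E" for m
    using that assms by (intro prod_nonneg) (auto simp: matchings_def)
qed

lemma matching_poly_pos:
  fixes r :: "'v set \<Rightarrow> real"
  assumes "finite E" "\<And>e. e \<in> E \<Longrightarrow> r e \<ge> 0"
  shows "matching_poly r E \<ge> 1"
  using matching_poly_mono[of E "{}" r] assms by auto

text \<open>Each edge put back multiplies the sum by at most \<open>1 + r e\<close>, since the
  matchings using it are counted by a smaller sum. For a cut, the change of free energy is thus
  bounded by a sum over bonds, whatever the size of the two sides.\<close>

lemma matching_poly_union_bounds:
  fixes r :: "'v set \<Rightarrow> real"
  assumes "finite C" "finite E" "\<And>e. e \<in> E \<union> C \<Longrightarrow> r e \<ge> 0"
  shows "matching_poly r E \<le> matching_poly r (E \<union> C)"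
    and "matching_poly r (E \<union> C) \<le> matching_poly r E * (\<Prod>e\<in>C. 1 + r e)"
proof -
  show "matching_poly r E \<le> matching_poly r (E \<union> C)"
    by (rule matching_poly_mono) (use assms in auto)
  show "matching_poly r (E \<union> C) \<le> matching_poly r E * (\<Prod>e\<in>C. 1 + r e)"
    using assms
  proof (induction C rule: finite_induct)
    case (insert e C)
    have IH: "matching_poly r (E \<union> C) \<le> matching_poly r E * (\<Prod>e\<in>C. 1 + r e)"
      by (rule insert.IH) (use insert.prems in auto)
    have re: "r e \<ge> 0" using insert.prems by auto
    have "matching_poly r (insert e (E \<union> C)) \<le> matching_poly r (E \<union> C) * (1 + r e)"
    proof (cases "e \<in> E \<union> C")
      case True
      then show ?thesis
        using re matching_poly_pos[of "E \<union> C" r] insert by (auto simp: insert_absorb mult_le_cancel_left1)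
    next
      case False
      have "matching_poly r {f \<in> E \<union> C. disjnt f e} \<le> matching_poly r (E \<union> C)"
        by (rule matching_poly_mono) (use insert in auto)
      then show ?thesis
        using False re insert matching_poly_insert[of "E \<union> C" e r]
        by (simp add: algebra_simps mult_left_mono)
    qed
    also have "\<dots> \<le> (matching_poly r E * (\<Prod>e\<in>C. 1 + r e)) * (1 + r e)"
      using IH re by (intro mult_right_mono) auto
    finally show ?case using insert by (simp add: mult_ac)
  qed simp
qed

section \<open>Monomer-dimer sums with vertex and edge activities\<close>

definition monomer_dimer ::
    "'v set set \<Rightarrow> ('v \<Rightarrow> 'b::comm_semiring_1) \<Rightarrow> ('v set \<Rightarrow> 'b) \<Rightarrow> 'v set \<Rightarrow> 'b" where
  "monomer_dimer E x y W =
     (\<Sum>m\<in>matchings {e \<in> E. e \<subseteq> W}. (\<Prod>v\<in>unpaired W m. x v) * (\<Prod>e\<in>m. y e))"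

lemma prod_unpaired:
  fixes x :: "'v \<Rightarrow> 'b::field"
  assumes "finite W" "m \<in> matchings {e \<in> E. e \<subseteq> W}" "\<And>v. v \<in> W \<Longrightarrow> x v \<noteq> 0"
  shows "(\<Prod>v\<in>unpaired W m. x v) = (\<Prod>v\<in>W. x v) / (\<Prod>e\<in>m. \<Prod>v\<in>e. x v)"
proof -
  have sub: "\<And>e. e \<in> m \<Longrightarrow> e \<subseteq> W" and disj: "pairwise disjnt m"
    using assms(2) by (auto simp: matchings_def)
  have "(\<Prod>v\<in>\<Union>m. x v) = (\<Prod>e\<in>m. \<Prod>v\<in>e. x v)"
  proof (subst prod.Union_disjoint)
    show "\<forall>A\<in>m. finite A" using sub assms(1) finite_subset by blast
    show "\<forall>A\<in>m. \<forall>B\<in>m. A \<noteq> B \<longrightarrow> A \<inter> B = {}"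
      using disj by (auto simp: pairwise_def disjnt_def)
  qed simp
  moreover have "(\<Prod>v\<in>W. x v) = (\<Prod>v\<in>W - \<Union>m. x v) * (\<Prod>v\<in>\<Union>m. x v)"
    by (rule prod.subset_diff) (use sub assms(1) in auto)
  moreover have "(\<Prod>v\<in>\<Union>m. x v) \<noteq> 0"
  proof -
    have "finite (\<Union>m)" by (rule finite_subset[OF _ assms(1)]) (use sub in auto)
    then show ?thesis using sub assms(3) by (auto simp: prod_zero_iff)
  qed
  ultimately show ?thesis by (simp add: unpaired_def field_simps)
qed

text \<open>Factoring out the configuration without dimers moves the vertex activities into the edge
  weights, which makes the recurrences of \<open>matching_poly\<close> available; nonzero activities
  justify the division.\<close>

lemma monomer_dimer_eq_matching_poly:
  fixes x :: "'v \<Rightarrow> 'b::field"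
  assumes "finite W" "\<And>v. v \<in> W \<Longrightarrow> x v \<noteq> 0"
  shows "monomer_dimer E x y W
    = (\<Prod>v\<in>W. x v) * matching_poly (\<lambda>e. y e / (\<Prod>v\<in>e. x v)) {e \<in> E. e \<subseteq> W}"
  unfolding monomer_dimer_def matching_poly_def sum_distrib_left
  by (intro sum.cong refl) (simp add: prod_unpaired[OF assms(1) _ assms(2)] prod_dividef)

text \<open>Either \<open>v\<close> is unpaired or exactly one edge at \<open>v\<close> is used: the
  star recurrence for the edges at \<open>v\<close>. Its terms are sums over smaller vertex sets
  with the same \<open>E\<close>, as the induction of Heilmann and Lieb needs.\<close>

lemma monomer_dimer_rec:
  fixes x :: "'v \<Rightarrow> 'b::field"
  assumes "finite W" "finite E" "v \<in> W" "\<And>v. v \<in> W \<Longrightarrow> x v \<noteq> 0"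
  shows "monomer_dimer E x y W = x v * monomer_dimer E x y (W - {v})
    + (\<Sum>e\<in>{e \<in> E. e \<subseteq> W \<and> v \<in> e}. y e * monomer_dimer E x y (W - e))"
proof -
  let ?S = "{e \<in> E. e \<subseteq> W \<and> v \<in> e}" and ?r = "\<lambda>e. y e / (\<Prod>v\<in>e. x v)"
  let ?M = "\<lambda>W. matching_poly ?r {e \<in> E. e \<subseteq> W}"
  have md: "monomer_dimer E x y U = (\<Prod>v\<in>U. x v) * ?M U" if "U \<subseteq> W" for U
    by (rule monomer_dimer_eq_matching_poly) (use that assms finite_subset in auto)
  have "{e \<in> E. e \<subseteq> W} = {e \<in> E. e \<subseteq> W - {v}} \<union> ?S" by auto
  then have "?M W = ?M (W - {v}) + (\<Sum>e\<in>?S. ?r e * matching_poly ?r {f \<in> {e \<in> E. e \<subseteq> W - {v}}. disjnt f e})"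
    using matching_poly_star[of ?S "{e \<in> E. e \<subseteq> W - {v}}" ?r] assms by (auto simp: disjnt_def)
  also have "(\<Sum>e\<in>?S. ?r e * matching_poly ?r {f \<in> {e \<in> E. e \<subseteq> W - {v}}. disjnt f e})
     = (\<Sum>e\<in>?S. ?r e * ?M (W - e))"
  proof (intro sum.cong refl arg_cong[where f = "\<lambda>X. _ * matching_poly ?r X"])
    fix e assume "e \<in> ?S"
    then show "{f \<in> {e \<in> E. e \<subseteq> W - {v}}. disjnt f e} = {f \<in> E. f \<subseteq> W - e}"
      by (auto simp: disjnt_def)
  qed
  finally have "monomer_dimer E x y W
     = (\<Prod>v\<in>W. x v) * ?M (W - {v}) + (\<Sum>e\<in>?S. (\<Prod>v\<in>W. x v) * (?r e * ?M (W - e)))"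
    by (simp add: md algebra_simps sum_distrib_left)
  moreover have "(\<Prod>v\<in>W. x v) = x v * (\<Prod>v\<in>W - {v}. x v)"
    using assms by (simp add: prod.remove)
  moreover have "(\<Prod>v\<in>W. x v) * (?r e * ?M (W - e)) = y e * monomer_dimer E x y (W - e)" if "e \<in> ?S" for e
  proof -
    have "(\<Prod>v\<in>W. x v) = (\<Prod>v\<in>W - e. x v) * (\<Prod>v\<in>e. x v)"
      by (rule prod.subset_diff) (use that assms in auto)
    moreover have "(\<Prod>v\<in>e. x v) \<noteq> 0"
      using that assms finite_subset[of e W] by (auto simp: prod_zero_iff)
    ultimately show ?thesis by (simp add: md)
  qed
  ultimately show ?thesis by (simp add: md)
qed

text \<open>The Heilmann--Lieb argument: in \<open>Z(W) / Z(W - v) = x\<^sub>v + (\<Sum>e = {v, u}. y\<^sub>e Z(W - e) / Z(W - v))\<close>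
  each quotient on the right is the inverse of a number in the right half-plane, by induction.\<close>

lemma monomer_dimer_half_plane:
  fixes x :: "'v \<Rightarrow> complex" and y :: "'v set \<Rightarrow> real"
  assumes "finite W" "finite E" "\<And>e. e \<in> E \<Longrightarrow> card e = 2"
    and "\<And>v. v \<in> W \<Longrightarrow> Re (x v) > 0" "\<And>e. e \<in> E \<Longrightarrow> y e \<ge> 0"
  shows "monomer_dimer E x (\<lambda>e. of_real (y e)) W \<noteq> 0 \<and>
    (\<forall>v\<in>W. Re (monomer_dimer E x (\<lambda>e. of_real (y e)) W
              / monomer_dimer E x (\<lambda>e. of_real (y e)) (W - {v})) \<ge> Re (x v))"
  using assms(1,4)
proof (induction "card W" arbitrary: W rule: less_induct)
  case less
  let ?Z = "monomer_dimer E x (\<lambda>e. of_real (y e))"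
  have IH: "?Z U \<noteq> 0" "\<And>v. v \<in> U \<Longrightarrow> Re (?Z U / ?Z (U - {v})) \<ge> Re (x v)" if "U \<subset> W" for U
  proof -
    have "card U < card W" using that less.prems(1) by (rule psubset_card_mono[rotated])
    moreover have "finite U" using that less.prems(1) finite_subset by auto
    ultimately show "?Z U \<noteq> 0" "\<And>v. v \<in> U \<Longrightarrow> Re (?Z U / ?Z (U - {v})) \<ge> Re (x v)"
      using less.hyps[of U] less.prems(2) that by (meson psubsetD)+
  qed
  have xnz: "x v \<noteq> 0" if "v \<in> W" for v using less.prems(2)[OF that] by auto
  have *: "Re (?Z W / ?Z (W - {v})) \<ge> Re (x v)" if v: "v \<in> W" for v
  proof -
    let ?S = "{e \<in> E. e \<subseteq> W \<and> v \<in> e}"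
    have Zv: "?Z (W - {v}) \<noteq> 0" by (rule IH) (use v in auto)
    have "?Z W / ?Z (W - {v}) = x v + (\<Sum>e\<in>?S. of_real (y e) * (?Z (W - e) / ?Z (W - {v})))"
      using Zv by (simp add: monomer_dimer_rec[OF less.prems(1) assms(2) v xnz] add_divide_distrib sum_divide_distrib)
    moreover have "Re (of_real (y e) * (?Z (W - e) / ?Z (W - {v}))) \<ge> 0" if e: "e \<in> ?S" for e
    proof -
      obtain u where u: "e = {v, u}" "u \<noteq> v"
        using e assms(3)[of e] by (auto simp: card_2_iff doubleton_eq_iff)
      have We: "W - e = W - {v} - {u}" using u by auto
      have "Re (x u) \<le> Re (?Z (W - {v}) / ?Z (W - e))"
        unfolding We by (rule IH) (use u e v in auto)
      moreover have "Re (x u) > 0" using u e less.prems(2) by auto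
      moreover have "Re (inverse q) \<ge> 0" if "Re q \<ge> 0" for q :: complex
        using that by (simp add: divide_nonneg_nonneg)
      ultimately have "Re (inverse (?Z (W - {v}) / ?Z (W - e))) \<ge> 0"
        by (meson less_imp_le order_trans)
      then have "Re (?Z (W - e) / ?Z (W - {v})) \<ge> 0" by (simp only: inverse_divide)
      then show ?thesis using assms(5)[of e] e
        by (simp only: times_complex.simps Re_complex_of_real Im_complex_of_real) simp
    qed
    then have "(\<Sum>e\<in>?S. Re (of_real (y e) * (?Z (W - e) / ?Z (W - {v})))) \<ge> 0"
      by (rule sum_nonneg)
    ultimately show ?thesis by (simp only: plus_complex.simps Re_sum)
  qed
  show ?case
  proof (cases "W = {}")
    case True
    have no_edges: "{e \<in> E. e \<subseteq> {}} = {}" using assms(3) by fastforce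
    have "?Z {} = 1"
      by (subst monomer_dimer_eq_matching_poly) (simp_all only: no_edges matching_poly_empty prod.empty, simp_all)
    then show ?thesis using True by simp
  next
    case False
    then obtain v where v: "v \<in> W" by auto
    have "Re (?Z W / ?Z (W - {v})) > 0" using *[OF v] less.prems(2)[OF v] by linarith
    then have "?Z W \<noteq> 0" by auto
    then show ?thesis using * by auto
  qed
qed

section \<open>Generating functions of tilted Gibbs weights\<close>

definition tilt_sum :: "('v \<Rightarrow> real) \<Rightarrow> 'v set \<Rightarrow> 'v set set \<Rightarrow> real" where
  "tilt_sum c V m = (\<Sum>v\<in>unpaired V m. c v)"

definition exp_gen :: "'m set \<Rightarrow> ('m \<Rightarrow> real) \<Rightarrow> ('m \<Rightarrow> real) \<Rightarrow> complex \<Rightarrow> complex" where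
  "exp_gen M p a z = (\<Sum>m\<in>M. of_real (p m) * exp (z * of_real (a m)))"

text \<open>The derivative of \<open>exp_gen\<close> in \<open>z\<close>. As an explicit sum it lets
  a bound on the logarithmic derivative be stated without division, for unnormalised weights
  too.\<close>

definition exp_gen' :: "'m set \<Rightarrow> ('m \<Rightarrow> real) \<Rightarrow> ('m \<Rightarrow> real) \<Rightarrow> complex \<Rightarrow> complex" where
  "exp_gen' M p a z = (\<Sum>m\<in>M. of_real (a m) * (of_real (p m) * exp (z * of_real (a m))))"

locale finite_graph =
  fixes V :: "'v set" and E :: "'v set set"
  assumes finite_V: "finite V" and edges: "\<And>e. e \<in> E \<Longrightarrow> e \<subseteq> V \<and> card e = 2"
begin

lemma finite_E: "finite E"
  by (rule finite_subset[of _ "Pow V"]) (use finite_V edges in auto)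

lemma edges_within: "{e \<in> E. e \<subseteq> V} = E"
  using edges by auto

lemma finite_unpaired: "finite (unpaired V m)"
  using finite_V by (simp add: unpaired_def)

lemma tilted_weight:
  assumes "m \<in> matchings E"
  shows "of_real (exp (hamiltonian V nu om m)) * exp (z * of_real (tilt_sum c V m))
     = (\<Prod>v\<in>unpaired V m. exp (of_real (nu v) + z * of_real (c v))) * (\<Prod>e\<in>m. of_real (exp (om e)) :: complex)"
proof -
  have "finite m" using assms finite_E by (rule finite_in_matchings[rotated])
  then show ?thesis
    using finite_unpaired[of m]
    by (simp add: hamiltonian_def tilt_sum_def exp_add exp_sum of_real_prod of_real_exp[symmetric]
        sum_distrib_left prod.distrib algebra_simps flip: exp_of_real)
qed

text \<open>The tilt is absorbed into the vertex activities, so the zeros in \<open>z\<close> are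
  governed by the half-plane result for \<open>monomer_dimer\<close>.\<close>

lemma exp_gen_hamiltonian:
  "exp_gen (matchings E) (\<lambda>m. exp (hamiltonian V nu om m)) (tilt_sum c V) z
     = monomer_dimer E (\<lambda>v. exp (of_real (nu v) + z * of_real (c v))) (\<lambda>e. of_real (exp (om e))) V"
  unfolding exp_gen_def monomer_dimer_def edges_within
  by (intro sum.cong refl tilted_weight)

text \<open>The logarithmic derivative is bounded by Heilmann--Lieb:
  \<open>\<bar>x\<^sub>v Z(V - v) / Z(V)\<bar> \<le> \<bar>x\<^sub>v\<bar> / Re x\<^sub>v = 1 / cos (c\<^sub>v Im z)\<close>.\<close>

lemma exp_gen_hamiltonian_bound:
  assumes c: "\<And>v. v \<in> V \<Longrightarrow> \<bar>c v\<bar> \<le> 1" and z: "\<bar>Im z\<bar> \<le> 1"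
  shows "exp_gen (matchings E) (\<lambda>m. exp (hamiltonian V nu om m)) (tilt_sum c V) z \<noteq> 0" (is "?G \<noteq> 0")
    and "cmod (exp_gen' (matchings E) (\<lambda>m. exp (hamiltonian V nu om m)) (tilt_sum c V) z)
        \<le> 2 * real (card V) * cmod (exp_gen (matchings E) (\<lambda>m. exp (hamiltonian V nu om m)) (tilt_sum c V) z)"
      (is "cmod ?D \<le> _")
proof -
  define x where "x v = exp (of_real (nu v) + z * of_real (c v))" for v
  define Z where "Z = monomer_dimer E x (\<lambda>e. of_real (exp (om e)))"
  define w where "w m = (\<Prod>v\<in>unpaired V m. x v) * (\<Prod>e\<in>m. of_real (exp (om e)) :: complex)" for m
  \<comment> \<open>The phase of the activity at \<open>v\<close> is \<open>Im z * c v\<close>, and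
    1 < pi/3. The factor 2 of the final bound is the inverse of this 1/2.\<close>
  have cos_ge: "cos (Im z * c v) \<ge> 1/2" if "v \<in> V" for v
  proof -
    have "\<bar>Im z * c v\<bar> \<le> 1" using c[OF that] z by (simp add: abs_mult mult_le_one)
    moreover have "1 \<le> pi / 3" using pi_gt3 by simp
    ultimately have "cos \<bar>Im z * c v\<bar> \<ge> cos (pi / 3)"
      by (intro cos_monotone_0_pi_le) (use pi_gt3 in auto)
    then show ?thesis by (simp add: cos_60)
  qed
  have Re_x: "Re (x v) \<ge> cmod (x v) / 2" if "v \<in> V" for v
    using cos_ge[OF that] by (simp add: x_def Re_exp)
  have x_pos: "Re (x v) > 0" if "v \<in> V" for v
    using Re_x[OF that] by (smt (verit) x_def exp_not_eq_zero zero_less_norm_iff half_gt_zero)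
  have hp: "Z V \<noteq> 0" "\<And>v. v \<in> V \<Longrightarrow> Re (Z V / Z (V - {v})) \<ge> Re (x v)"
    using monomer_dimer_half_plane[of V E x "\<lambda>e. exp (om e)"] finite_V finite_E edges x_pos
    unfolding Z_def by auto
  have tp: "?G = Z V"
    unfolding exp_gen_hamiltonian Z_def x_def ..
  show "?G \<noteq> 0" using hp tp by simp
  have ratio: "cmod (x v * Z (V - {v})) \<le> 2 * cmod (Z V)" if v: "v \<in> V" for v
  proof (cases "Z (V - {v}) = 0")
    case False
    have "cmod (x v) / 2 \<le> Re (Z V / Z (V - {v}))" using hp(2)[OF v] Re_x[OF v] by linarith
    also have "\<dots> \<le> cmod (Z V) / cmod (Z (V - {v}))" by (metis complex_Re_le_cmod norm_divide)
    finally show ?thesis using False by (simp add: norm_mult field_simps)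
  qed simp
  \<comment> \<open>Matchings that leave \<open>v\<close> unpaired are the matchings of the graph
    without \<open>v\<close>. Relative to \<open>Z V\<close> this is the complex analogue of the
    probability that \<open>v\<close> is unpaired; weighted with \<open>c v\<close> and summed over
    \<open>v\<close> it gives the derivative.\<close>
  have part: "(\<Sum>m\<in>{m \<in> matchings E. v \<in> unpaired V m}. w m) = x v * Z (V - {v})" if v: "v \<in> V" for v
  proof -
    have "{m \<in> matchings E. v \<in> unpaired V m} = matchings {e \<in> E. e \<subseteq> V - {v}}"
      using v edges by (auto simp: matchings_def unpaired_def subset_iff)
    moreover have "w m = x v * ((\<Prod>v\<in>unpaired (V - {v}) m. x v) * (\<Prod>e\<in>m. of_real (exp (om e))))"
      if m: "m \<in> matchings {e \<in> E. e \<subseteq> V - {v}}" for m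
    proof -
      have "unpaired V m = insert v (unpaired (V - {v}) m)"
        using m v by (auto simp: matchings_def unpaired_def)
      moreover have "v \<notin> unpaired (V - {v}) m" "finite (unpaired (V - {v}) m)"
        using finite_V by (auto simp: unpaired_def)
      ultimately show ?thesis by (simp add: w_def mult.assoc)
    qed
    ultimately show ?thesis by (simp add: Z_def monomer_dimer_def sum_distrib_left)
  qed
  have "?D
     = (\<Sum>m\<in>matchings E. \<Sum>v\<in>V. if v \<in> unpaired V m then of_real (c v) * w m else 0)"
    unfolding exp_gen'_def
  proof (intro sum.cong refl)
    fix m assume m: "m \<in> matchings E"
    have "of_real (exp (hamiltonian V nu om m)) * exp (z * of_real (tilt_sum c V m)) = w m"
      unfolding w_def x_def by (rule tilted_weight[OF m])
    moreover have "tilt_sum c V m = (\<Sum>v\<in>V. if v \<in> unpaired V m then c v else 0)"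
      unfolding tilt_sum_def by (subst sum.inter_restrict[OF finite_V, symmetric])
        (auto simp: unpaired_def intro!: sum.cong)
    ultimately show "of_real (tilt_sum c V m)
            * (of_real (exp (hamiltonian V nu om m)) * exp (z * of_real (tilt_sum c V m)))
       = (\<Sum>v\<in>V. if v \<in> unpaired V m then of_real (c v) * w m else 0)"
      by (simp add: sum_distrib_right if_distrib[of of_real] if_distrib[of "\<lambda>x. x * _"] cong: if_cong)
  qed
  also have "\<dots> = (\<Sum>v\<in>V. of_real (c v) * (\<Sum>m\<in>{m \<in> matchings E. v \<in> unpaired V m}. w m))"
    by (subst sum.swap) (simp add: sum.inter_filter[OF finite_matchings[OF finite_E]] sum_distrib_left
        if_distrib[of "\<lambda>x. _ * x"] cong: if_cong)
  also have "\<dots> = (\<Sum>v\<in>V. of_real (c v) * (x v * Z (V - {v})))"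
    by (intro sum.cong refl) (simp add: part)
  finally have eq: "?D
     = (\<Sum>v\<in>V. of_real (c v) * (x v * Z (V - {v})))" .
  have "cmod (of_real (c v) * (x v * Z (V - {v}))) \<le> 2 * cmod (Z V)" if "v \<in> V" for v
    using mult_mono[OF c[OF that] ratio[OF that]] by (simp add: norm_mult)
  then have "cmod (\<Sum>v\<in>V. of_real (c v) * (x v * Z (V - {v}))) \<le> real (card V) * (2 * cmod (Z V))"
    by (rule sum_norm_bound)
  then show "cmod ?D
        \<le> 2 * real (card V) * cmod ?G"
    unfolding eq tp by (simp add: mult_ac)
qed

end

section \<open>Cumulants from a zero-free disc\<close>

text \<open>Isolates what the analytic argument uses: a finite probability distribution
  \<open>p\<close>, a statistic \<open>a\<close>, and a generating function without zeros on the
  unit disc whose logarithmic derivative is at most \<open>A\<close>. In the application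
  \<open>A\<close> is twice the number of vertices.\<close>

locale exp_sum =
  fixes M :: "'m set" and p a :: "'m \<Rightarrow> real" and A :: real
  assumes finite_M: "finite M" and p_nonneg: "\<And>m. m \<in> M \<Longrightarrow> p m \<ge> 0" and p_sum: "(\<Sum>m\<in>M. p m) = 1"
    and bound: "\<And>z. norm z < 1 \<Longrightarrow> exp_gen M p a z \<noteq> 0 \<and> cmod (exp_gen' M p a z) \<le> A * cmod (exp_gen M p a z)"
begin

definition mean :: real where "mean = (\<Sum>m\<in>M. a m * p m)"
definition var :: real where "var = (\<Sum>m\<in>M. (a m)\<^sup>2 * p m) - mean\<^sup>2"
abbreviation "gen \<equiv> exp_gen M p a"

lemma var_eq: "var = (\<Sum>m\<in>M. (a m - mean)\<^sup>2 * p m)"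
proof -
  have "(\<Sum>m\<in>M. (a m - mean)\<^sup>2 * p m)
    = (\<Sum>m\<in>M. (a m)\<^sup>2 * p m) - 2 * mean * (\<Sum>m\<in>M. a m * p m) + mean\<^sup>2 * (\<Sum>m\<in>M. p m)"
    by (simp add: power2_diff algebra_simps sum.distrib sum_subtractf sum_distrib_left sum_distrib_right)
  then show ?thesis by (simp add: var_def p_sum flip: mean_def) (simp add: power2_eq_square)
qed

lemma var_nonneg: "var \<ge> 0"
  unfolding var_eq by (rule sum_nonneg) (simp add: p_nonneg)

text \<open>\<open>F\<close> is the primitive, vanishing at 0, of the logarithmic derivative
  \<open>f\<close>. Cauchy's inequality on circles of radius 1/4 about points of modulus at most 1/2
  bounds the second derivative of \<open>f\<close> by \<open>2 * A * 16\<close>; the Taylor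
  remainder, divided by \<open>fact 2\<close>, leaves 16. The circle of radius 1/2 about 0 bounds
  the variance.\<close>

lemma ex_log_gen:
  "\<exists>F. (\<forall>z. norm z < 1 \<longrightarrow> gen z = exp (F z)) \<and>
    (\<forall>z. norm z \<le> 1/2 \<longrightarrow> cmod (F z - (of_real mean * z + of_real var * z\<^sup>2 / 2)) \<le> 16 * A * norm z ^ 3)
    \<and> var \<le> 2 * A"
proof -
  let ?g1 = "exp_gen' M p a"
  define g2 where "g2 z = (\<Sum>m\<in>M. of_real (a m) * (of_real (a m) * (of_real (p m) * exp (z * of_real (a m)))))" for z :: complex
  define f where "f z = ?g1 z / gen z" for z
  have gen_deriv: "(gen has_field_derivative ?g1 z) (at z)" for z
    unfolding exp_gen_def exp_gen'_def by (auto intro!: derivative_eq_intros sum.cong simp: mult_ac)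
  have g1_deriv: "(?g1 has_field_derivative g2 z) (at z)" for z
    unfolding exp_gen'_def g2_def by (auto intro!: derivative_eq_intros sum.cong simp: mult_ac)
  have gen_nz: "gen z \<noteq> 0" if "norm z < 1" for z using bound[OF that] by (simp add: exp_gen_def)
  have f_le: "cmod (f z) \<le> A" if "norm z < 1" for z
    using bound[OF that] gen_nz[OF that]
    by (simp add: f_def norm_divide divide_le_eq)
  have gen_hol: "gen holomorphic_on S" for S
    unfolding holomorphic_on_def field_differentiable_def
    using gen_deriv has_field_derivative_at_within by blast
  have g1_hol: "?g1 holomorphic_on S" for S
    unfolding holomorphic_on_def field_differentiable_def
    using g1_deriv has_field_derivative_at_within by blast
  have f_hol: "f holomorphic_on ball 0 1"
    unfolding f_def by (intro holomorphic_on_divide gen_hol g1_hol) (simp add: gen_nz)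
  obtain F0 where F0: "\<And>z. z \<in> ball 0 1 \<Longrightarrow> (F0 has_field_derivative f z) (at z within ball 0 1)"
    using holomorphic_convex_primitive'[OF convex_ball open_ball f_hol] by auto
  define F where "F z = F0 z - F0 0" for z
  have F_deriv: "(F has_field_derivative f z) (at z)" if "norm z < 1" for z
    using F0[of z] that unfolding F_def
    by (auto simp: at_within_open[of z "ball 0 1"] intro!: derivative_eq_intros)
  have gen0: "gen 0 = 1" using p_sum by (simp add: exp_gen_def flip: of_real_sum)
  \<comment> \<open>\<open>gen z * exp (- F z)\<close> has derivative 0 and value 1 at the origin,
    so no branch of the complex logarithm has to be chosen.\<close>
  have gen_exp: "gen z = exp (F z)" if z: "norm z < 1" for z
  proof -
    have "\<exists>c. \<forall>z\<in>ball 0 1. gen z * exp (- F z) = c"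
    proof (rule has_field_derivative_zero_constant)
      fix z :: complex assume "z \<in> ball 0 1"
      then have "norm z < 1" by simp
      have "((\<lambda>z. gen z * exp (- F z)) has_field_derivative
          gen z * (exp (- F z) * (- f z)) + ?g1 z * exp (- F z)) (at z)"
        by (intro DERIV_mult' gen_deriv DERIV_chain2[OF DERIV_exp] DERIV_minus F_deriv) fact
      moreover have "gen z * (exp (- F z) * (- f z)) + ?g1 z * exp (- F z) = 0"
        using gen_nz[OF \<open>norm z < 1\<close>] by (simp add: f_def)
      ultimately show "((\<lambda>z. gen z * exp (- F z)) has_field_derivative 0) (at z within ball 0 1)"
        by (metis has_field_derivative_at_within)
    qed auto
    then obtain k where k: "\<And>z. norm z < 1 \<Longrightarrow> gen z * exp (- F z) = k" by auto
    have "k = 1" using k[of 0] by (simp add: gen0 F_def)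
    then show ?thesis using k[OF z] by (simp add: exp_minus field_simps)
  qed
  have hol1: "deriv f holomorphic_on ball 0 1" by (rule holomorphic_deriv[OF f_hol]) simp
  have cauchy: "cmod ((deriv ^^ n) f x) \<le> fact n * A / r ^ n" if "norm x + r < 1" "r > 0" for x r n
  proof (rule Cauchy_inequality)
    have sub: "cball x r \<subseteq> ball 0 1" using that by (simp add: cball_subset_ball_iff dist_norm)
    show "f holomorphic_on ball x r" using f_hol sub by (meson ball_subset_cball holomorphic_on_subset subset_trans)
    show "continuous_on (cball x r) f" using f_hol sub by (meson holomorphic_on_imp_continuous_on continuous_on_subset)
    show "r > 0" by fact
    show "cmod (f y) \<le> A" if "cmod (x - y) = r" for y
      by (rule f_le) (use that sub in \<open>auto simp: dist_norm subset_iff\<close>)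
  qed
  have f0: "f 0 = of_real mean"
    by (simp add: f_def gen0 exp_gen'_def mean_def)
  have df0: "deriv f 0 = of_real var"
  proof -
    have "(f has_field_derivative (g2 0 * gen 0 - ?g1 0 * ?g1 0) / (gen 0 * gen 0)) (at 0)"
      unfolding f_def by (intro DERIV_divide gen_deriv g1_deriv) (simp add: gen0)
    then have "deriv f 0 = g2 0 - ?g1 0 * ?g1 0" by (simp add: gen0 DERIV_imp_deriv)
    also have "g2 0 = of_real (\<Sum>m\<in>M. (a m)\<^sup>2 * p m)" by (simp add: g2_def power2_eq_square mult_ac)
    also have "?g1 0 = of_real mean" by (simp add: exp_gen'_def mean_def)
    finally show ?thesis by (simp add: var_def power2_eq_square)
  qed
  \<comment> \<open>\<open>F\<close> and its successive derivatives \<open>f\<close>,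
    \<open>deriv f\<close>, ... in the indexed form of Taylor's theorem; the third one is the
    quantity bounded by Cauchy's inequality.\<close>
  define G where "G i = (if i = 0 then F else (deriv ^^ (i - 1)) f)" for i :: nat
  have taylor: "cmod (F z - (of_real mean * z + of_real var * z\<^sup>2 / 2)) \<le> 16 * A * norm z ^ 3"
    if z: "norm z \<le> 1/2" for z
  proof -
    have "cmod (G 0 z - (\<Sum>i\<le>2. G i 0 * (z - 0) ^ i / fact i)) \<le> (32 * A) * cmod (z - 0) ^ Suc 2 / fact 2"
    proof (rule complex_Taylor[where S = "cball 0 (1/2)"])
      fix i and x :: complex assume x: "x \<in> cball 0 (1/2)" and i: "i \<le> (2::nat)"
      have "norm x < 1" using x by simp
      then have "(G i has_field_derivative G (Suc i) x) (at x)"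
        using F_deriv[of x] i holomorphic_derivI[OF f_hol, of x] holomorphic_derivI[OF hol1, of x]
        by (auto simp: G_def numeral_2_eq_2 le_Suc_eq)
      then show "(G i has_field_derivative G (Suc i) x) (at x within cball 0 (1/2))"
        by (rule has_field_derivative_at_within)
    next
      fix x :: complex assume "x \<in> cball 0 (1/2)"
      then show "cmod (G (Suc 2) x) \<le> 32 * A"
        using cauchy[of x "1/4" 2] by (simp add: G_def fact_2 power2_eq_square)
    qed (use z in auto)
    moreover have "(\<Sum>i\<le>2. G i 0 * (z - 0) ^ i / fact i) = of_real mean * z + of_real var * z\<^sup>2 / 2"
      by (simp add: G_def numeral_2_eq_2 f0 df0 F_def)
    ultimately show ?thesis by (simp add: G_def fact_2 eval_nat_numeral)
  qed
  have "cmod (deriv f 0) \<le> 2 * A" using cauchy[of 0 "1/2" 1] by simp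
  then have "var \<le> 2 * A" by (simp add: df0)
  then show ?thesis using gen_exp taylor by blast
qed

lemma var_le: "var \<le> 2 * A"
  using ex_log_gen by blast

lemma gen_real: "gen (of_real s) = of_real (\<Sum>m\<in>M. p m * exp (s * a m))"
  by (simp add: exp_gen_def flip: exp_of_real)

text \<open>The terms with \<open>mean\<close> cancel between \<open>s\<close> and
  \<open>- s\<close>, leaving two Taylor errors with constant 16. On the real axis
  \<open>gen\<close> is a nonnegative real, so taking moduli identifies the real logarithm with the
  real part of \<open>F\<close>.\<close>

lemma second_difference:
  assumes s: "\<bar>s\<bar> \<le> 1/2"
  shows "\<bar>ln (\<Sum>m\<in>M. p m * exp (s * a m)) + ln (\<Sum>m\<in>M. p m * exp (- s * a m)) - var * s\<^sup>2\<bar> \<le> 32 * A * \<bar>s\<bar> ^ 3"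
proof -
  obtain F where F: "\<And>z. norm z < 1 \<Longrightarrow> gen z = exp (F z)"
    "\<And>z. norm z \<le> 1/2 \<Longrightarrow> cmod (F z - (of_real mean * z + of_real var * z\<^sup>2 / 2)) \<le> 16 * A * norm z ^ 3"
    using ex_log_gen by blast
  have 1: "\<bar>ln (\<Sum>m\<in>M. p m * exp (s * a m)) - (mean * s + var * s\<^sup>2 / 2)\<bar> \<le> 16 * A * \<bar>s\<bar> ^ 3"
    if s: "\<bar>s\<bar> \<le> 1/2" for s
  proof -
    have n: "norm (of_real s :: complex) < 1" using s by simp
    have nn: "(\<Sum>m\<in>M. p m * exp (s * a m)) \<ge> 0" by (intro sum_nonneg) (simp add: p_nonneg)
    have "cmod (gen (of_real s)) = exp (Re (F (of_real s)))"
      using F(1)[OF n] by simp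
    then have "(\<Sum>m\<in>M. p m * exp (s * a m)) = exp (Re (F (of_real s)))"
      using nn by (simp only: gen_real norm_of_real abs_of_nonneg)
    then have "ln (\<Sum>m\<in>M. p m * exp (s * a m)) = Re (F (of_real s))" by simp
    moreover have "\<bar>Re (F (of_real s) - (of_real mean * of_real s + of_real var * (of_real s)\<^sup>2 / 2))\<bar> \<le> 16 * A * \<bar>s\<bar> ^ 3"
      using F(2)[of "of_real s"] s abs_Re_le_cmod order_trans by fastforce
    moreover have "Re (of_real mean * of_real s + of_real var * (of_real s)\<^sup>2 / 2 :: complex) = mean * s + var * s\<^sup>2 / 2"
      by (simp flip: of_real_power of_real_mult)
    ultimately show ?thesis by simp
  qed
  show ?thesis using 1[OF s] 1[of "-s"] s by (simp add: abs_le_iff)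
qed

text \<open>On the imaginary axis, centring removes the linear term of \<open>F\<close>, and the sum
  becomes \<open>exp R\<close> times a Gaussian factor, at most 1 because \<open>var\<close> is
  nonnegative. The second hypothesis gives \<open>|R| \<le> 1\<close>, hence
  \<open>|exp R - 1| \<le> 3 * |R|\<close>, and 48 is 3 times 16. For \<open>A\<close> of order n
  and \<open>t\<close> of order \<open>n^(-1/2)\<close> the error is of order
  \<open>n^(-1/2)\<close>.\<close>

lemma char_approx:
  assumes t: "\<bar>t\<bar> \<le> 1/2" "16 * A * \<bar>t\<bar> ^ 3 \<le> 1"
  shows "cmod ((\<Sum>m\<in>M. of_real (p m) * exp (\<i> * of_real (t * (a m - mean)))) - of_real (exp (- var * t\<^sup>2 / 2)))
     \<le> 48 * A * \<bar>t\<bar> ^ 3" (is "cmod ?D \<le> _")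
proof -
  obtain F where F: "\<And>z. norm z < 1 \<Longrightarrow> gen z = exp (F z)"
    "\<And>z. norm z \<le> 1/2 \<Longrightarrow> cmod (F z - (of_real mean * z + of_real var * z\<^sup>2 / 2)) \<le> 16 * A * norm z ^ 3"
    using ex_log_gen by blast
  define z where "z = \<i> * of_real t"
  define R where "R = F z - (of_real mean * z + of_real var * z\<^sup>2 / 2)"
  have nz: "norm z = \<bar>t\<bar>" by (simp add: z_def norm_mult)
  have R: "cmod R \<le> 16 * A * \<bar>t\<bar> ^ 3" using F(2)[of z] nz t by (simp add: R_def)
  have "(\<Sum>m\<in>M. of_real (p m) * exp (\<i> * of_real (t * (a m - mean)))) = gen z * exp (- of_real mean * z)"
    unfolding exp_gen_def sum_distrib_right
    by (intro sum.cong refl) (simp add: z_def algebra_simps flip: exp_add)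
  also have "\<dots> = exp (F z - of_real mean * z)"
    using F(1)[of z] nz t by (simp add: exp_diff exp_minus field_simps)
  also have "F z - of_real mean * z = R + of_real (- var * t\<^sup>2 / 2)"
    by (simp add: R_def z_def power_mult_distrib)
  also have "exp \<dots> = exp R * of_real (exp (- var * t\<^sup>2 / 2))"
    by (simp only: exp_add exp_of_real)
  finally have "cmod ?D
     = cmod ((exp R - 1) * of_real (exp (- var * t\<^sup>2 / 2)))" by (simp add: algebra_simps)
  also have "\<dots> = cmod (exp R - 1) * exp (- var * t\<^sup>2 / 2)" by (simp add: norm_mult)
  also have "\<dots> \<le> cmod (exp R - 1) * 1"
    by (intro mult_left_mono) (use var_nonneg in auto)
  also have "\<dots> \<le> 3 * cmod R"
  proof -
    have "\<bar>Re R\<bar> \<le> 1" using abs_Re_le_cmod[of R] R t by linarith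
    then have "exp \<bar>Re R\<bar> \<le> 3" using exp_le by (smt (verit) exp_le_cancel_iff)
    then have "exp \<bar>Re R\<bar> * cmod R \<le> 3 * cmod R" by (rule mult_right_mono) simp
    then show ?thesis using Taylor_exp[of R 0] by simp
  qed
  also have "\<dots> \<le> 48 * A * \<bar>t\<bar> ^ 3" using R by simp
  finally show ?thesis .
qed

end

section \<open>Free energies of slabs of the cylinder\<close>

definition log_partition :: "'v set \<Rightarrow> 'v set set \<Rightarrow> ('v \<Rightarrow> real) \<Rightarrow> ('v set \<Rightarrow> real) \<Rightarrow> real" where
  "log_partition V E nu om = ln (partition_function V E nu om)"

lemma finite_graph_subset:
  "finite_graph V E \<Longrightarrow> E' \<subseteq> E \<Longrightarrow> V' \<subseteq> V \<Longrightarrow> (\<And>e. e \<in> E' \<Longrightarrow> e \<subseteq> V') \<Longrightarrow> finite_graph V' E'"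
  unfolding finite_graph_def using finite_subset by blast

context finite_graph
begin

lemma finite_edge: "e \<in> E \<Longrightarrow> finite e"
  using edges finite_V finite_subset by blast

lemma partition_function_pos: "partition_function V E nu om > 0"
  unfolding partition_function_def
  by (rule sum_pos) (use finite_matchings[OF finite_E] empty_in_matchings in auto)

text \<open>Relative to the empty matching, each edge contributes the factor
  \<open>exp (om e - (\<Sum>v\<in>e. nu v))\<close>. The vertex sum is additive over parts of the
  graph, so all interaction across a cut sits in the polynomial.\<close>

lemma log_partition_eq:
  "log_partition V E nu om = (\<Sum>v\<in>V. nu v) + ln (matching_poly (\<lambda>e. exp (om e - (\<Sum>v\<in>e. nu v))) E)"
proof -
  let ?r = "\<lambda>e. exp (om e - (\<Sum>v\<in>e. nu v))"
  have "partition_function V E nu om = monomer_dimer E (\<lambda>v. exp (nu v)) (\<lambda>e. exp (om e)) V"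
    unfolding partition_function_def monomer_dimer_def edges_within
    by (intro sum.cong refl)
      (simp add: hamiltonian_def exp_add exp_sum finite_unpaired finite_in_matchings[OF finite_E])
  also have "\<dots> = (\<Prod>v\<in>V. exp (nu v)) * matching_poly (\<lambda>e. exp (om e) / (\<Prod>v\<in>e. exp (nu v))) E"
    by (subst monomer_dimer_eq_matching_poly) (simp_all add: finite_V edges_within)
  also have "matching_poly (\<lambda>e. exp (om e) / (\<Prod>v\<in>e. exp (nu v))) E = matching_poly ?r E"
    unfolding matching_poly_def
    by (intro sum.cong prod.cong refl) (auto simp: matchings_def exp_diff exp_sum finite_edge)
  also have "(\<Prod>v\<in>V. exp (nu v)) = exp (\<Sum>v\<in>V. nu v)"
    by (simp add: exp_sum finite_V)
  finally show ?thesis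
    using matching_poly_pos[OF finite_E, of ?r] by (simp add: log_partition_def ln_mult)
qed

text \<open>Without the cut edges \<open>C\<close> the polynomial factorises and the vertex sums add
  exactly. Putting \<open>C\<close> back can only increase the polynomial, by a factor of at most
  \<open>1 + r e\<close> per edge, and the logarithm of these factors is the cost.\<close>

lemma log_partition_split:
  assumes V: "V = V1 \<union> V2" "V1 \<inter> V2 = {}" and E: "E = E1 \<union> E2 \<union> C" "(E1 \<union> E2) \<inter> C = {}"
    and sub: "\<And>e. e \<in> E1 \<Longrightarrow> e \<subseteq> V1" "\<And>e. e \<in> E2 \<Longrightarrow> e \<subseteq> V2"
  shows "0 \<le> log_partition V E nu om - log_partition V1 E1 nu om - log_partition V2 E2 nu om" (is "0 \<le> ?d")
    and "log_partition V E nu om - log_partition V1 E1 nu om - log_partition V2 E2 nu om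
           \<le> (\<Sum>e\<in>C. ln (1 + exp (om e - (\<Sum>v\<in>e. nu v))))" (is "_ \<le> ?c")
proof -
  let ?r = "\<lambda>e. exp (om e - (\<Sum>v\<in>e. nu v))"
  have fin: "finite E1" "finite E2" "finite C" using finite_E E by auto
  have g: "finite_graph V1 E1" "finite_graph V2 E2"
    using finite_graph_subset[OF finite_graph_axioms] V E sub by auto
  have ne: "e \<noteq> {}" if "e \<in> E" for e using edges[OF that] by auto
  have prod: "matching_poly ?r (E1 \<union> E2) = matching_poly ?r E1 * matching_poly ?r E2"
  proof (rule matching_poly_union_disjnt)
    fix e f assume ef: "e \<in> E1" "f \<in> E2"
    then have "disjnt e f" using sub V unfolding disjnt_def by blast
    moreover have "e \<noteq> {}" using ne ef E by auto
    ultimately show "disjnt e f \<and> e \<noteq> f" by (auto simp: disjnt_def)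
  qed (use fin in auto)
  have pos: "matching_poly ?r F \<ge> 1" if "F \<subseteq> E" for F
    using matching_poly_pos[of F ?r] finite_subset[OF that finite_E] by simp
  have eq: "?d
      = ln (matching_poly ?r E) - ln (matching_poly ?r (E1 \<union> E2))"
  proof -
    have "(\<Sum>v\<in>V. nu v) = (\<Sum>v\<in>V1. nu v) + (\<Sum>v\<in>V2. nu v)"
      unfolding V(1) by (rule sum.union_disjoint) (use V finite_V in auto)
    moreover have "ln (matching_poly ?r (E1 \<union> E2)) = ln (matching_poly ?r E1) + ln (matching_poly ?r E2)"
    proof -
      have "E1 \<subseteq> E" "E2 \<subseteq> E" using E by auto
      from this[THEN pos] have "matching_poly ?r E1 > 0" "matching_poly ?r E2 > 0" by linarith+
      then show ?thesis unfolding prod by (simp add: ln_mult)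
    qed
    ultimately show ?thesis
      unfolding log_partition_eq finite_graph.log_partition_eq[OF g(1)]
        finite_graph.log_partition_eq[OF g(2)] by linarith
  qed
  have bnd: "matching_poly ?r (E1 \<union> E2) \<le> matching_poly ?r E"
    "matching_poly ?r E \<le> matching_poly ?r (E1 \<union> E2) * (\<Prod>e\<in>C. 1 + ?r e)"
    unfolding E(1) by (rule matching_poly_union_bounds, use fin in simp_all)+
  have "E1 \<union> E2 \<subseteq> E" using E by auto
  then have p12: "matching_poly ?r (E1 \<union> E2) > 0" using pos[of "E1 \<union> E2"] by linarith
  show "0 \<le> ?d"
    unfolding eq using bnd(1) p12 by simp
  have pp: "(\<Prod>e\<in>C. 1 + ?r e) > 0" by (intro prod_pos) (auto simp: add_pos_pos)
  have "ln (matching_poly ?r E) \<le> ln (matching_poly ?r (E1 \<union> E2) * (\<Prod>e\<in>C. 1 + ?r e))"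
    using bnd p12 by (subst ln_le_cancel_iff) auto
  also have "\<dots> = ln (matching_poly ?r (E1 \<union> E2)) + (\<Sum>e\<in>C. ln (1 + ?r e))"
  proof -
    have "1 + exp x \<noteq> 0" for x :: real using exp_gt_zero[of x] by linarith
    then have "ln (\<Prod>e\<in>C. 1 + ?r e) = (\<Sum>e\<in>C. ln (1 + ?r e))"
      by (intro ln_prod fin(3)) blast
    then show ?thesis using ln_mult[of "matching_poly ?r (E1 \<union> E2)" "\<Prod>e\<in>C. 1 + ?r e"] p12 pp by simp
  qed
  finally show "?d \<le> ?c"
    unfolding eq by simp
qed

text \<open>Holds matching by matching, as at most \<open>card V\<close> vertices are unpaired. This
  uniformity in the weights is what makes tilt gains bounded random variables.\<close>

lemma log_partition_lipschitz:
  assumes "\<And>v. v \<in> V \<Longrightarrow> \<bar>nu' v - nu v\<bar> \<le> K"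
  shows "\<bar>log_partition V E nu' om - log_partition V E nu om\<bar> \<le> K * real (card V)"
proof -
  have K: "K \<ge> 0" if "V \<noteq> {}" using assms that by (meson abs_ge_zero ex_in_conv order_trans)
  have *: "log_partition V E nu' om \<le> log_partition V E nu om + K * real (card V)"
    if d: "\<And>v. v \<in> V \<Longrightarrow> \<bar>nu' v - nu v\<bar> \<le> K" for nu nu'
  proof -
    have "hamiltonian V nu' om m \<le> hamiltonian V nu om m + K * real (card V)" for m
    proof -
      have "(\<Sum>v\<in>unpaired V m. nu' v) - (\<Sum>v\<in>unpaired V m. nu v) = (\<Sum>v\<in>unpaired V m. nu' v - nu v)"
        by (simp add: sum_subtractf)
      also have "\<dots> \<le> (\<Sum>v\<in>unpaired V m. K)"
        by (rule sum_mono) (use d in \<open>fastforce simp: unpaired_def abs_le_iff\<close>)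
      also have "\<dots> \<le> (\<Sum>v\<in>V. K)"
        by (rule sum_mono2) (use K finite_V in \<open>auto simp: unpaired_def\<close>)
      finally show ?thesis by (simp add: hamiltonian_def mult.commute)
    qed
    then have "partition_function V E nu' om
        \<le> (\<Sum>m\<in>matchings E. exp (hamiltonian V nu om m + K * real (card V)))"
      unfolding partition_function_def by (intro sum_mono) simp
    also have "\<dots> = partition_function V E nu om * exp (K * real (card V))"
      by (simp add: partition_function_def exp_add sum_distrib_right)
    finally have "ln (partition_function V E nu' om) \<le> ln (partition_function V E nu om * exp (K * real (card V)))"
      using partition_function_pos by (subst ln_le_cancel_iff) auto
    then show ?thesis using partition_function_pos[of nu om] by (simp add: log_partition_def ln_mult)
  qed
  show ?thesis using *[of nu' nu] *[of nu nu'] assms by (fastforce simp: abs_minus_commute abs_le_iff)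
qed

end

lemma log_partition_cong:
  assumes "\<And>v. v \<in> V \<Longrightarrow> nu v = nu' v" "\<And>e. e \<in> E \<Longrightarrow> om e = om' e"
  shows "log_partition V E nu om = log_partition V E nu' om'"
proof -
  have "hamiltonian V nu om m = hamiltonian V nu' om' m" if "m \<in> matchings E" for m
    unfolding hamiltonian_def using assms that
    by (intro arg_cong2[where f = "(+)"] sum.cong) (auto simp: unpaired_def matchings_def)
  then show ?thesis by (simp add: log_partition_def partition_function_def)
qed

lemma log_partition_image:
  assumes f: "inj f" and E: "\<And>e. e \<in> E \<Longrightarrow> e \<subseteq> V"
  shows "log_partition (f ` V) ((`) f ` E) nu om = log_partition V E (nu \<circ> f) (\<lambda>e. om (f ` e))"
proof -
  have inj2: "inj ((`) f)" using f by (simp add: inj_on_def inj_image_eq_iff)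
  have inj3: "inj ((`) ((`) f))" using inj2 by (simp add: inj_on_def inj_image_eq_iff)
  have M: "matchings ((`) f ` E) = (`) ((`) f) ` matchings E"
  proof (intro equalityI subsetI)
    fix m assume m: "m \<in> matchings ((`) f ` E)"
    then obtain m' where m': "m' \<subseteq> E" "m = (`) f ` m'" by (auto simp: matchings_def subset_image_iff)
    have "pairwise disjnt m'"
      using m f unfolding m'(2) matchings_def
      by (auto simp: pairwise_def disjnt_def inj_image_eq_iff simp flip: image_Int)
    then show "m \<in> (`) ((`) f) ` matchings E" using m' by (auto simp: matchings_def)
  next
    fix m assume "m \<in> (`) ((`) f) ` matchings E"
    then obtain m' where m': "m' \<in> matchings E" "m = (`) f ` m'" by auto
    then show "m \<in> matchings ((`) f ` E)"
      using f by (auto simp: matchings_def pairwise_def disjnt_def inj_image_eq_iff simp flip: image_Int)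
  qed
  have H: "hamiltonian (f ` V) nu om ((`) f ` m) = hamiltonian V (nu \<circ> f) (\<lambda>e. om (f ` e)) m" for m
  proof -
    have "unpaired (f ` V) ((`) f ` m) = f ` unpaired V m"
      using f by (simp add: unpaired_def image_set_diff image_Union)
    then show ?thesis
      by (simp add: hamiltonian_def sum.reindex[OF inj_on_subset[OF f]] sum.reindex[OF inj_on_subset[OF inj2]])
  qed
  show ?thesis
    unfolding log_partition_def partition_function_def M
    by (simp add: sum.reindex[OF inj_on_subset[OF inj3]] H)
qed

section \<open>Slabs of consecutive layers\<close>

definition slab_edges :: "'a set \<Rightarrow> 'a set set \<Rightarrow> int set \<Rightarrow> (int \<times> 'a) set set" where
  "slab_edges VH EH I = {{(i, j), (i', j')} | i j i' j'.
     i \<in> I \<and> j \<in> VH \<and> i' \<in> I \<and> j' \<in> VH \<and>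
     ((\<bar>i - i'\<bar> = 1 \<and> j = j') \<or> (i = i' \<and> {j, j'} \<in> EH))}"

text \<open>With half-open intervals consecutive slabs \<open>{a<..b}\<close> and
  \<open>{b<..c}\<close> fit together without index shifts, and the whole cylinder is a slab like
  any other.\<close>

lemma cyl_eq_slab:
  "cyl_vertices VH n = {0<..int n} \<times> VH" "cyl_edges VH EH n = slab_edges VH EH {0<..int n}"
proof -
  have "{1..int n} = {0<..int n}" by auto
  then show "cyl_vertices VH n = {0<..int n} \<times> VH" "cyl_edges VH EH n = slab_edges VH EH {0<..int n}"
    by (simp_all add: cyl_vertices_def cyl_edges_def slab_edges_def conj_assoc)
qed

lemma slab_edgesI:
  "i \<in> I \<Longrightarrow> j \<in> VH \<Longrightarrow> i' \<in> I \<Longrightarrow> j' \<in> VH \<Longrightarrow>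
     (\<bar>i - i'\<bar> = 1 \<and> j = j') \<or> (i = i' \<and> {j, j'} \<in> EH) \<Longrightarrow> {(i, j), (i', j')} \<in> slab_edges VH EH I"
  unfolding slab_edges_def by blast

lemma slab_edges_mono: "I \<subseteq> J \<Longrightarrow> slab_edges VH EH I \<subseteq> slab_edges VH EH J"
  unfolding slab_edges_def by blast

lemma finite_graph_slab:
  assumes "finite_simple_graph VH EH" "finite I"
  shows "finite_graph (I \<times> VH) (slab_edges VH EH I)"
proof
  show "finite (I \<times> VH)" using assms by (simp add: finite_simple_graph_def)
  fix e assume "e \<in> slab_edges VH EH I"
  then obtain i j i' j' where e: "e = {(i, j), (i', j')}" "i \<in> I" "j \<in> VH" "i' \<in> I" "j' \<in> VH"
     and c: "(\<bar>i - i'\<bar> = 1 \<and> j = j') \<or> (i = i' \<and> {j, j'} \<in> EH)"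
    unfolding slab_edges_def by blast
  have "(i, j) \<noteq> (i', j')"
  proof
    assume "(i, j) = (i', j')"
    then have "{j} \<in> EH" using c by auto
    then show False using assms(1) by (force simp: finite_simple_graph_def)
  qed
  then show "e \<subseteq> I \<times> VH \<and> card e = 2" using e by auto
qed

text \<open>An edge changes the layer by at most 1, so an edge across the cut joins layers
  \<open>b\<close> and \<open>b + 1\<close> over one point of \<open>VH\<close>. The number of such
  bonds does not depend on the lengths of the slabs.\<close>

lemma slab_edges_split:
  assumes "a < b" "b < (c::int)"
  shows "slab_edges VH EH {a<..c} = slab_edges VH EH {a<..b} \<union> slab_edges VH EH {b<..c}
           \<union> (\<lambda>j. {(b, j), (b + 1, j)}) ` VH"
    and "(slab_edges VH EH {a<..b} \<union> slab_edges VH EH {b<..c}) \<inter> (\<lambda>j. {(b, j), (b + 1, j)}) ` VH = {}"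
proof -
  show "slab_edges VH EH {a<..c} = slab_edges VH EH {a<..b} \<union> slab_edges VH EH {b<..c}
           \<union> (\<lambda>j. {(b, j), (b + 1, j)}) ` VH" (is "?L = ?R")
  proof (intro equalityI subsetI)
    fix e assume "e \<in> ?L"
    then obtain i j i' j' where e: "e = {(i, j), (i', j')}" "i \<in> {a<..c}" "j \<in> VH" "i' \<in> {a<..c}" "j' \<in> VH"
     and c: "(\<bar>i - i'\<bar> = 1 \<and> j = j') \<or> (i = i' \<and> {j, j'} \<in> EH)"
      unfolding slab_edges_def by blast
    consider "i \<le> b \<and> i' \<le> b" | "i > b \<and> i' > b" | "i \<le> b" "i' > b" | "i > b" "i' \<le> b" by linarith
    then show "e \<in> ?R"
    proof cases
      case 1
      have "e \<in> slab_edges VH EH {a<..b}"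
        unfolding e(1) by (rule slab_edgesI) (use 1 e c in auto)
      then show ?thesis by simp
    next
      case 2
      have "e \<in> slab_edges VH EH {b<..c}"
        unfolding e(1) by (rule slab_edgesI) (use 2 e c in auto)
      then show ?thesis by simp
    next
      case 3
      then have "i = b" "i' = b + 1" "j = j'" using c by auto
      then show ?thesis using e by auto
    next
      case 4
      then have "i' = b" "i = b + 1" "j = j'" using c by auto
      then show ?thesis using e by (auto simp: insert_commute)
    qed
  next
    fix e assume e: "e \<in> ?R"
    have "{(b, j), (b + 1, j)} \<in> ?L" if "j \<in> VH" for j
      by (rule slab_edgesI) (use that assms in auto)
    moreover have "slab_edges VH EH {a<..b} \<subseteq> ?L" "slab_edges VH EH {b<..c} \<subseteq> ?L"
      by (rule slab_edges_mono; use assms in force)+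
    ultimately show "e \<in> ?L" using e by auto
  qed
  have sub: "e \<subseteq> I \<times> VH" if "e \<in> slab_edges VH EH I" for e I
    using that unfolding slab_edges_def by auto
  have "{(b, j), (b + 1, j)} \<notin> slab_edges VH EH {a<..b}" "{(b, j), (b + 1, j)} \<notin> slab_edges VH EH {b<..c}" for j
    using sub[of "{(b, j), (b + 1, j)}" "{a<..b}"] sub[of "{(b, j), (b + 1, j)}" "{b<..c}"] by auto
  then show "(slab_edges VH EH {a<..b} \<union> slab_edges VH EH {b<..c}) \<inter> (\<lambda>j. {(b, j), (b + 1, j)}) ` VH = {}"
    by auto
qed

text \<open>The change of the free energy of the layers \<open>a + 1, \<dots>, b\<close> when \<open>c i\<close> is added to all vertex
  weights of layer \<open>i\<close>.\<close>

definition tilt_gain ::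
    "'a set \<Rightarrow> 'a set set \<Rightarrow> (int \<Rightarrow> real) \<Rightarrow> int \<Rightarrow> int \<Rightarrow> (int \<times> 'a \<Rightarrow> real) \<Rightarrow>
      ((int \<times> 'a) set \<Rightarrow> real) \<Rightarrow> real" where
  "tilt_gain VH EH c a b nu om =
     log_partition ({a<..b} \<times> VH) (slab_edges VH EH {a<..b}) (\<lambda>v. nu v + c (fst v)) om
     - log_partition ({a<..b} \<times> VH) (slab_edges VH EH {a<..b}) nu om"

text \<open>Bounds the effect of a cut after layer \<open>b\<close>, for tilted and untilted weights
  alike. The 3 is the 1 from \<open>ln (1 + exp x) \<le> 1 + |x|\<close> plus 1 for the tilt at each
  end of the bond.\<close>

definition bond_cost :: "'a set \<Rightarrow> int \<Rightarrow> (int \<times> 'a \<Rightarrow> real) \<Rightarrow> ((int \<times> 'a) set \<Rightarrow> real) \<Rightarrow> real" where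
  "bond_cost VH b nu om = (\<Sum>j\<in>VH. 3 + \<bar>om {(b, j), (b + 1, j)}\<bar> + \<bar>nu (b, j)\<bar> + \<bar>nu (b + 1, j)\<bar>)"

lemma ln_1_plus_exp_le: "ln (1 + exp x) \<le> 1 + \<bar>x :: real\<bar>"
proof -
  have "1 + exp x \<le> 2 * exp \<bar>x\<bar>"
    by (smt (verit) exp_ge_zero exp_le_cancel_iff one_le_exp_iff)
  also have "\<dots> \<le> exp 1 * exp \<bar>x\<bar>"
    using exp_ge_add_one_self[of 1] by (intro mult_right_mono) auto
  finally have "ln (1 + exp x) \<le> ln (exp (1 + \<bar>x\<bar>))"
    by (subst ln_le_cancel_iff) (auto simp: exp_add add_pos_pos)
  then show ?thesis by simp
qed

text \<open>The additivity defects of the tilted and of the untilted free energy both lie between 0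
  and the bond cost; the defect of the gain is their difference, so no factor 2 appears.\<close>

lemma tilt_gain_split:
  assumes H: "finite_simple_graph VH EH" and abc: "a < b" "b < d" and c: "\<And>i. \<bar>c i\<bar> \<le> 1"
  shows "\<bar>tilt_gain VH EH c a d nu om - tilt_gain VH EH c a b nu om - tilt_gain VH EH c b d nu om\<bar>
     \<le> bond_cost VH b nu om"
proof -
  let ?C = "(\<lambda>j. {(b, j), (b + 1, j)}) ` VH"
  interpret G: finite_graph "{a<..d} \<times> VH" "slab_edges VH EH {a<..d}"
    by (rule finite_graph_slab[OF H]) simp
  let ?L = "\<lambda>a b nu. log_partition ({a<..b} \<times> VH) (slab_edges VH EH {a<..b}) nu om"
  have sub: "e \<subseteq> I \<times> VH" if "e \<in> slab_edges VH EH I" for e I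
    using that unfolding slab_edges_def by auto
  have "{a<..d} = {a<..b} \<union> {b<..d}" using abc by auto
  then have V: "{a<..d} \<times> VH = {a<..b} \<times> VH \<union> {b<..d} \<times> VH" by auto
  have disj: "{a<..b} \<times> VH \<inter> {b<..d} \<times> VH = {}" by auto
  have cost: "(\<Sum>e\<in>?C. ln (1 + exp (om e - (\<Sum>v\<in>e. nu v + c' (fst v))))) \<le> bond_cost VH b nu om"
    if c': "\<And>i. \<bar>c' i\<bar> \<le> 1" for c'
  proof -
    have inj: "inj_on (\<lambda>j. {(b, j), (b + 1, j)}) VH"
      by (auto simp: inj_on_def doubleton_eq_iff)
    have "(\<Sum>e\<in>?C. ln (1 + exp (om e - (\<Sum>v\<in>e. nu v + c' (fst v)))))
      = (\<Sum>j\<in>VH. ln (1 + exp (om {(b, j), (b + 1, j)} - (nu (b, j) + c' b + (nu (b + 1, j) + c' (b + 1))))))"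
      by (simp add: sum.reindex[OF inj])
    also have "\<dots> \<le> bond_cost VH b nu om"
      unfolding bond_cost_def
    proof (rule sum_mono)
      fix j
      let ?x = "om {(b, j), (b + 1, j)} - (nu (b, j) + c' b + (nu (b + 1, j) + c' (b + 1)))"
      show "ln (1 + exp ?x) \<le> 3 + \<bar>om {(b, j), (b + 1, j)}\<bar> + \<bar>nu (b, j)\<bar> + \<bar>nu (b + 1, j)\<bar>"
        using ln_1_plus_exp_le[of ?x] c'[of b] c'[of "b + 1"] by linarith
    qed
    finally show ?thesis .
  qed
  have split: "0 \<le> ?L a d nu' - ?L a b nu' - ?L b d nu'"
    "?L a d nu' - ?L a b nu' - ?L b d nu' \<le> (\<Sum>e\<in>?C. ln (1 + exp (om e - (\<Sum>v\<in>e. nu' v))))" for nu'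
    by (rule G.log_partition_split(1)[OF V disj slab_edges_split[OF abc] sub sub], assumption+,
      rule G.log_partition_split(2)[OF V disj slab_edges_split[OF abc] sub sub])
  show ?thesis
    using split[of nu] split[of "\<lambda>v. nu v + c (fst v)"] cost[of c] cost[of "\<lambda>_. 0"] c
    unfolding tilt_gain_def by fastforce
qed

lemma tilt_gain_bound:
  assumes H: "finite_simple_graph VH EH" and c: "\<And>i. \<bar>c i\<bar> \<le> 1"
  shows "\<bar>tilt_gain VH EH c a b nu om\<bar> \<le> real (nat (b - a)) * real (card VH)"
proof -
  interpret G: finite_graph "{a<..b} \<times> VH" "slab_edges VH EH {a<..b}"
    by (rule finite_graph_slab[OF H]) simp
  have "card ({a<..b} \<times> VH) = nat (b - a) * card VH" by (simp add: card_cartesian_product)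
  then show ?thesis
    using G.log_partition_lipschitz[of "\<lambda>v. nu v + c (fst v)" nu 1 om] c by (simp add: tilt_gain_def)
qed

lemma tilt_gain_cong:
  assumes "\<And>v. v \<in> {a<..b} \<times> VH \<Longrightarrow> nu v = nu' v" "\<And>e. e \<in> slab_edges VH EH {a<..b} \<Longrightarrow> om e = om' e"
    "\<And>i. i \<in> {a<..b} \<Longrightarrow> c i = c' i"
  shows "tilt_gain VH EH c a b nu om = tilt_gain VH EH c' a b nu' om'"
  unfolding tilt_gain_def
  by (intro arg_cong2[where f = "(-)"] log_partition_cong) (use assms in auto)

section \<open>Translation along the path\<close>

definition shift_layer :: "int \<Rightarrow> int \<times> 'a \<Rightarrow> int \<times> 'a" where
  "shift_layer a v = (fst v + a, snd v)"

lemma inj_shift: "inj (shift_layer a)"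
  by (auto simp: inj_on_def shift_layer_def prod_eq_iff)

text \<open>One inclusion, proved for every shift, suffices: the reverse one is the same inclusion
  for the shift by \<open>- a\<close>.\<close>

lemma shift_slab:
  "shift_layer a ` ({b<..d} \<times> VH) = {b + a<..d + a} \<times> VH"
  "(`) (shift_layer a) ` slab_edges VH EH {b<..d} = slab_edges VH EH {b + a<..d + a}"
proof -
  have V: "shift_layer a ` ({b<..d} \<times> VH) \<subseteq> {b + a<..d + a} \<times> VH" for a b d and VH :: "'b set"
    by (auto simp: shift_layer_def)
  have E: "(`) (shift_layer a) ` slab_edges VH EH {b<..d} \<subseteq> slab_edges VH EH {b + a<..d + a}" for a b d and VH :: "'b set" and EH
    unfolding slab_edges_def shift_layer_def by (force simp: image_iff)
  have id: "shift_layer a (shift_layer (- a) v) = v" for a and v :: "int \<times> 'b" by (simp add: shift_layer_def)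
  show "shift_layer a ` ({b<..d} \<times> VH) = {b + a<..d + a} \<times> VH"
  proof (intro equalityI V)
    have "{b + a<..d + a} \<times> VH = shift_layer a ` shift_layer (- a) ` ({b + a<..d + a} \<times> VH)"
      by (simp add: image_image id)
    also have "\<dots> \<subseteq> shift_layer a ` ({b<..d} \<times> VH)" using V[of "-a" "b + a" "d + a" VH] by (intro image_mono) simp
    finally show "{b + a<..d + a} \<times> VH \<subseteq> shift_layer a ` ({b<..d} \<times> VH)" .
  qed
  show "(`) (shift_layer a) ` slab_edges VH EH {b<..d} = slab_edges VH EH {b + a<..d + a}"
  proof (intro equalityI E)
    have "slab_edges VH EH {b + a<..d + a} = (`) (shift_layer a) ` (`) (shift_layer (- a)) ` slab_edges VH EH {b + a<..d + a}"
      by (simp add: image_image id)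
    also have "\<dots> \<subseteq> (`) (shift_layer a) ` slab_edges VH EH {b<..d}"
      using E[of "-a" VH EH "b + a" "d + a"] by (intro image_mono) simp
    finally show "slab_edges VH EH {b + a<..d + a} \<subseteq> (`) (shift_layer a) ` slab_edges VH EH {b<..d}" .
  qed
qed

text \<open>A constant tilt does not see the translation, so only the weights are moved. For
  identically distributed weights this makes the mean gain independent of the position.\<close>

lemma tilt_gain_shift:
  "tilt_gain VH EH (\<lambda>_. s) a (a + l) nu om
    = tilt_gain VH EH (\<lambda>_. s) 0 l (nu \<circ> shift_layer a) (\<lambda>e. om (shift_layer a ` e))"
proof -
  have sub: "e \<subseteq> {0<..l} \<times> VH" if "e \<in> slab_edges VH EH {0<..l}" for e
    using that unfolding slab_edges_def by auto
  have "log_partition ({a<..a + l} \<times> VH) (slab_edges VH EH {a<..a + l}) nu' om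
     = log_partition ({0<..l} \<times> VH) (slab_edges VH EH {0<..l}) (nu' \<circ> shift_layer a) (\<lambda>e. om (shift_layer a ` e))" for nu'
  proof -
    have "log_partition (shift_layer a ` ({0<..l} \<times> VH)) ((`) (shift_layer a) ` slab_edges VH EH {0<..l}) nu' om
       = log_partition ({0<..l} \<times> VH) (slab_edges VH EH {0<..l}) (nu' \<circ> shift_layer a) (\<lambda>e. om (shift_layer a ` e))"
      by (rule log_partition_image[OF inj_shift sub])
    then show ?thesis by (simp add: shift_slab add.commute)
  qed
  then show ?thesis by (simp add: tilt_gain_def comp_def)
qed

section \<open>Law of large numbers for the tilted free energy\<close>

lemma measurable_log_partition:
  assumes "\<And>v. v \<in> V \<Longrightarrow> (\<lambda>w. nu w v) \<in> borel_measurable M"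
    and "\<And>e. e \<in> E \<Longrightarrow> (\<lambda>w. om w e) \<in> borel_measurable M"
  shows "(\<lambda>w. log_partition V E (nu w) (om w)) \<in> borel_measurable M"
  unfolding log_partition_def partition_function_def hamiltonian_def
  by (intro borel_measurable_ln borel_measurable_sum borel_measurable_exp borel_measurable_add)
    (use assms in \<open>auto simp: unpaired_def matchings_def subset_iff\<close>)

lemma tilt_gain_degenerate:
  assumes "{a<..b} \<times> VH = {}"
  shows "tilt_gain VH EH c a b nu om = 0"
proof -
  have "log_partition ({a<..b} \<times> VH) (slab_edges VH EH {a<..b}) (\<lambda>v. nu v + c (fst v)) om
    = log_partition ({a<..b} \<times> VH) (slab_edges VH EH {a<..b}) nu om"
    by (rule log_partition_cong) (simp_all only: assms empty_iff)
  then show ?thesis by (simp add: tilt_gain_def)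
qed

text \<open>Jensen's inequality, read off from the nonnegative variance of
  \<open>|S|\<close>.\<close>

lemma (in prob_space) expectation_abs_le_sqrt:
  fixes S :: "'a \<Rightarrow> real"
  assumes "integrable M (\<lambda>w. \<bar>S w\<bar>)" "integrable M (\<lambda>w. (S w)\<^sup>2)" "expectation (\<lambda>w. (S w)\<^sup>2) \<le> B"
  shows "expectation (\<lambda>w. \<bar>S w\<bar>) \<le> sqrt B"
proof -
  have "variance (\<lambda>w. \<bar>S w\<bar>) \<ge> 0" by (rule variance_positive)
  then have "(expectation (\<lambda>w. \<bar>S w\<bar>))\<^sup>2 \<le> B"
    using assms by (subst (asm) variance_eq) simp_all
  then show ?thesis by (rule real_le_rsqrt)
qed

text \<open>The summand added at each step is centred and independent of the partial sum, so the
  cross term has mean 0. Boundedness supplies the integrability.\<close>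

lemma (in prob_space) expectation_square_indep_sum_le:
  fixes Y :: "'i \<Rightarrow> 'a \<Rightarrow> real"
  assumes "finite I" "indep_vars (\<lambda>_. borel) Y I"
    and "\<And>i w. i \<in> I \<Longrightarrow> w \<in> space M \<Longrightarrow> \<bar>Y i w\<bar> \<le> K" "\<And>i. i \<in> I \<Longrightarrow> expectation (Y i) = 0"
  shows "expectation (\<lambda>w. (\<Sum>i\<in>I. Y i w)\<^sup>2) \<le> real (card I) * K\<^sup>2"
  using assms
proof (induction I rule: finite_induct)
  case (insert i I)
  have Y[measurable]: "Y j \<in> borel_measurable M" if "j \<in> insert i I" for j
    using insert.prems(1) that by (auto simp: indep_vars_def)
  let ?S = "\<lambda>w. \<Sum>i\<in>I. Y i w"
  have S[measurable]: "?S \<in> borel_measurable M" by (rule borel_measurable_sum) (use Y in auto)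
  have Yi[measurable]: "Y i \<in> borel_measurable M" by (rule Y) simp
  have intY: "integrable M (Y j)" if "j \<in> insert i I" for j
    by (rule integrable_const_bound[of _ K]) (use insert.prems(2) that Y in auto)
  have intS: "integrable M ?S" by (rule Bochner_Integration.integrable_sum) (use intY in auto)
  have bS: "\<bar>?S w\<bar> \<le> real (card I) * K" if "w \<in> space M" for w
    using sum_norm_bound[of I "\<lambda>i. Y i w" K] insert.prems(2) that by simp
  have sq: "a\<^sup>2 \<le> B\<^sup>2" if "\<bar>a\<bar> \<le> B" for a B :: real
    using that by (metis abs_ge_zero power2_abs power_mono)
  have intS2: "integrable M (\<lambda>w. (?S w)\<^sup>2)"
    by (rule integrable_const_bound[of _ "(real (card I) * K)\<^sup>2"]) (use sq[OF bS] in auto)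
  have intY2: "integrable M (\<lambda>w. (Y i w)\<^sup>2)"
    by (rule integrable_const_bound[of _ "K\<^sup>2"]) (use insert.prems(2) sq in auto)
  have ind: "indep_var borel (Y i) borel ?S"
    by (rule indep_vars_sum) (use insert in auto)
  have prod: "expectation (\<lambda>w. Y i w * ?S w) = 0" "integrable M (\<lambda>w. Y i w * ?S w)"
    using indep_var_lebesgue_integral[OF ind _ intS] indep_var_integrable[OF ind _ intS] intY insert.prems(3)
    by auto
  have "expectation (\<lambda>w. (\<Sum>i\<in>insert i I. Y i w)\<^sup>2)
      = expectation (\<lambda>w. (Y i w)\<^sup>2 + (?S w)\<^sup>2 + 2 * (Y i w * ?S w))"
    by (rule arg_cong[where f = expectation]) (use insert.hyps in \<open>auto simp: fun_eq_iff power2_sum\<close>)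
  also have "\<dots> = expectation (\<lambda>w. (Y i w)\<^sup>2) + expectation (\<lambda>w. (?S w)\<^sup>2)"
    using prod intS2 intY2 by simp
  also have "expectation (\<lambda>w. (Y i w)\<^sup>2) \<le> K\<^sup>2"
    using integral_mono[OF intY2 integrable_const[of "K\<^sup>2"]] insert.prems(2) sq by (simp add: prob_space)
  also have "expectation (\<lambda>w. (?S w)\<^sup>2) \<le> real (card I) * K\<^sup>2"
    by (rule insert.IH) (use insert.prems indep_vars_subset[OF insert.prems(1)] in auto)
  finally show ?case using insert.hyps by (simp add: algebra_simps)
qed simp

text \<open>All weights on which the free energy of the layers \<open>I\<close> depends, tagged as
  in \<open>iid_weights\<close>. Disjoint sets of layers have disjoint index sets, which is the
  source of independence between blocks.\<close>

definition slab_index :: "'a set \<Rightarrow> 'a set set \<Rightarrow> int set \<Rightarrow> (int \<times> 'a + (int \<times> 'a) set) set" where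
  "slab_index VH EH I = Inl ` (I \<times> VH) \<union> Inr ` slab_edges VH EH I"

definition weight_law :: "real measure \<Rightarrow> real measure \<Rightarrow> 'b + 'c \<Rightarrow> real measure" where
  "weight_law Lnu Lom x = (case x of Inl _ \<Rightarrow> Lnu | Inr _ \<Rightarrow> Lom)"

text \<open>The expected gain of \<open>l\<close> consecutive layers, written as an integral over the product of the
  laws, which makes it visibly independent of the position of the layers.\<close>

definition mean_gain :: "'a set \<Rightarrow> 'a set set \<Rightarrow> real measure \<Rightarrow> real measure \<Rightarrow> real \<Rightarrow> int \<Rightarrow> real" where
  "mean_gain VH EH Lnu Lom s l =
     (\<integral>f. tilt_gain VH EH (\<lambda>_. s) 0 l (\<lambda>v. f (Inl v)) (\<lambda>e. f (Inr e))
        \<partial>PiM (slab_index VH EH {0<..l}) (weight_law Lnu Lom))"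

lemma block_end_le:
  assumes "0 < b" "i < q"
  shows "int i * b + b \<le> int q * b"
proof -
  have "(int i + 1) * b \<le> int q * b" by (rule mult_right_mono) (use assms in auto)
  then show ?thesis by (simp add: algebra_simps)
qed

section \<open>Block decomposition in one random cylinder\<close>

locale random_cylinder =
  fixes VH :: "'a set" and EH :: "'a set set" and n :: nat and P :: "'w measure"
    and nu :: "'w \<Rightarrow> int \<times> 'a \<Rightarrow> real" and om :: "'w \<Rightarrow> (int \<times> 'a) set \<Rightarrow> real"
    and Lnu Lom :: "real measure"
  assumes H: "finite_simple_graph VH EH"
    and iid: "iid_weights P (cyl_vertices VH n) (cyl_edges VH EH n) nu om Lnu Lom"
    and int_nu: "integrable Lnu (\<lambda>x. \<bar>x\<bar>)" and int_om: "integrable Lom (\<lambda>x. \<bar>x\<bar>)"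
begin

abbreviation "layers \<equiv> {0<..int n}"
abbreviation "gain c a b w \<equiv> tilt_gain VH EH c a b (nu w) (om w)"
abbreviation "h \<equiv> real (card VH)"

text \<open>The mean of a bond cost. It depends on \<open>VH\<close> and the two laws and not on n
  or the probability space, so one constant serves all cylinders.\<close>

definition cost :: real where
  "cost = h * (3 + (\<integral>x. \<bar>x\<bar> \<partial>Lom) + 2 * (\<integral>x. \<bar>x\<bar> \<partial>Lnu))"

sublocale prob_space P
  using iid by (simp add: iid_weights_def)

definition weight :: "int \<times> 'a + (int \<times> 'a) set \<Rightarrow> 'w \<Rightarrow> real" where
  "weight x w = (case x of Inl v \<Rightarrow> nu w v | Inr e \<Rightarrow> om w e)"

lemma indep: "indep_vars (\<lambda>_. borel) weight (slab_index VH EH layers)"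
  using iid unfolding iid_weights_def cyl_eq_slab slab_index_def weight_def[abs_def] by simp

lemma slab_index_mono: "I \<subseteq> J \<Longrightarrow> slab_index VH EH I \<subseteq> slab_index VH EH J"
  using slab_edges_mono[of I J VH EH] by (auto simp: slab_index_def)

lemma measurable_weight: "x \<in> slab_index VH EH layers \<Longrightarrow> weight x \<in> borel_measurable P"
  using indep by (auto simp: indep_vars_def)

lemma measurable_nu: "v \<in> layers \<times> VH \<Longrightarrow> (\<lambda>w. nu w v) \<in> borel_measurable P"
  using measurable_weight[of "Inl v"] by (simp add: weight_def[abs_def] slab_index_def)

lemma measurable_om: "e \<in> slab_edges VH EH layers \<Longrightarrow> (\<lambda>w. om w e) \<in> borel_measurable P"
  using measurable_weight[of "Inr e"] by (simp add: weight_def[abs_def] slab_index_def)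

lemma distr_weight: "x \<in> slab_index VH EH layers \<Longrightarrow> distr P borel (weight x) = weight_law Lnu Lom x"
  using iid unfolding iid_weights_def cyl_eq_slab
  by (auto simp: weight_def[abs_def] weight_law_def slab_index_def)

lemma interval_sub: "0 \<le> a \<Longrightarrow> b \<le> int n \<Longrightarrow> {a<..b} \<subseteq> layers"
  by auto

lemma measurable_gain [measurable]:
  assumes "0 \<le> a" "b \<le> int n"
  shows "gain c a b \<in> borel_measurable P"
  unfolding tilt_gain_def
  using interval_sub[OF assms] slab_edges_mono[OF interval_sub[OF assms], of VH EH]
  by (intro borel_measurable_diff measurable_log_partition borel_measurable_add measurable_nu measurable_om)
    auto

lemma integrable_gain:
  assumes "0 \<le> a" "b \<le> int n" "\<And>i. \<bar>c i\<bar> \<le> 1"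
  shows "integrable P (gain c a b)"
  by (rule integrable_const_bound[of _ "real (nat (b - a)) * h"])
    (use assms tilt_gain_bound[OF H] in auto)

lemma expectation_bond_cost:
  assumes "0 < b" "b < int n"
  shows "integrable P (\<lambda>w. bond_cost VH b (nu w) (om w))"
    and "expectation (\<lambda>w. bond_cost VH b (nu w) (om w)) = cost"
proof -
  have abs_weight: "integrable P (\<lambda>w. \<bar>weight x w\<bar>)"
      "expectation (\<lambda>w. \<bar>weight x w\<bar>) = (\<integral>y. \<bar>y\<bar> \<partial>weight_law Lnu Lom x)"
    if x: "x \<in> slab_index VH EH layers" for x
    using int_nu int_om integrable_distr_eq[OF measurable_weight[OF x], of abs]
      integral_distr[OF measurable_weight[OF x], of abs]
    by (simp_all add: distr_weight[OF x] weight_law_def split: sum.splits)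
  have nu: "integrable P (\<lambda>w. \<bar>nu w v\<bar>)" "expectation (\<lambda>w. \<bar>nu w v\<bar>) = (\<integral>x. \<bar>x\<bar> \<partial>Lnu)"
    if "v \<in> layers \<times> VH" for v
    using abs_weight[of "Inl v"] that by (simp_all add: weight_def weight_law_def slab_index_def)
  have om: "integrable P (\<lambda>w. \<bar>om w e\<bar>)" "expectation (\<lambda>w. \<bar>om w e\<bar>) = (\<integral>x. \<bar>x\<bar> \<partial>Lom)"
    if "e \<in> slab_edges VH EH layers" for e
    using abs_weight[of "Inr e"] that by (simp_all add: weight_def weight_law_def slab_index_def)
  have mem: "(b, j) \<in> layers \<times> VH" "(b + 1, j) \<in> layers \<times> VH"
    "{(b, j), (b + 1, j)} \<in> slab_edges VH EH layers" if "j \<in> VH" for j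
    using that assms by (auto intro!: slab_edgesI)
  have j: "integrable P (\<lambda>w. 3 + \<bar>om w {(b, j), (b + 1, j)}\<bar> + \<bar>nu w (b, j)\<bar> + \<bar>nu w (b + 1, j)\<bar>)"
    "expectation (\<lambda>w. 3 + \<bar>om w {(b, j), (b + 1, j)}\<bar> + \<bar>nu w (b, j)\<bar> + \<bar>nu w (b + 1, j)\<bar>)
       = 3 + (\<integral>x. \<bar>x\<bar> \<partial>Lom) + 2 * (\<integral>x. \<bar>x\<bar> \<partial>Lnu)" if "j \<in> VH" for j
    using nu[OF mem(1)[OF that]] nu[OF mem(2)[OF that]] om[OF mem(3)[OF that]] by (simp_all add: prob_space)
  show "integrable P (\<lambda>w. bond_cost VH b (nu w) (om w))"
    unfolding bond_cost_def by (rule Bochner_Integration.integrable_sum) (rule j)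
  show "expectation (\<lambda>w. bond_cost VH b (nu w) (om w)) = cost"
    unfolding bond_cost_def cost_def by (subst Bochner_Integration.integral_sum) (simp_all add: j)
qed

lemma cost_nonneg: "cost \<ge> 0"
  by (simp add: cost_def)

text \<open>The weights of the slab have the product of their laws as joint law, and translating the
  indices carries this product to the slab at the origin. Means taken on different probability
  spaces thereby become comparable.\<close>

lemma expectation_gain:
  assumes "0 \<le> a" "a + l \<le> int n"
  shows "expectation (gain (\<lambda>_. s) a (a + l)) = mean_gain VH EH Lnu Lom s l"
proof -
  let ?J = "slab_index VH EH {a<..a + l}" and ?K = "slab_index VH EH {0<..l}"
  let ?f = "map_sum (shift_layer a) ((`) (shift_layer a)) :: int \<times> 'a + (int \<times> 'a) set \<Rightarrow> _"
  let ?law = "weight_law Lnu Lom :: int \<times> 'a + (int \<times> 'a) set \<Rightarrow> real measure"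
  let ?F = "\<lambda>f. tilt_gain VH EH (\<lambda>_. s) 0 l (\<lambda>v. f (Inl v)) (\<lambda>e. f (Inr e))"
  have J: "?J \<subseteq> slab_index VH EH layers" by (rule slab_index_mono) (use assms in auto)
  have shiftV: "shift_layer a ` ({0<..l} \<times> VH) = {a<..a + l} \<times> VH"
    and shiftE: "(`) (shift_layer a) ` slab_edges VH EH {0<..l} = slab_edges VH EH {a<..a + l}"
    using shift_slab(1)[of a 0 l VH] shift_slab(2)[of a VH EH 0 l] by (simp_all add: add.commute)
  have fK: "?f \<in> ?K \<rightarrow> ?J"
  proof
    fix x assume "x \<in> ?K"
    then consider v where "x = Inl v" "v \<in> {0<..l} \<times> VH" | e where "x = Inr e" "e \<in> slab_edges VH EH {0<..l}"
      by (auto simp: slab_index_def)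
    then show "?f x \<in> ?J"
    proof cases
      case 1
      then have "shift_layer a v \<in> {a<..a + l} \<times> VH" unfolding shiftV[symmetric] by (rule_tac imageI)
      then show ?thesis using 1 by (simp add: slab_index_def)
    next
      case 2
      then have "shift_layer a ` e \<in> slab_edges VH EH {a<..a + l}"
        unfolding shiftE[symmetric] by (rule_tac imageI)
      then show ?thesis using 2 by (simp add: slab_index_def)
    qed
  qed
  have inj: "inj_on ?f ?K"
  proof (rule inj_on_subset[OF sum.inj_map[OF inj_shift]])
    show "inj ((`) (shift_layer a))" by (simp add: inj_on_def inj_image_eq_iff[OF inj_shift])
  qed simp
  have law_f: "?law (?f x) = ?law x" for x by (cases x) (auto simp: weight_law_def)
  have prob_law: "prob_space (?law i)" if "i \<in> ?J" for i
  proof -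
    have i: "i \<in> slab_index VH EH layers" using J that by auto
    show ?thesis unfolding distr_weight[OF i, symmetric] by (rule prob_space_distr[OF measurable_weight[OF i]])
  qed
  have sets_law: "sets (?law i) = sets borel" if "i \<in> ?J" for i
  proof -
    have i: "i \<in> slab_index VH EH layers" using J that by auto
    show ?thesis unfolding distr_weight[OF i, symmetric] by simp
  qed
  have sets_K: "sets (?law i) = sets borel" if "i \<in> ?K" for i
  proof -
    have "?f i \<in> ?J" using fK that by blast
    from sets_law[OF this] show ?thesis by (simp only: law_f)
  qed
  show ?thesis
  \<comment> \<open>Independence is used as equality of the joint law with a product over a nonempty
    index set; for an empty slab both gains vanish.\<close>
  proof (cases "?J = {}")
    case True
    then have "{a<..a + l} \<times> VH = {}" by (simp add: slab_index_def)
    moreover from this have "{0<..l} \<times> VH = {}" by auto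
    ultimately have "tilt_gain VH EH (\<lambda>_. s) a (a + l) x y = 0" "tilt_gain VH EH (\<lambda>_. s) 0 l x y = 0" for x y
      by (simp_all only: tilt_gain_degenerate)
    then show ?thesis by (simp add: mean_gain_def)
  next
    case False
    have dJ: "distr P (PiM ?J (\<lambda>_. borel)) (\<lambda>w. \<lambda>i\<in>?J. weight i w) = PiM ?J ?law"
    proof -
      have "distr P (PiM ?J (\<lambda>_. borel)) (\<lambda>w. \<lambda>i\<in>?J. weight i w) = PiM ?J (\<lambda>i. distr P borel (weight i))"
        using indep_vars_iff_distr_eq_PiM'[OF False, where X = weight and M' = "\<lambda>_. borel"]
          measurable_weight indep_vars_subset[OF indep J] J by auto
      also have "\<dots> = PiM ?J ?law" by (rule PiM_cong) (use J distr_weight in auto)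
      finally show ?thesis .
    qed
    \<comment> \<open>Reindexing by the injective translation keeps the product law because vertices
      go to vertices and edges to edges, so each index keeps its factor.\<close>
    have dK: "distr (PiM ?J ?law) (PiM ?K ?law) (\<lambda>g. \<lambda>x\<in>?K. g (?f x)) = PiM ?K ?law"
      using distr_PiM_reindex[where M = ?law, OF prob_law inj fK] by (simp add: law_f)
    have F: "?F \<in> borel_measurable (PiM ?K ?law)"
    proof -
      have "(\<lambda>f. f x) \<in> borel_measurable (PiM ?K ?law)" if "x \<in> ?K" for x
        using measurable_component_singleton[OF that, of ?law] sets_K[OF that] by (simp cong: measurable_cong_sets)
      then show ?thesis
        unfolding tilt_gain_def
        by (intro borel_measurable_diff measurable_log_partition borel_measurable_add)
          (auto simp: slab_index_def)
    qed
    have m1: "(\<lambda>g. \<lambda>x\<in>?K. g (?f x)) \<in> measurable (PiM ?J ?law) (PiM ?K ?law)"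
    proof (rule measurable_restrict)
      fix x assume "x \<in> ?K"
      then have "?f x \<in> ?J" using fK by auto
      then show "(\<lambda>g. g (?f x)) \<in> measurable (PiM ?J ?law) (?law x)"
        using measurable_component_singleton[of "?f x" ?J ?law] by (simp add: law_f)
    qed
    have m2: "(\<lambda>w. \<lambda>i\<in>?J. weight i w) \<in> measurable P (PiM ?J (\<lambda>_. borel))"
      by (rule measurable_restrict) (use measurable_weight J in auto)
    have sets_J: "sets (PiM ?J ?law) = sets (PiM ?J (\<lambda>_. borel))"
      by (rule sets_PiM_cong) (use sets_law in auto)
    have "mean_gain VH EH Lnu Lom s l = (\<integral>g. ?F g \<partial>PiM ?K ?law)"
      by (simp add: mean_gain_def)
    also have "\<dots> = (\<integral>g. ?F (\<lambda>x\<in>?K. g (?f x)) \<partial>PiM ?J ?law)"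
      by (subst dK[symmetric], rule integral_distr[OF m1 F])
    also have "\<dots> = expectation (\<lambda>w. ?F (\<lambda>x\<in>?K. (\<lambda>i\<in>?J. weight i w) (?f x)))"
    proof -
      have "(\<lambda>g. ?F (\<lambda>x\<in>?K. g (?f x))) \<in> borel_measurable (PiM ?J (\<lambda>_. borel))"
        using measurable_compose[OF m1 F] by (simp cong: measurable_cong_sets add: measurable_cong_sets[OF sets_J refl])
      then show ?thesis by (subst dJ[symmetric], rule integral_distr[OF m2])
    qed
    also have "(\<lambda>w. ?F (\<lambda>x\<in>?K. (\<lambda>i\<in>?J. weight i w) (?f x))) = gain (\<lambda>_. s) a (a + l)"
    proof
      fix w
      show "?F (\<lambda>x\<in>?K. (\<lambda>i\<in>?J. weight i w) (?f x)) = gain (\<lambda>_. s) a (a + l) w"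
        unfolding tilt_gain_shift
      proof (rule tilt_gain_cong)
        fix v assume v: "v \<in> {0<..l} \<times> VH"
        then have "Inl v \<in> ?K" by (simp add: slab_index_def)
        moreover from this have "?f (Inl v) \<in> ?J" using fK by blast
        ultimately show "(\<lambda>x\<in>?K. (\<lambda>i\<in>?J. weight i w) (?f x)) (Inl v) = (nu w \<circ> shift_layer a) v"
          by (simp add: weight_def)
      next
        fix e assume v: "e \<in> slab_edges VH EH {0<..l}"
        then have "Inr e \<in> ?K" by (simp add: slab_index_def)
        moreover from this have "?f (Inr e) \<in> ?J" using fK by blast
        ultimately show "(\<lambda>x\<in>?K. (\<lambda>i\<in>?J. weight i w) (?f x)) (Inr e) = om w (shift_layer a ` e)"
          by (simp add: weight_def)
      qed simp
    qed
    finally show ?thesis ..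
  qed
qed

lemma gain_bound:
  assumes "0 \<le> l" "\<And>i. \<bar>c i\<bar> \<le> 1"
  shows "\<bar>gain c a (a + l) w\<bar> \<le> real_of_int l * h"
  using tilt_gain_bound[OF H assms(2), where a = a and b = "a + l" and nu = "nu w" and om = "om w"]
    assms(1) by simp

lemma expectation_gain_bound:
  assumes "0 \<le> l" "0 \<le> a" "a + l \<le> int n" "\<And>i. \<bar>c i\<bar> \<le> 1"
  shows "expectation (\<lambda>w. \<bar>gain c a (a + l) w\<bar>) \<le> real_of_int l * h"
proof -
  have "expectation (\<lambda>w. \<bar>gain c a (a + l) w\<bar>) \<le> expectation (\<lambda>_. real_of_int l * h)"
    by (intro integral_mono integrable_abs integrable_gain integrable_const gain_bound assms)
  then show ?thesis by (simp add: prob_space)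
qed

lemma mean_gain_bound:
  assumes "0 \<le> l" "l \<le> int n" "\<bar>s\<bar> \<le> 1"
  shows "\<bar>mean_gain VH EH Lnu Lom s l\<bar> \<le> real_of_int l * h"
proof -
  have "\<bar>expectation (gain (\<lambda>_. s) 0 (0 + l))\<bar> \<le> expectation (\<lambda>w. \<bar>gain (\<lambda>_. s) 0 (0 + l) w\<bar>)"
    by (rule integral_abs_bound)
  also have "\<dots> \<le> real_of_int l * h"
    by (rule expectation_gain_bound) (use assms in auto)
  finally show ?thesis using expectation_gain[of 0 l s] assms by simp
qed

text \<open>Blocks are split off from the left, hence the induction over all starting points
  \<open>a\<close>. Each cut costs \<open>cost\<close> in mean, and the last \<open>r\<close> layers
  are bounded by their number of vertices.\<close>

lemma gain_blocks:
  assumes b: "0 < b" and r: "0 \<le> r" and "0 \<le> a" "a + int q * b + r \<le> int n" and c: "\<And>i. \<bar>c i\<bar> \<le> 1"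
  shows "expectation (\<lambda>w. \<bar>gain c a (a + int q * b + r) w
           - (\<Sum>i<q. gain c (a + int i * b) (a + int i * b + b) w)\<bar>) \<le> real_of_int r * h + real q * cost"
  using assms(3,4)
proof (induction q arbitrary: a)
  case 0
  show ?case using expectation_gain_bound[OF r _ _ c, where a = a] 0 by simp
next
  case (Suc q)
  let ?e = "a + b + int q * b + r"
  let ?B = "\<lambda>a q w. \<Sum>i<q. gain c (a + int i * b) (a + int i * b + b) w"
  have e: "a + int (Suc q) * b + r = ?e" by (simp add: algebra_simps)
  have B: "?B a (Suc q) w = gain c a (a + b) w + ?B (a + b) q w" for w
    by (subst sum.lessThan_Suc_shift) (simp add: algebra_simps)
  have qb: "int q * b \<ge> 0" using b by simp
  have en: "?e \<le> int n" using Suc.prems e by simp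
  note blk = block_end_le[OF b]
  have intB: "integrable P (?B (a + b) q)"
  proof (rule Bochner_Integration.integrable_sum, rule integrable_gain[OF _ _ c])
    fix i assume "i \<in> {..<q}"
    then show "a + b + int i * b + b \<le> int n" using blk[of i q] en r by simp
  qed (use Suc.prems b in auto)
  have int1: "integrable P (gain c a ?e)" and int2: "integrable P (gain c a (a + b))"
    and int3: "integrable P (gain c (a + b) ?e)"
  proof -
    have "a + b \<le> int n" using en qb r by linarith
    then show "integrable P (gain c a ?e)" "integrable P (gain c a (a + b))" "integrable P (gain c (a + b) ?e)"
      using Suc.prems(1) en b by (auto intro!: integrable_gain c)
  qed
  show ?case
  \<comment> \<open>If nothing lies to the right of the first block, there is no bond to cut and the
    difference is 0.\<close>
  proof (cases "int q * b + r = 0")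
    case True
    then have "int q * b = 0" "r = 0" using qb r by linarith+
    then have "q = 0" "r = 0" using b by auto
    then show ?thesis using cost_nonneg by simp
  next
    case False
    then have lt: "a + b < ?e" "0 < a + b" "a + b < int n" using qb r en Suc.prems(1) b by linarith+
    have "expectation (\<lambda>w. \<bar>gain c a ?e w - ?B a (Suc q) w\<bar>)
      \<le> expectation (\<lambda>w. bond_cost VH (a + b) (nu w) (om w) + \<bar>gain c (a + b) ?e w - ?B (a + b) q w\<bar>)"
    proof (rule integral_mono)
      show "integrable P (\<lambda>w. \<bar>gain c a ?e w - ?B a (Suc q) w\<bar>)"
        unfolding B using int1 int2 intB by auto
      show "integrable P (\<lambda>w. bond_cost VH (a + b) (nu w) (om w) + \<bar>gain c (a + b) ?e w - ?B (a + b) q w\<bar>)"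
        using expectation_bond_cost(1)[OF lt(2,3)] int3 intB by auto
      show "\<bar>gain c a ?e w - ?B a (Suc q) w\<bar>
         \<le> bond_cost VH (a + b) (nu w) (om w) + \<bar>gain c (a + b) ?e w - ?B (a + b) q w\<bar>" for w
        unfolding B using tilt_gain_split[where c = c and a = a and nu = "nu w" and om = "om w", OF H _ lt(1) c] b by linarith
    qed
    also have "\<dots> = cost + expectation (\<lambda>w. \<bar>gain c (a + b) ?e w - ?B (a + b) q w\<bar>)"
      using expectation_bond_cost[OF lt(2,3)] int3 intB by simp
    also have "\<dots> \<le> cost + (real_of_int r * h + real q * cost)"
      by (intro add_left_mono Suc.IH) (use Suc.prems b en in auto)
    finally show ?thesis unfolding e by (simp add: algebra_simps)
  qed
qed

text \<open>Block gains are independent with common mean, and deviate from it by at most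
  \<open>2 * b * h\<close>. The second moment of the centred sum is therefore of order
  \<open>q\<close>, and its root bounds the mean deviation.\<close>

lemma blocks_mean:
  assumes b: "0 < b" and a: "0 \<le> a" "a + int q * b \<le> int n" and s: "\<bar>s\<bar> \<le> 1"
  shows "expectation (\<lambda>w. \<bar>(\<Sum>i<q. gain (\<lambda>_. s) (a + int i * b) (a + int i * b + b) w)
           - real q * mean_gain VH EH Lnu Lom s b\<bar>) \<le> 2 * real_of_int b * h * sqrt (real q)"
proof (cases "q = 0")
  case False
  let ?e = "mean_gain VH EH Lnu Lom s b"
  define X where "X i = gain (\<lambda>_. s) (a + int i * b) (a + int i * b + b)" for i
  define Y where "Y i w = X i w - ?e" for i w
  define I where "I i = {a + int i * b<..a + int i * b + b}" for i
  note blk = block_end_le[OF b]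
  have rng: "0 \<le> a + int i * b" "a + int i * b + b \<le> int n" if "i < q" for i
    using blk[OF that] a b by auto
  have bn: "b \<le> int n" using rng(2)[of 0] False a by simp
  have Isub: "I i \<subseteq> layers" if "i < q" for i
    unfolding I_def using rng[OF that] by (rule interval_sub)
  have disjI: "I i \<inter> I j = {}" if "i \<noteq> j" for i j :: nat
    using blk[of i j] blk[of j i] that unfolding I_def by (cases "i < j") auto
  have disj: "disjoint_family_on (\<lambda>i. slab_index VH EH (I i)) {..<q}"
  proof (unfold disjoint_family_on_def, intro ballI impI)
    fix i j :: nat assume "i \<noteq> j"
    have "slab_edges VH EH (I i) \<inter> slab_edges VH EH (I j) = {}"
      using disjI[OF \<open>i \<noteq> j\<close>] unfolding slab_edges_def by (auto simp: doubleton_eq_iff)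
    then show "slab_index VH EH (I i) \<inter> slab_index VH EH (I j) = {}"
      using disjI[OF \<open>i \<noteq> j\<close>] unfolding slab_index_def by auto
  qed
  have ind0: "indep_vars (\<lambda>j. PiM (slab_index VH EH (I j)) (\<lambda>_. borel))
     (\<lambda>j w. restrict (\<lambda>i. weight i w) (slab_index VH EH (I j))) {..<q}"
    by (rule indep_vars_restrict[OF indep _ disj]) (use Isub slab_index_mono in auto)
  \<comment> \<open>Each block gain as a function of the weights of its own block, so that
    independence of the restricted families carries over.\<close>
  let ?G = "\<lambda>i f. tilt_gain VH EH (\<lambda>_. s) (a + int i * b) (a + int i * b + b) (\<lambda>v. f (Inl v)) (\<lambda>e. f (Inr e)) - ?e"
  have G: "?G i \<in> borel_measurable (PiM (slab_index VH EH (I i)) (\<lambda>_. borel))" for i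
    unfolding tilt_gain_def
    by (intro borel_measurable_diff measurable_log_partition borel_measurable_add borel_measurable_const
        measurable_component_singleton) (auto simp: slab_index_def I_def)
  have ind: "indep_vars (\<lambda>_. borel) Y {..<q}"
  proof -
    have "indep_vars (\<lambda>_. borel) (\<lambda>j w. ?G j (restrict (\<lambda>i. weight i w) (slab_index VH EH (I j)))) {..<q}"
      by (rule indep_vars_compose2[OF ind0]) (rule G)
    moreover have "?G j (restrict (\<lambda>i. weight i w) (slab_index VH EH (I j))) = Y j w" for j w
      unfolding Y_def X_def
      by (intro arg_cong2[where f = "(-)"] tilt_gain_cong refl) (auto simp: slab_index_def I_def weight_def)
    ultimately show ?thesis by simp
  qed
  have intX: "integrable P (X i)" if "i < q" for i
    unfolding X_def using rng[OF that] s by (intro integrable_gain) auto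
  have EX: "expectation (X i) = ?e" if "i < q" for i
    unfolding X_def using expectation_gain[of "a + int i * b" b s] rng[OF that] by simp
  have EY: "expectation (Y i) = 0" if "i < q" for i
    unfolding Y_def using intX[OF that] EX[OF that] by (simp add: prob_space)
  have bY: "\<bar>Y i w\<bar> \<le> 2 * real_of_int b * h" for i w
  proof -
    have "\<bar>X i w\<bar> \<le> real_of_int b * h"
      unfolding X_def by (rule gain_bound) (use s b in auto)
    moreover have "\<bar>?e\<bar> \<le> real_of_int b * h" by (rule mean_gain_bound) (use b bn s in auto)
    ultimately show ?thesis unfolding Y_def by linarith
  qed
  let ?S = "\<lambda>w. \<Sum>i<q. Y i w"
  have S: "expectation (\<lambda>w. (?S w)\<^sup>2) \<le> real (card {..<q}) * (2 * real_of_int b * h)\<^sup>2"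
    by (rule expectation_square_indep_sum_le[OF _ ind]) (use bY EY in auto)
  have bS: "\<bar>?S w\<bar> \<le> real q * (2 * real_of_int b * h)" for w
    using sum_norm_bound[of "{..<q}" "\<lambda>i. Y i w"] bY by simp
  have intS: "integrable P ?S"
    unfolding Y_def by (rule Bochner_Integration.integrable_sum) (use intX in auto)
  have intS2: "integrable P (\<lambda>w. (?S w)\<^sup>2)"
  proof (rule integrable_const_bound[of _ "(real q * (2 * real_of_int b * h))\<^sup>2"])
    show "AE w in P. norm ((?S w)\<^sup>2) \<le> (real q * (2 * real_of_int b * h))\<^sup>2"
      using bS by (intro AE_I2) (metis abs_ge_zero norm_power power2_abs power_mono real_norm_def)
    show "(\<lambda>w. (?S w)\<^sup>2) \<in> borel_measurable P"
      using borel_measurable_integrable[OF intS] by (rule borel_measurable_power)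
  qed
  have "expectation (\<lambda>w. \<bar>?S w\<bar>) \<le> sqrt (real (card {..<q}) * (2 * real_of_int b * h)\<^sup>2)"
    by (rule expectation_abs_le_sqrt[OF _ intS2 S]) (use intS in auto)
  also have "\<dots> = 2 * real_of_int b * h * sqrt (real q)" using b by (simp add: real_sqrt_mult)
  finally show ?thesis by (simp add: Y_def X_def sum_subtractf)
qed simp

text \<open>Write \<open>l = q * b + r\<close>. At most \<open>l / b\<close> cuts contribute
  \<open>cost / b\<close> per layer, the fluctuation is of order \<open>sqrt l\<close>, and the
  remainder counts twice: for the layers left over, and for the difference between \<open>q\<close>
  and \<open>l / b\<close>. The term \<open>cost / b\<close> does not shrink with \<open>l\<close>,
  so \<open>l\<close> must grow first and \<open>b\<close> afterwards.\<close>

lemma gain_near_mean: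
  assumes b: "0 < b" and a: "0 \<le> a" and l: "0 < l" "a + l \<le> int n" and bl: "b \<le> l" and s: "\<bar>s\<bar> \<le> 1"
  shows "expectation (\<lambda>w. \<bar>gain (\<lambda>_. s) a (a + l) w
            - real_of_int l * (mean_gain VH EH Lnu Lom s b / real_of_int b)\<bar>)
         \<le> real_of_int l * (cost / real_of_int b + 2 * real_of_int b * h * (1 / real_of_int l + 1 / sqrt (real_of_int l)))"
proof -
  let ?e = "mean_gain VH EH Lnu Lom s b" and ?X = "gain (\<lambda>_. s) a (a + l)"
  let ?m = "real_of_int l * (?e / real_of_int b)"
  define q where "q = nat (l div b)"
  define r where "r = l mod b"
  have q: "int q = l div b" using b l by (simp add: q_def pos_imp_zdiv_nonneg_iff)
  have lq: "l = int q * b + r" unfolding q r_def by (simp add: mult.commute)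
  have r: "0 \<le> r" "r < b" using b by (simp_all add: r_def)
  have an: "a + int q * b + r \<le> int n" "a + int q * b \<le> int n" using lq l r by auto
  let ?T = "\<lambda>w. \<Sum>i<q. gain (\<lambda>_. s) (a + int i * b) (a + int i * b + b) w"
  note blk = block_end_le[OF b]
  have intT: "integrable P ?T"
  proof (rule Bochner_Integration.integrable_sum, rule integrable_gain)
    fix i assume "i \<in> {..<q}"
    then show "a + int i * b + b \<le> int n" using blk[of i q] an r by simp
  qed (use a b s in auto)
  have intg: "integrable P (gain (\<lambda>_. s) a (a + l))" using a l s by (intro integrable_gain) auto
  have en: "\<bar>?e\<bar> \<le> real_of_int b * h" by (rule mean_gain_bound) (use b bl a l s in auto)
  have drift: "\<bar>real q * ?e - ?m\<bar> \<le> real_of_int r * h"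
  proof -
    have "real_of_int l = real q * real_of_int b + real_of_int r" using lq by (metis of_int_add of_int_mult of_int_of_nat_eq)
    then have "real q * ?e - ?m = - (real_of_int r * (?e / real_of_int b))"
      using b by (simp add: field_simps)
    moreover have "\<bar>?e / real_of_int b\<bar> \<le> h" using en b by (simp add: abs_divide divide_le_eq mult.commute)
    then have "real_of_int r * \<bar>?e / real_of_int b\<bar> \<le> real_of_int r * h"
      by (rule mult_left_mono) (use r in simp)
    moreover have "\<bar>real_of_int r * (?e / real_of_int b)\<bar> = real_of_int r * \<bar>?e / real_of_int b\<bar>"
      using r by (simp only: abs_mult)
    ultimately show ?thesis by (simp only: abs_minus_cancel)
  qed
  have "expectation (\<lambda>w. \<bar>?X w - ?m\<bar>)
     \<le> expectation (\<lambda>w. \<bar>?X w - ?T w\<bar> + \<bar>?T w - real q * ?e\<bar> + real_of_int r * h)"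
    using drift intT intg by (intro integral_mono) auto
  also have "\<dots> = expectation (\<lambda>w. \<bar>?X w - ?T w\<bar>) + expectation (\<lambda>w. \<bar>?T w - real q * ?e\<bar>)
      + real_of_int r * h"
    using intT intg by (simp add: prob_space)
  also have "expectation (\<lambda>w. \<bar>?X w - ?T w\<bar>) \<le> real_of_int r * h + real q * cost"
    using gain_blocks[OF b r(1) a an(1), where c = "\<lambda>_. s"] s lq by (simp add: add.assoc)
  also have "expectation (\<lambda>w. \<bar>?T w - real q * ?e\<bar>) \<le> 2 * real_of_int b * h * sqrt (real q)"
    by (rule blocks_mean[OF b a an(2) s])
  also have "real_of_int r * h + real q * cost + 2 * real_of_int b * h * sqrt (real q) + real_of_int r * h
     \<le> real_of_int l * (cost / real_of_int b) + 2 * real_of_int b * h * sqrt (real_of_int l) + 2 * real_of_int b * h"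
  proof -
    have "int q * b \<le> l" using lq r by simp
    then have "real q * real_of_int b \<le> real_of_int l" by (metis of_int_le_iff of_int_mult of_int_of_nat_eq)
    then have "real q \<le> real_of_int l / real_of_int b" using b by (simp add: field_simps)
    then have 1: "real q * cost \<le> real_of_int l * (cost / real_of_int b)"
      using cost_nonneg mult_right_mono by fastforce
    have "int q \<le> int q * b" using mult_left_mono[of 1 b "int q"] b by simp
    then have "real q \<le> real_of_int l" using lq r by linarith
    then have "2 * real_of_int b * h * sqrt (real q) \<le> 2 * real_of_int b * h * sqrt (real_of_int l)"
      using b by (intro mult_left_mono) auto
    moreover have "real_of_int r * h \<le> real_of_int b * h" using r by (intro mult_right_mono) auto
    ultimately show ?thesis using 1 by linarith
  qed
  also have "\<dots> = real_of_int l * (cost / real_of_int b + 2 * real_of_int b * h * (1 / real_of_int l + 1 / sqrt (real_of_int l)))"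
  proof -
    have "sqrt (real_of_int l) = real_of_int l * (1 / sqrt (real_of_int l))"
      using l by (simp add: real_div_sqrt)
    then show ?thesis using l by (simp add: field_simps)
  qed
  finally show ?thesis by simp
qed

end

section \<open>Limiting gain per layer for the sequence of cylinders\<close>

locale cylinder_family =
  fixes VH :: "'a set" and EH :: "'a set set" and P :: "nat \<Rightarrow> 'w measure"
    and nu :: "nat \<Rightarrow> 'w \<Rightarrow> int \<times> 'a \<Rightarrow> real" and om :: "nat \<Rightarrow> 'w \<Rightarrow> (int \<times> 'a) set \<Rightarrow> real"
    and Lnu Lom :: "real measure"
  assumes cylinder: "\<And>n. n \<ge> 1 \<Longrightarrow> random_cylinder VH EH n (P n) (nu n) (om n) Lnu Lom"
begin

abbreviation "gain n c a b w \<equiv> tilt_gain VH EH c a b (nu n w) (om n w)"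

text \<open>A law of large numbers in mean whose threshold \<open>L\<close> serves all positions,
  lengths and cylinders at once. The uniformity is needed because the cut, and with it the second
  half, moves with n.\<close>

definition gain_close :: "real \<Rightarrow> real \<Rightarrow> real \<Rightarrow> nat \<Rightarrow> bool" where
  "gain_close s g \<delta> L \<longleftrightarrow> (\<forall>n\<ge>1. \<forall>a l. 0 \<le> a \<longrightarrow> int L \<le> l \<longrightarrow> a + l \<le> int n \<longrightarrow>
     (\<integral>w. \<bar>gain n (\<lambda>_. s) a (a + l) w - real_of_int l * g\<bar> \<partial>P n) \<le> \<delta> * real_of_int l)"

text \<open>The means per layer \<open>U\<close> are Cauchy: for \<open>b\<close> fixed and large,
  all \<open>U k\<close> with large \<open>k\<close> are close to \<open>U b\<close>. Comparing with
  \<open>U b\<close> once more turns \<open>gain_near_mean\<close> into closeness to the limit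
  \<open>g\<close>.\<close>

lemma ex_gain_rate:
  assumes s: "\<bar>s\<bar> \<le> 1"
  shows "\<exists>g. \<forall>\<delta>>0. \<exists>L. gain_close s g \<delta> L"
proof -
  define C where "C = random_cylinder.cost VH Lnu Lom"
  define h where "h = real (card VH)"
  define U where "U k = mean_gain VH EH Lnu Lom s (int k) / real k" for k
  define \<rho> where "\<rho> b k = 2 * real b * h * (1 / real k + 1 / sqrt (real k))" for b k :: nat
  have rho0: "\<rho> b \<longlonglongrightarrow> 0" for b
  proof -
    have "(\<lambda>k. 1 / real k + sqrt (1 / real k)) \<longlonglongrightarrow> 0 + sqrt 0"
      by (intro tendsto_add tendsto_real_sqrt lim_1_over_n)
    then have "(\<lambda>k. 2 * real b * h * (1 / real k + sqrt (1 / real k))) \<longlonglongrightarrow> 2 * real b * h * (0 + sqrt 0)"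
      by (rule tendsto_mult_left)
    then show ?thesis by (simp add: \<rho>_def[abs_def] real_sqrt_divide)
  qed
  have near: "(\<integral>w. \<bar>gain n (\<lambda>_. s) a (a + int l) w - real l * U b\<bar> \<partial>P n) \<le> real l * (C / real b + \<rho> b l)"
    if "b \<ge> 1" "0 \<le> a" "b \<le> l" "a + int l \<le> int n" "n \<ge> 1" for a n b l
  proof -
    interpret R: random_cylinder VH EH n "P n" "nu n" "om n" Lnu Lom by (rule cylinder) fact
    show ?thesis
      using R.gain_near_mean[of "int b" a "int l" s] that s by (simp add: U_def \<rho>_def C_def h_def)
  qed
  \<comment> \<open>\<open>near\<close> for the whole cylinder of length \<open>l\<close>, whose
    mean gain is exactly \<open>l * U l\<close>.\<close>
  have UU: "\<bar>U l - U b\<bar> \<le> C / real b + \<rho> b l" if "b \<ge> 1" "b \<le> l" for b l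
  proof -
    have l: "l \<ge> 1" using that by simp
    interpret R: random_cylinder VH EH l "P l" "nu l" "om l" Lnu Lom by (rule cylinder) fact
    have int: "integrable (P l) (gain l (\<lambda>_. s) 0 (0 + int l))"
      by (rule R.integrable_gain) (use s in auto)
    let ?D = "\<lambda>w. gain l (\<lambda>_. s) 0 (0 + int l) w - real l * U b"
    have "real l * (U l - U b) = R.expectation ?D"
      using int R.expectation_gain[of 0 "int l" s] l by (simp add: R.prob_space U_def algebra_simps)
    then have "real l * \<bar>U l - U b\<bar> = \<bar>R.expectation ?D\<bar>"
      by (metis abs_mult abs_of_nat)
    also have "\<dots> \<le> R.expectation (\<lambda>w. \<bar>?D w\<bar>)"
      by (rule integral_abs_bound)
    also have "\<dots> \<le> real l * (C / real b + \<rho> b l)"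
      by (rule near) (use that l in auto)
    finally show ?thesis using l by simp
  qed
  have C0: "C \<ge> 0"
  proof -
    interpret R: random_cylinder VH EH 1 "P 1" "nu 1" "om 1" Lnu Lom by (rule cylinder) simp
    show ?thesis unfolding C_def by (rule R.cost_nonneg)
  qed
  have ex_b: "\<exists>b::nat. b \<ge> 1 \<and> C / real b < \<epsilon>" if "\<epsilon> > 0" for \<epsilon>
  proof -
    obtain b :: nat where b: "C / \<epsilon> < real b" using reals_Archimedean2 by blast
    have "C / \<epsilon> \<ge> 0" using C0 that by simp
    then have "b \<ge> 1" using b by (cases b) auto
    then show ?thesis using b that by (intro exI[of _ b]) (auto simp: field_simps)
  qed
  have "Cauchy U"
  proof (rule CauchyI)
    fix \<epsilon> :: real assume \<epsilon>: "\<epsilon> > 0"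
    obtain b where b: "b \<ge> 1" "C / real b < \<epsilon> / 4" using ex_b[of "\<epsilon> / 4"] \<epsilon> by auto
    have "eventually (\<lambda>k. \<rho> b k < \<epsilon> / 4) sequentially"
      by (rule order_tendstoD[OF rho0]) (use \<epsilon> in simp)
    then obtain K where K: "\<And>k. k \<ge> K \<Longrightarrow> \<rho> b k < \<epsilon> / 4" by (auto simp: eventually_sequentially)
    have near_b: "\<bar>U k - U b\<bar> < \<epsilon> / 2" if "k \<ge> max K b" for k
      using UU[of b k] K[of k] b that by linarith
    show "\<exists>M. \<forall>m\<ge>M. \<forall>n\<ge>M. norm (U m - U n) < \<epsilon>"
    proof (intro exI[of _ "max K b"] allI impI)
      fix m n assume "m \<ge> max K b" "n \<ge> max K b"
      from this[THEN near_b] show "norm (U m - U n) < \<epsilon>" unfolding real_norm_def by linarith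
    qed
  qed
  then obtain g where g: "U \<longlonglongrightarrow> g" using Cauchy_convergent convergent_def by blast
  have gU: "\<bar>g - U b\<bar> \<le> C / real b" if b: "b \<ge> 1" for b
  proof (rule LIMSEQ_le)
    show "(\<lambda>k. \<bar>U k - U b\<bar>) \<longlonglongrightarrow> \<bar>g - U b\<bar>" by (intro tendsto_intros g)
    show "(\<lambda>k. C / real b + \<rho> b k) \<longlonglongrightarrow> C / real b"
      using tendsto_add[OF tendsto_const[of "C / real b"] rho0[of b]] by simp
    show "\<exists>N. \<forall>k\<ge>N. \<bar>U k - U b\<bar> \<le> C / real b + \<rho> b k" using UU[OF b] by (intro exI[of _ b]) auto
  qed
  show ?thesis
  proof (rule exI[of _ g], intro allI impI)
    fix \<delta> :: real assume \<delta>: "\<delta> > 0"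
    obtain b where b: "b \<ge> 1" "C / real b < \<delta> / 3" using ex_b[of "\<delta> / 3"] \<delta> by auto
    have "eventually (\<lambda>k. \<rho> b k < \<delta> / 3) sequentially"
      by (rule order_tendstoD[OF rho0]) (use \<delta> in simp)
    then obtain K where K: "\<And>k. k \<ge> K \<Longrightarrow> \<rho> b k < \<delta> / 3" by (auto simp: eventually_sequentially)
    show "\<exists>L. gain_close s g \<delta> L"
    proof (rule exI[of _ "max K b"], unfold gain_close_def, intro allI impI)
      fix n a and l :: int
      assume n: "1 \<le> n" and al: "0 \<le> a" "int (max K b) \<le> l" "a + l \<le> int n"
      define k where "k = nat l"
      have l: "l = int k" "k \<ge> K" "k \<ge> b" using al by (auto simp: k_def)
      interpret R: random_cylinder VH EH n "P n" "nu n" "om n" Lnu Lom by (rule cylinder) fact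
      have int: "integrable (P n) (gain n (\<lambda>_. s) a (a + int k))"
        by (rule R.integrable_gain) (use s al l in auto)
      let ?X = "gain n (\<lambda>_. s) a (a + int k)"
      have "R.expectation (\<lambda>w. \<bar>?X w - real k * g\<bar>)
        \<le> R.expectation (\<lambda>w. \<bar>?X w - real k * U b\<bar> + real k * \<bar>g - U b\<bar>)"
      proof (rule integral_mono)
        fix w
        have "real k * U b - real k * g = - (real k * (g - U b))" by (simp add: algebra_simps)
        then have "\<bar>real k * U b - real k * g\<bar> = real k * \<bar>g - U b\<bar>" by (simp add: abs_mult)
        then show "\<bar>?X w - real k * g\<bar>
          \<le> \<bar>?X w - real k * U b\<bar> + real k * \<bar>g - U b\<bar>" by linarith
      qed (use int in auto)
      also have "\<dots> = R.expectation (\<lambda>w. \<bar>?X w - real k * U b\<bar>) + real k * \<bar>g - U b\<bar>"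
        using int by (simp add: R.prob_space)
      also have "\<dots> \<le> real k * (C / real b + \<rho> b k) + real k * (C / real b)"
        by (intro add_mono near mult_left_mono gU) (use b l al n in auto)
      also have "\<dots> = real k * (C / real b + \<rho> b k + C / real b)" by (simp add: algebra_simps)
      also have "\<dots> \<le> real k * \<delta>"
        by (rule mult_left_mono) (use b K[OF l(2)] in auto)
      finally show "R.expectation (\<lambda>w. \<bar>gain n (\<lambda>_. s) a (a + l) w - real_of_int l * g\<bar>) \<le> \<delta> * real_of_int l"
        by (simp add: l mult.commute)
    qed
  qed
qed

end

section \<open>Convergence in probability\<close>

locale prob_seq =
  fixes P :: "nat \<Rightarrow> 'w measure"
  assumes prob_P: "\<And>n. n \<ge> 1 \<Longrightarrow> prob_space (P n)"
begin

abbreviation "tends \<equiv> tendsto_in_probability P"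

lemma tends_measurable: "tends X x \<Longrightarrow> n \<ge> 1 \<Longrightarrow> X n \<in> borel_measurable (P n)"
  by (simp add: tendsto_in_probability_def)

lemma sets_deviation:
  assumes "X \<in> borel_measurable M"
  shows "{w \<in> space M. \<bar>X w - x\<bar> > (d::real)} \<in> sets M"
  using assms by measurable

lemma tends_limit: "tends X x \<Longrightarrow> d > 0 \<Longrightarrow> (\<lambda>n. measure (P n) {w \<in> space (P n). \<bar>X n w - x\<bar> > d}) \<longlonglongrightarrow> 0"
  by (simp add: tendsto_in_probability_def)

text \<open>Closure properties of convergence in probability become inclusions between deviation
  events and a union bound. The reference sequences may depend on \<open>d\<close>, which admits
  approximations of varying accuracy.\<close>

lemma tends_cover:
  assumes meas: "\<And>n. n \<ge> 1 \<Longrightarrow> X n \<in> borel_measurable (P n)"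
    and cover: "\<And>d. d > 0 \<Longrightarrow> \<exists>Y y Z z e. tends Y y \<and> tends Z z \<and> e > 0 \<and>
       (\<forall>\<^sub>F n in sequentially. \<forall>w\<in>space (P n).
          \<bar>X n w - x\<bar> > d \<longrightarrow> \<bar>Y n w - y\<bar> > e \<or> \<bar>Z n w - z\<bar> > e)"
  shows "tends X x"
  unfolding tendsto_in_probability_def
proof (intro conjI allI impI meas)
  fix d :: real assume "d > 0"
  from cover[OF this] obtain Y y Z z e where Y: "tends Y y" and Z: "tends Z z" and e: "e > 0"
    and sub: "\<forall>\<^sub>F n in sequentially. \<forall>w\<in>space (P n).
      \<bar>X n w - x\<bar> > d \<longrightarrow> \<bar>Y n w - y\<bar> > e \<or> \<bar>Z n w - z\<bar> > e" by blast
  let ?A = "\<lambda>n. {w \<in> space (P n). \<bar>Y n w - y\<bar> > e}" and ?B = "\<lambda>n. {w \<in> space (P n). \<bar>Z n w - z\<bar> > e}"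
  show "(\<lambda>n. measure (P n) {w \<in> space (P n). \<bar>X n w - x\<bar> > d}) \<longlonglongrightarrow> 0"
  proof (rule tendsto_sandwich[of "\<lambda>_. 0" _ _ "\<lambda>n. measure (P n) (?A n) + measure (P n) (?B n)"])
    show "(\<lambda>n. measure (P n) (?A n) + measure (P n) (?B n)) \<longlonglongrightarrow> 0"
      using tendsto_add[OF tends_limit[OF Y e] tends_limit[OF Z e]] by simp
    show "\<forall>\<^sub>F n in sequentially. measure (P n) {w \<in> space (P n). \<bar>X n w - x\<bar> > d}
        \<le> measure (P n) (?A n) + measure (P n) (?B n)"
      using sub eventually_ge_at_top[of 1]
    proof eventually_elim
      case (elim n)
      interpret prob_space "P n" by (rule prob_P) fact
      have AB: "?A n \<in> sets (P n)" "?B n \<in> sets (P n)"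
        using sets_deviation tends_measurable[OF Y elim(2)] tends_measurable[OF Z elim(2)] by auto
      have "prob {w \<in> space (P n). \<bar>X n w - x\<bar> > d} \<le> prob (?A n \<union> ?B n)"
        by (rule finite_measure_mono) (use elim AB in auto)
      also have "\<dots> \<le> prob (?A n) + prob (?B n)" by (rule measure_Un_le[OF AB])
      finally show ?case .
    qed
  qed auto
qed

lemma tends_approx:
  assumes meas: "\<And>n. n \<ge> 1 \<Longrightarrow> X n \<in> borel_measurable (P n)"
    and approx: "\<And>e. e > 0 \<Longrightarrow> \<exists>Y y. tends Y y \<and> \<bar>y - x\<bar> \<le> e \<and>
        (\<forall>\<^sub>F n in sequentially. \<forall>w\<in>space (P n). \<bar>X n w - Y n w\<bar> \<le> e)"
  shows "tends X x"
proof (rule tends_cover[OF meas], goal_cases)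
  case d: (2 d)
  then have "d / 4 > 0" by simp
  then obtain Y y where Y: "tends Y y" "\<bar>y - x\<bar> \<le> d / 4"
    and XY: "\<forall>\<^sub>F n in sequentially. \<forall>w\<in>space (P n). \<bar>X n w - Y n w\<bar> \<le> d / 4"
    using approx by blast
  have "\<forall>\<^sub>F n in sequentially. \<forall>w\<in>space (P n).
      \<bar>X n w - x\<bar> > d \<longrightarrow> \<bar>Y n w - y\<bar> > d / 4 \<or> \<bar>Y n w - y\<bar> > d / 4"
    using XY
  proof eventually_elim
    case (elim n)
    show ?case
    proof (intro ballI impI)
      fix w assume "w \<in> space (P n)" "\<bar>X n w - x\<bar> > d"
      then have "\<bar>X n w - Y n w\<bar> \<le> d / 4" using elim by auto
      then show "\<bar>Y n w - y\<bar> > d / 4 \<or> \<bar>Y n w - y\<bar> > d / 4"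
        using \<open>\<bar>X n w - x\<bar> > d\<close> Y(2) d by linarith
    qed
  qed
  then show ?case
    using Y(1) \<open>d / 4 > 0\<close> by blast
qed

lemma tends_const: "tends (\<lambda>n w. c) c"
  unfolding tendsto_in_probability_def by simp

lemma tends_add:
  assumes X: "tends X x" and Y: "tends Y y"
  shows "tends (\<lambda>n w. X n w + Y n w) (x + y)"
proof (rule tends_cover, goal_cases)
  case (1 n)
  show ?case using tends_measurable[OF X 1] tends_measurable[OF Y 1] by simp
next
  case (2 d)
  have "\<bar>X n w - x\<bar> > d / 2 \<or> \<bar>Y n w - y\<bar> > d / 2" if "\<bar>X n w + Y n w - (x + y)\<bar> > d" for n w
    using that by linarith
  moreover have "d / 2 > 0" using 2 by simp
  ultimately show ?case
    using X Y by (intro exI[of _ X] exI[of _ x] exI[of _ Y] exI[of _ y] exI[of _ "d / 2"] conjI always_eventually) auto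
qed

lemma tends_continuous:
  assumes X: "tends X x" and f: "continuous_on UNIV f"
  shows "tends (\<lambda>n w. f (X n w) :: real) (f x)"
proof (rule tends_cover, goal_cases)
  case (1 n)
  show ?case
    using tends_measurable[OF X 1] borel_measurable_continuous_onI[OF f] by (rule measurable_compose)
next
  case d: (2 d)
  have "isCont f x" using f by (simp add: continuous_on_eq_continuous_at)
  then obtain r where r: "r > 0" "\<And>y. \<bar>y - x\<bar> < r \<Longrightarrow> \<bar>f y - f x\<bar> < d"
    using d unfolding continuous_at_eps_delta dist_real_def by blast
  have "\<bar>y - x\<bar> > r / 2" if "\<bar>f y - f x\<bar> > d" for y
  proof (rule ccontr)
    assume "\<not> \<bar>y - x\<bar> > r / 2"
    then have "\<bar>y - x\<bar> < r" using r(1) by linarith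
    from r(2)[OF this] that show False by linarith
  qed
  moreover have "r / 2 > 0" using r by simp
  ultimately show ?case
    using X by (intro exI[of _ X] exI[of _ x] exI[of _ "r / 2"] conjI always_eventually) auto
qed

lemma tends_cmult: "tends X x \<Longrightarrow> tends (\<lambda>n w. c * X n w) (c * x)"
  by (rule tends_continuous[where f = "\<lambda>y. c * y"]) (auto intro: continuous_intros)

lemma tends_of_expectation:
  assumes meas: "\<And>n. n \<ge> 1 \<Longrightarrow> X n \<in> borel_measurable (P n)"
    and lim: "\<And>e. e > 0 \<Longrightarrow> \<forall>\<^sub>F n in sequentially. integrable (P n) (X n) \<and> (\<integral>w. \<bar>X n w - x\<bar> \<partial>P n) \<le> e"
  shows "tends X x"
  unfolding tendsto_in_probability_def
proof (intro conjI allI impI meas)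
  fix d :: real assume d: "d > 0"
  show "(\<lambda>n. measure (P n) {w \<in> space (P n). \<bar>X n w - x\<bar> > d}) \<longlonglongrightarrow> 0"
  proof (rule tendstoI)
    fix e :: real assume e: "e > 0"
    have "\<forall>\<^sub>F n in sequentially. integrable (P n) (X n) \<and> (\<integral>w. \<bar>X n w - x\<bar> \<partial>P n) \<le> d * e / 2"
      by (rule lim) (use d e in simp)
    then show "\<forall>\<^sub>F n in sequentially. dist (measure (P n) {w \<in> space (P n). \<bar>X n w - x\<bar> > d}) 0 < e"
      using eventually_ge_at_top[of 1]
    proof eventually_elim
      case (elim n)
      interpret prob_space "P n" by (rule prob_P) (use elim in auto)
      have [measurable]: "X n \<in> borel_measurable (P n)" by (rule meas) (use elim in auto)
      have int: "integrable (P n) (\<lambda>w. \<bar>X n w - x\<bar>)" using elim by simp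
      have "prob {w \<in> space (P n). \<bar>X n w - x\<bar> > d} \<le> prob {w \<in> space (P n). \<bar>X n w - x\<bar> \<ge> d}"
        by (rule finite_measure_mono) auto
      also have "\<dots> \<le> expectation (\<lambda>w. \<bar>X n w - x\<bar>) / d"
        by (rule integral_Markov_inequality_measure[OF int, of "{}"]) (use d in auto)
      also have "\<dots> \<le> (d * e / 2) / d"
        by (rule divide_right_mono) (use elim d in auto)
      also have "\<dots> < e" using d e by simp
      finally show ?case by simp
    qed
  qed
qed

text \<open>For large n both exceptional events have probability below 1/2 and cannot cover the
  space. At a common good point, deterministic relations between the variables pass to their
  limits.\<close>

lemma tends_common_point:
  assumes X: "tends X x" and Y: "tends Y y" and d: "d > 0" and Q: "\<forall>\<^sub>F n in sequentially. Q n"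
  obtains n w where "n \<ge> 1" "Q n" "w \<in> space (P n)" "\<bar>X n w - x\<bar> \<le> d" "\<bar>Y n w - y\<bar> \<le> d"
proof -
  have "\<forall>\<^sub>F n in sequentially. measure (P n) {w \<in> space (P n). \<bar>X n w - x\<bar> > d} < 1/2"
    "\<forall>\<^sub>F n in sequentially. measure (P n) {w \<in> space (P n). \<bar>Y n w - y\<bar> > d} < 1/2"
    by (rule order_tendstoD(2)[OF tends_limit[OF X d]], simp, rule order_tendstoD(2)[OF tends_limit[OF Y d]], simp)
  then have "\<forall>\<^sub>F n in sequentially. measure (P n) {w \<in> space (P n). \<bar>X n w - x\<bar> > d} < 1/2
     \<and> measure (P n) {w \<in> space (P n). \<bar>Y n w - y\<bar> > d} < 1/2 \<and> Q n \<and> n \<ge> 1"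
    using Q eventually_ge_at_top[of 1] by eventually_elim simp
  then obtain n where n: "measure (P n) {w \<in> space (P n). \<bar>X n w - x\<bar> > d} < 1/2"
     "measure (P n) {w \<in> space (P n). \<bar>Y n w - y\<bar> > d} < 1/2" "Q n" "n \<ge> 1"
    using eventually_happens'[OF sequentially_bot] by blast
  interpret prob_space "P n" by (rule prob_P) fact
  let ?A = "{w \<in> space (P n). \<bar>X n w - x\<bar> > d}" and ?B = "{w \<in> space (P n). \<bar>Y n w - y\<bar> > d}"
  have AB: "?A \<in> sets (P n)" "?B \<in> sets (P n)"
    using sets_deviation tends_measurable[OF X n(4)] tends_measurable[OF Y n(4)] by auto
  have "prob (?A \<union> ?B) < 1"
    using measure_Un_le[OF AB] n by linarith
  then have "?A \<union> ?B \<noteq> space (P n)" using prob_space by auto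
  then obtain w where "w \<in> space (P n)" "w \<notin> ?A \<union> ?B" by blast
  then show ?thesis using that[of n w] n by force
qed

lemma tends_nonneg:
  assumes "tends X x" "\<And>n w. n \<ge> 1 \<Longrightarrow> w \<in> space (P n) \<Longrightarrow> X n w \<ge> 0"
  shows "x \<ge> 0"
proof (rule ccontr)
  assume "\<not> x \<ge> 0"
  then have "- x / 2 > 0" by simp
  from tends_common_point[OF assms(1,1) this, of "\<lambda>_. True"] obtain n w where
    "n \<ge> 1" "w \<in> space (P n)" "\<bar>X n w - x\<bar> \<le> - x / 2" by auto
  then show False using assms(2)[of n w] \<open>\<not> x \<ge> 0\<close> by linarith
qed

text \<open>The limit is not known in advance: it is produced from the limits \<open>y s\<close> of
  approximations that are off by at most \<open>C s\<close>, which are therefore Cauchy as \<open>s \<rightarrow> 0\<close>.\<close>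

lemma ex_tends_of_approx:
  assumes meas: "\<And>n. n \<ge> 1 \<Longrightarrow> X n \<in> borel_measurable (P n)" and C: "C \<ge> 0"
    and Y: "\<And>s. 0 < s \<Longrightarrow> s \<le> 1/2 \<Longrightarrow> tends (Y s) (y s)"
    and app: "\<And>s. 0 < s \<Longrightarrow> s \<le> 1/2 \<Longrightarrow>
       \<forall>\<^sub>F n in sequentially. \<forall>w\<in>space (P n). \<bar>X n w - Y s n w\<bar> \<le> C * s"
  obtains x where "tends X x" "\<And>s. 0 < s \<Longrightarrow> s \<le> 1/2 \<Longrightarrow> \<bar>y s - x\<bar> \<le> C * s"
proof -
  have yy: "\<bar>y s - y r\<bar> \<le> C * s + C * r" if s: "0 < s" "s \<le> 1/2" and r: "0 < r" "r \<le> 1/2" for s r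
  proof (rule field_le_epsilon)
    fix e :: real assume e: "e > 0"
    then have "e / 2 > 0" by simp
    then obtain n w where n: "n \<ge> 1" "(\<forall>w\<in>space (P n). \<bar>X n w - Y s n w\<bar> \<le> C * s) \<and> (\<forall>w\<in>space (P n). \<bar>X n w - Y r n w\<bar> \<le> C * r)"
      "w \<in> space (P n)" "\<bar>Y s n w - y s\<bar> \<le> e / 2" "\<bar>Y r n w - y r\<bar> \<le> e / 2"
      using tends_common_point[OF Y[OF s] Y[OF r] _ eventually_conj[OF app[OF s] app[OF r]]] by metis
    then have "\<bar>X n w - Y s n w\<bar> \<le> C * s" "\<bar>X n w - Y r n w\<bar> \<le> C * r" by auto
    then show "\<bar>y s - y r\<bar> \<le> C * s + C * r + e" using n by linarith
  qed
  \<comment> \<open>The shift by 2 keeps the step in the admissible range, at most 1/2, from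
    \<open>k = 0\<close> on.\<close>
  define z where "z k = y (1 / (real k + 2))" for k :: nat
  have rng: "0 < 1 / (real k + 2)" "1 / (real k + 2) \<le> 1/2" for k by (auto simp: field_simps)
  have lim0: "(\<lambda>k. C * (1 / (real k + 2))) \<longlonglongrightarrow> 0"
  proof -
    have "(\<lambda>k. 1 / real (k + 2)) \<longlonglongrightarrow> 0" by (rule LIMSEQ_ignore_initial_segment[OF lim_1_over_n])
    from tendsto_mult_left[OF this, of C] show ?thesis by (simp add: add.commute)
  qed
  have "Cauchy z"
  proof (rule CauchyI)
    fix e :: real assume e: "e > 0"
    have "\<forall>\<^sub>F k in sequentially. C * (1 / (real k + 2)) < e / 2"
      by (rule order_tendstoD(2)[OF lim0]) (use e in simp)
    then obtain K where K: "\<And>k. k \<ge> K \<Longrightarrow> C * (1 / (real k + 2)) < e / 2" by (auto simp: eventually_sequentially)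
    show "\<exists>M. \<forall>m\<ge>M. \<forall>n\<ge>M. norm (z m - z n) < e"
    proof (intro exI[of _ K] allI impI)
      fix m n assume "m \<ge> K" "n \<ge> K"
      then show "norm (z m - z n) < e"
        using K[of m] K[of n] yy[OF rng[of m] rng[of n]] unfolding z_def real_norm_def by linarith
    qed
  qed
  then obtain x where x: "z \<longlonglongrightarrow> x" using Cauchy_convergent convergent_def by blast
  have yx: "\<bar>y s - x\<bar> \<le> C * s" if s: "0 < s" "s \<le> 1/2" for s
  proof (rule LIMSEQ_le)
    show "(\<lambda>k. \<bar>y s - z k\<bar>) \<longlonglongrightarrow> \<bar>y s - x\<bar>" by (intro tendsto_intros x)
    show "(\<lambda>k. C * s + C * (1 / (real k + 2))) \<longlonglongrightarrow> C * s"
      using tendsto_add[OF tendsto_const[of "C * s"] lim0] by simp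
    show "\<exists>N. \<forall>k\<ge>N. \<bar>y s - z k\<bar> \<le> C * s + C * (1 / (real k + 2))"
      unfolding z_def using yy[OF s rng] by blast
  qed
  have "tends X x"
  proof (rule tends_approx[OF meas], goal_cases)
    case e: (2 e)
    \<comment> \<open>Dividing by \<open>C\<close> itself would give the inadmissible step 0 when
      \<open>C = 0\<close>.\<close>
    define s where "s = min (1/2) (e / (C + 1))"
    have s: "0 < s" using e C by (simp add: s_def)
    have s2: "s \<le> 1/2" unfolding s_def by (rule min.cobounded1)
    have "C * s \<le> C * (e / (C + 1))" using C by (intro mult_left_mono) (auto simp: s_def)
    also have "\<dots> \<le> e" using C e by (simp add: field_simps)
    finally have Cs: "C * s \<le> e" .
    show ?case
    proof (intro exI conjI)
      show "tends (Y s) (y s)" by (rule Y[OF s s2])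
      show "\<bar>y s - x\<bar> \<le> e" using yx[OF s s2] Cs by linarith
      show "\<forall>\<^sub>F n in sequentially. \<forall>w\<in>space (P n). \<bar>X n w - Y s n w\<bar> \<le> e"
        using app[OF s s2]
      proof eventually_elim
        case (elim n)
        then show ?case using Cs order_trans by blast
      qed
    qed
  qed
  from that[OF this yx] show ?thesis .
qed

end

section \<open>Quenched variances and characteristic functions\<close>

context finite_graph
begin

lemma hamiltonian_tilt:
  "hamiltonian V (\<lambda>v. nu v + s * c v) om m = hamiltonian V nu om m + s * tilt_sum c V m"
  by (simp add: hamiltonian_def tilt_sum_def sum.distrib sum_distrib_left)

text \<open>Normalisation divides the generating function and its derivative by the same positive
  number, so the Heilmann-Lieb bound survives with \<open>A = 2 * card V\<close>.\<close>

lemma exp_sum_gibbs: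
  assumes c: "\<And>v. v \<in> V \<Longrightarrow> \<bar>c v\<bar> \<le> 1"
  shows "exp_sum (matchings E) (gibbs_weight V E nu om) (tilt_sum c V) (2 * real (card V))"
proof
  let ?Z = "partition_function V E nu om" and ?w = "\<lambda>m. exp (hamiltonian V nu om m)"
  let ?G = "exp_gen (matchings E) (gibbs_weight V E nu om) (tilt_sum c V)"
    and ?D = "exp_gen' (matchings E) (gibbs_weight V E nu om) (tilt_sum c V)"
  have Z: "?Z > 0" by (rule partition_function_pos)
  show "finite (matchings E)" by (rule finite_matchings[OF finite_E])
  show "gibbs_weight V E nu om m \<ge> 0" for m using Z by (simp add: gibbs_weight_def)
  show "(\<Sum>m\<in>matchings E. gibbs_weight V E nu om m) = 1"
    using Z by (simp add: gibbs_weight_def partition_function_def flip: sum_divide_distrib)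
  fix z :: complex assume z: "norm z < 1"
  have "\<bar>Im z\<bar> \<le> 1" using abs_Im_le_cmod[of z] z by linarith
  note bnd = exp_gen_hamiltonian_bound[where c = c and nu = nu and om = om, OF c this]
  have 1: "?G z = exp_gen (matchings E) ?w (tilt_sum c V) z / of_real ?Z"
    "?D z = exp_gen' (matchings E) ?w (tilt_sum c V) z / of_real ?Z"
    by (simp_all add: gibbs_weight_def exp_gen_def exp_gen'_def sum_divide_distrib)
  show "?G z \<noteq> 0 \<and>
      cmod (?D z) \<le> 2 * real (card V) * cmod (?G z)"
    unfolding 1 using bnd Z by (simp add: norm_divide divide_right_mono)
qed

definition gibbs_variance :: "('v \<Rightarrow> real) \<Rightarrow> ('v set \<Rightarrow> real) \<Rightarrow> ('v set set \<Rightarrow> real) \<Rightarrow> real" where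
  "gibbs_variance nu om X =
     gibbs_average V E nu om (\<lambda>m. (X m)\<^sup>2) - (gibbs_average V E nu om X)\<^sup>2"

context
  fixes c :: "'v \<Rightarrow> real" and nu :: "'v \<Rightarrow> real" and om :: "'v set \<Rightarrow> real"
  assumes c: "\<And>v. v \<in> V \<Longrightarrow> \<bar>c v\<bar> \<le> 1"
begin

interpretation S: exp_sum "matchings E" "gibbs_weight V E nu om" "tilt_sum c V" "2 * real (card V)"
  by (rule exp_sum_gibbs[OF c])

lemma gibbs_variance_eq: "gibbs_variance nu om (tilt_sum c V) = S.var"
  by (simp add: gibbs_variance_def S.var_def S.mean_def gibbs_average_def)

lemma gibbs_variance_bounds:
  "0 \<le> gibbs_variance nu om (tilt_sum c V)" "gibbs_variance nu om (tilt_sum c V) \<le> 4 * real (card V)"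
  "gibbs_variance nu om (tilt_sum c V)
     = gibbs_average V E nu om (\<lambda>m. (tilt_sum c V m - gibbs_average V E nu om (tilt_sum c V))\<^sup>2)"
  using S.var_nonneg S.var_le S.var_eq unfolding gibbs_variance_eq by (auto simp: S.mean_def gibbs_average_def)

text \<open>The Gibbs average of \<open>exp (r * tilt_sum c V m)\<close> is a ratio of partition
  functions, so its logarithm is a difference of free energies. The 64 is 32 times the factor 2 in
  \<open>A\<close>.\<close>

lemma log_partition_second_difference:
  assumes s: "\<bar>s\<bar> \<le> 1/2"
  shows "\<bar>(log_partition V E (\<lambda>v. nu v + s * c v) om - log_partition V E nu om)
     + (log_partition V E (\<lambda>v. nu v + - s * c v) om - log_partition V E nu om)
     - gibbs_variance nu om (tilt_sum c V) * s\<^sup>2\<bar> \<le> 64 * real (card V) * \<bar>s\<bar> ^ 3"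
proof -
  have *: "ln (\<Sum>m\<in>matchings E. gibbs_weight V E nu om m * exp (r * tilt_sum c V m))
     = log_partition V E (\<lambda>v. nu v + r * c v) om - log_partition V E nu om" for r
  proof -
    have "(\<Sum>m\<in>matchings E. gibbs_weight V E nu om m * exp (r * tilt_sum c V m))
      = partition_function V E (\<lambda>v. nu v + r * c v) om / partition_function V E nu om"
      by (simp add: gibbs_weight_def partition_function_def[of V E "\<lambda>v. nu v + r * c v"] hamiltonian_tilt
          exp_add sum_divide_distrib)
    then show ?thesis
      using partition_function_pos[of nu om] partition_function_pos[of "\<lambda>v. nu v + r * c v" om]
      by (simp add: log_partition_def ln_div)
  qed
  show ?thesis
    using S.second_difference[OF s] unfolding gibbs_variance_eq * by simp
qed

text \<open>Real and imaginary parts of the characteristic function, because Gibbs averages are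
  real. The constants 32 and 96 are 16 and 48 with \<open>A = 2 * card V\<close>.\<close>

lemma gibbs_char_approx:
  assumes t: "\<bar>t\<bar> \<le> 1/2" "32 * real (card V) * \<bar>t\<bar> ^ 3 \<le> 1"
  defines "a \<equiv> gibbs_average V E nu om (tilt_sum c V)"
  shows "\<bar>gibbs_average V E nu om (\<lambda>m. cos (t * (tilt_sum c V m - a)))
            - exp (- gibbs_variance nu om (tilt_sum c V) * t\<^sup>2 / 2)\<bar> \<le> 96 * real (card V) * \<bar>t\<bar> ^ 3" (is "?R \<le> _")
    and "\<bar>gibbs_average V E nu om (\<lambda>m. sin (t * (tilt_sum c V m - a)))\<bar> \<le> 96 * real (card V) * \<bar>t\<bar> ^ 3"
proof -
  let ?D = "(\<Sum>m\<in>matchings E. of_real (gibbs_weight V E nu om m) * exp (\<i> * of_real (t * (tilt_sum c V m - S.mean))))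
      - of_real (exp (- S.var * t\<^sup>2 / 2))"
  have a: "a = S.mean" by (simp add: a_def S.mean_def gibbs_average_def)
  have D: "cmod ?D \<le> 96 * real (card V) * \<bar>t\<bar> ^ 3"
    using S.char_approx[of t] t by simp
  have re: "Re (exp (\<i> * of_real x)) = cos x" and im: "Im (exp (\<i> * of_real x)) = sin x" for x
    by (simp_all add: Re_exp Im_exp)
  have "Re ?D = gibbs_average V E nu om (\<lambda>m. cos (t * (tilt_sum c V m - a))) - exp (- S.var * t\<^sup>2 / 2)"
    by (simp only: minus_complex.simps Re_sum times_complex.simps Re_complex_of_real Im_complex_of_real re im
        gibbs_average_def a) (simp add: mult.commute)
  then show "?R \<le> 96 * real (card V) * \<bar>t\<bar> ^ 3"
    unfolding gibbs_variance_eq using abs_Re_le_cmod[of ?D] D by linarith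
  have "Im ?D = gibbs_average V E nu om (\<lambda>m. sin (t * (tilt_sum c V m - a)))"
    by (simp only: minus_complex.simps Im_sum times_complex.simps Re_complex_of_real Im_complex_of_real re im
        gibbs_average_def a) (simp add: mult.commute)
  then show "\<bar>gibbs_average V E nu om (\<lambda>m. sin (t * (tilt_sum c V m - a)))\<bar> \<le> 96 * real (card V) * \<bar>t\<bar> ^ 3"
    using abs_Im_le_cmod[of ?D] D by linarith
qed

end

lemma gibbs_average_add:
  "gibbs_average V E nu om (\<lambda>m. X m + Y m) = gibbs_average V E nu om X + gibbs_average V E nu om Y"
  by (simp add: gibbs_average_def distrib_right sum.distrib)

lemma gibbs_average_cmult: "gibbs_average V E nu om (\<lambda>m. r * X m) = r * gibbs_average V E nu om X"
  by (simp add: gibbs_average_def sum_distrib_left mult.assoc)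

lemma gibbs_average_mono:
  assumes "\<And>m. m \<in> matchings E \<Longrightarrow> X m \<le> Y m"
  shows "gibbs_average V E nu om X \<le> gibbs_average V E nu om Y"
  unfolding gibbs_average_def
  by (intro sum_mono mult_right_mono assms)
    (use partition_function_pos[of nu om] in \<open>auto simp: gibbs_weight_def\<close>)

lemma gibbs_average_const: "gibbs_average V E nu om (\<lambda>_. r) = r"
proof -
  have "(\<Sum>m\<in>matchings E. gibbs_weight V E nu om m) = 1"
    using partition_function_pos[of nu om]
    by (simp add: gibbs_weight_def partition_function_def flip: sum_divide_distrib)
  then show ?thesis by (simp add: gibbs_average_def flip: sum_distrib_left)
qed

lemma gibbs_average_abs_le:
  "\<bar>gibbs_average V E nu om X\<bar> \<le> gibbs_average V E nu om (\<lambda>m. \<bar>X m\<bar>)"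
  using gibbs_average_mono[of X "\<lambda>m. \<bar>X m\<bar>" nu om] gibbs_average_mono[of "\<lambda>m. - 1 * X m" "\<lambda>m. \<bar>X m\<bar>" nu om]
  unfolding gibbs_average_cmult by (simp add: abs_le_iff)

end

section \<open>Asymptotic variance and characteristic function of tilted counts\<close>

lemma eventually_ge_of_ratio:
  fixes f :: "nat \<Rightarrow> int"
  assumes "(\<lambda>n. real_of_int (f n) / real n) \<longlonglongrightarrow> r" "r > 0"
  shows "\<forall>\<^sub>F n in sequentially. f n \<ge> L"
proof -
  have "filterlim (\<lambda>n. real_of_int (f n) / real n * real n) at_top sequentially"
    by (rule filterlim_tendsto_pos_mult_at_top[OF assms filterlim_real_sequentially])
  then have "\<forall>\<^sub>F n in sequentially. real_of_int (f n) / real n * real n \<ge> real_of_int L"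
    by (simp add: filterlim_at_top)
  then show ?thesis using eventually_gt_at_top[of 0] by eventually_elim simp
qed

text \<open>Linear functionals of the two counts appear as tilts with one value per half; letting
  \<open>u\<close> and \<open>v\<close> vary replaces a treatment of the joint law.\<close>

definition two_tilt :: "int \<Rightarrow> real \<Rightarrow> real \<Rightarrow> int \<Rightarrow> real" where
  "two_tilt k u v i = (if i \<le> k then u else v)"

context cylinder_family
begin

lemma prob_space_P:
  assumes "n \<ge> 1"
  shows "prob_space (P n)"
proof -
  interpret R: random_cylinder VH EH n "P n" "nu n" "om n" Lnu Lom by (rule cylinder[OF assms])
  show ?thesis by (rule R.prob_space_axioms)
qed

sublocale prob_seq P
  by (rule prob_seq.intro) (rule prob_space_P)

abbreviation "h \<equiv> real (card VH)"

lemma finite_simple: "finite_simple_graph VH EH"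
  using random_cylinder.H[OF cylinder[of 1]] by simp

text \<open>Only meaningful for \<open>\<bar>s\<bar> \<le> 1\<close>, where the limiting gain per layer is known to exist.\<close>

definition rate :: "real \<Rightarrow> real" where
  "rate s = (SOME g. \<forall>\<delta>>0. \<exists>L. gain_close s g \<delta> L)"

lemma rate:
  assumes "\<bar>s\<bar> \<le> 1" "\<delta> > 0"
  shows "\<exists>L. gain_close s (rate s) \<delta> L"
  using someI_ex[OF ex_gain_rate[OF assms(1)]] assms(2) unfolding rate_def[symmetric] by blast

text \<open>\<open>rate\<close> is a chosen value, so even this one has to be extracted from its
  defining property, here on the cylinder of length \<open>L + 1\<close>.\<close>

lemma rate_0: "rate 0 = 0"
proof -
  have z: "gain n (\<lambda>_. 0) a b w = 0" for n a b w by (simp add: tilt_gain_def)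
  have "\<bar>rate 0\<bar> \<le> 0"
  proof (rule field_le_epsilon)
    fix \<delta> :: real assume \<delta>: "\<delta> > 0"
    obtain L where L: "gain_close 0 (rate 0) \<delta> L"
      using rate[OF _ \<delta>, of 0] by auto
    interpret R: prob_space "P (Suc L)" by (rule prob_P) simp
    have "real (Suc L) * \<bar>rate 0\<bar> \<le> real (Suc L) * \<delta>"
      using L[unfolded gain_close_def z, rule_format, of "Suc L" 0 "int (Suc L)"]
      by (simp add: R.prob_space abs_mult mult.commute del: of_nat_Suc)
    then show "\<bar>rate 0\<bar> \<le> 0 + \<delta>"
      by (simp only: mult_le_cancel_left_pos[of "real (Suc L)"] of_nat_0_less_iff zero_less_Suc add_0)
  qed
  then show ?thesis by simp
qed

text \<open>One cut after layer \<open>k n\<close> leaves two slabs with constant tilts, both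
  eventually longer than the thresholds of \<open>gain_close\<close>. The bond cost vanishes after
  division by n; what remains is an average of the two errors per layer and the deviation of
  \<open>k n / n\<close> from \<open>t\<close>.\<close>

lemma tends_gain:
  assumes u: "\<bar>u\<bar> \<le> 1" and v: "\<bar>v\<bar> \<le> 1" and t: "0 < t" "t < 1"
    and k: "(\<lambda>n. real_of_int (k n) / real n) \<longlonglongrightarrow> t"
  shows "tends (\<lambda>n w. gain n (two_tilt (k n) u v) 0 (int n) w / real n) (t * rate u + (1 - t) * rate v)"
proof (rule tends_of_expectation, goal_cases)
  case (1 n)
  interpret R: random_cylinder VH EH n "P n" "nu n" "om n" Lnu Lom by (rule cylinder) fact
  show ?case by (intro borel_measurable_divide R.measurable_gain) auto
next
  case e: (2 e)
  have c: "\<bar>two_tilt j u v i\<bar> \<le> 1" for i j using u v by (simp add: two_tilt_def)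
  have e4: "e / 4 > 0" using e by simp
  define K where "K = random_cylinder.cost VH Lnu Lom"
  obtain L1 where L1: "gain_close u (rate u) (e / 4) L1"
    using rate[OF u e4] by blast
  obtain L2 where L2: "gain_close v (rate v) (e / 4) L2"
    using rate[OF v e4] by blast
  \<comment> \<open>The \<open>max\<close> with 1, here and for the other half, places the cut
    strictly inside the cylinder, so that a bond crosses it.\<close>
  have ev1: "\<forall>\<^sub>F n in sequentially. k n \<ge> max 1 (int L1)"
    by (rule eventually_ge_of_ratio[OF k t(1)])
  have k': "(\<lambda>n. real_of_int (int n - k n) / real n) \<longlonglongrightarrow> 1 - t"
  proof (rule Lim_transform_eventually[OF tendsto_diff[OF tendsto_const k]])
    show "\<forall>\<^sub>F n in sequentially. 1 - real_of_int (k n) / real n = real_of_int (int n - k n) / real n"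
      using eventually_gt_at_top[of 0] by eventually_elim (simp add: diff_divide_distrib)
  qed
  have ev2: "\<forall>\<^sub>F n in sequentially. int n - k n \<ge> max 1 (int L2)"
    by (rule eventually_ge_of_ratio[OF k']) (use t in simp)
  have ev3: "\<forall>\<^sub>F n in sequentially. \<bar>real_of_int (k n) / real n - t\<bar> * (\<bar>rate u\<bar> + \<bar>rate v\<bar>) < e / 4"
  proof (rule order_tendstoD(2))
    show "(\<lambda>n. \<bar>real_of_int (k n) / real n - t\<bar> * (\<bar>rate u\<bar> + \<bar>rate v\<bar>)) \<longlonglongrightarrow> \<bar>t - t\<bar> * (\<bar>rate u\<bar> + \<bar>rate v\<bar>)"
      by (intro tendsto_intros k)
  qed (use e in simp)
  have ev4: "\<forall>\<^sub>F n in sequentially. K * (1 / real n) < e / 4"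
    by (rule order_tendstoD(2)[OF tendsto_mult_right_zero[OF lim_1_over_n]]) (use e in simp)
  show ?case
    using ev1 ev2 ev3 ev4 eventually_ge_at_top[of 1]
  proof eventually_elim
    case (elim n)
    interpret R: random_cylinder VH EH n "P n" "nu n" "om n" Lnu Lom by (rule cylinder) (use elim in simp)
    let ?c = "two_tilt (k n) u v"
    let ?X = "gain n ?c 0 (int n)"
    let ?G1 = "gain n (\<lambda>_. u) 0 (0 + k n)" and ?G2 = "gain n (\<lambda>_. v) (k n) (k n + (int n - k n))"
    have kn: "0 < k n" "k n < int n" using elim by auto
    have G1: "gain n ?c 0 (k n) w = ?G1 w" for w
      by (simp, rule tilt_gain_cong) (auto simp: two_tilt_def)
    have G2: "gain n ?c (k n) (int n) w = ?G2 w" for w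
      by (simp, rule tilt_gain_cong) (auto simp: two_tilt_def)
    have int: "integrable (P n) (?X)" "integrable (P n) ?G1" "integrable (P n) ?G2"
      using kn u v by (auto intro!: R.integrable_gain c)
    note bc = R.expectation_bond_cost[OF kn]
    let ?x = "t * rate u + (1 - t) * rate v" and ?r = "real_of_int (k n) / real n"
    let ?b = "\<lambda>w. bond_cost VH (k n) (nu n w) (om n w) + \<bar>?G1 w - real_of_int (k n) * rate u\<bar>
         + \<bar>?G2 w - real_of_int (int n - k n) * rate v\<bar>"
    let ?m = "real_of_int (k n) * rate u + real_of_int (int n - k n) * rate v"
    let ?B = "\<lambda>w. ?b w / real n + \<bar>?r - t\<bar> * (\<bar>rate u\<bar> + \<bar>rate v\<bar>)"
    have n0: "real n > 0" using elim by simp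
    have "\<bar>?X w / real n - ?x\<bar> \<le> ?B w" for w
    proof -
      have "\<bar>?X w - ?G1 w - ?G2 w\<bar> \<le> bond_cost VH (k n) (nu n w) (om n w)"
        using tilt_gain_split[where c = ?c and nu = "nu n w" and om = "om n w", OF finite_simple kn c]
        unfolding G1 G2 .
      then have "\<bar>?X w - ?m\<bar> \<le> ?b w" by linarith
      then have 1: "\<bar>(?X w - ?m) / real n\<bar> \<le> ?b w / real n"
        unfolding abs_divide abs_of_nat by (rule divide_right_mono) simp
      have 2: "?X w / real n - ?x
        = (?X w - ?m) / real n + (?r - t) * (rate u - rate v)"
        using n0 by (simp add: field_simps)
      have "\<bar>(?r - t) * (rate u - rate v)\<bar> \<le> \<bar>?r - t\<bar> * (\<bar>rate u\<bar> + \<bar>rate v\<bar>)"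
        unfolding abs_mult by (intro mult_left_mono) auto
      with 1 show ?thesis unfolding 2 by (rule order_trans[OF abs_triangle_ineq add_mono])
    qed
    then have "R.expectation (\<lambda>w. \<bar>?X w / real n - ?x\<bar>) \<le> R.expectation ?B"
      using int bc by (intro integral_mono) auto
    also have "\<dots> = (K + R.expectation (\<lambda>w. \<bar>?G1 w - real_of_int (k n) * rate u\<bar>)
         + R.expectation (\<lambda>w. \<bar>?G2 w - real_of_int (int n - k n) * rate v\<bar>)) / real n + \<bar>?r - t\<bar> * (\<bar>rate u\<bar> + \<bar>rate v\<bar>)"
      using int bc by (simp add: R.prob_space K_def)
    also have "\<dots> \<le> (K + e / 4 * real_of_int (k n) + e / 4 * real_of_int (int n - k n)) / real n + e / 4"
      using L1[unfolded gain_close_def, rule_format, of n 0 "k n"]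
        L2[unfolded gain_close_def, rule_format, of n "k n" "int n - k n"] elim kn n0
      by (intro add_mono divide_right_mono) auto
    also have "\<dots> = K * (1 / real n) + e / 4 + e / 4" using n0 by (simp add: field_simps)
    also have "\<dots> \<le> e" using elim(4) e by linarith
    finally show ?case using int by simp
  qed
qed

text \<open>Obtained from equal tilts on both sides of a cut in the middle, because
  \<open>tends_gain\<close> speaks of \<open>0 < t < 1\<close>.\<close>

lemma tends_gain_const:
  assumes s: "\<bar>s\<bar> \<le> 1"
  shows "tends (\<lambda>n w. gain n (\<lambda>_. s) 0 (int n) w / real n) (rate s)"
proof -
  have "(\<lambda>n. real_of_int (int n div 2) / real n - 1/2) \<longlonglongrightarrow> 0"
  proof (rule Lim_null_comparison[OF _ lim_1_over_n])
    show "\<forall>\<^sub>F n in sequentially. norm (real_of_int (int n div 2) / real n - 1/2) \<le> 1 / real n"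
      using eventually_ge_at_top[of 1]
    proof eventually_elim
      case (elim n)
      have "int n = 2 * (int n div 2) + int n mod 2" by simp
      then have "real n = 2 * real_of_int (int n div 2) + real_of_int (int n mod 2)"
        by (metis of_int_add of_int_mult of_int_numeral of_int_of_nat_eq)
      then have "real_of_int (int n div 2) / real n - 1/2 = - (real_of_int (int n mod 2) / 2) / real n"
        using elim by (simp add: field_simps)
      moreover have "real_of_int (int n mod 2) \<le> 2" by simp
      then have "real_of_int (int n mod 2) / 2 / real n \<le> 1 / real n" by (intro divide_right_mono) auto
      ultimately show ?case by simp
    qed
  qed
  then have "(\<lambda>n. real_of_int (int n div 2) / real n) \<longlonglongrightarrow> 1/2" by (simp add: LIM_zero_iff)
  from tends_gain[OF s s _ _ this] show ?thesis by (simp add: two_tilt_def[abs_def])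
qed

abbreviation "avg n w \<equiv> cyl_average VH EH n (nu n w) (om n w)"

text \<open>The tilt \<open>\<lambda>_. 1\<close> yields the total number of unpaired vertices and
  \<open>two_tilt\<close> the combinations of the two halves, so \<open>layer_var\<close> covers
  both the variance that defines the limit and the quadratic form of the covariance.\<close>

definition layer_sum :: "nat \<Rightarrow> (int \<Rightarrow> real) \<Rightarrow> (int \<times> 'a) set set \<Rightarrow> real" where
  "layer_sum n c = tilt_sum (\<lambda>v. c (fst v)) (cyl_vertices VH n)"

definition layer_var :: "nat \<Rightarrow> (int \<Rightarrow> real) \<Rightarrow> 'w \<Rightarrow> real" where
  "layer_var n c w = avg n w (\<lambda>m. (layer_sum n c m)\<^sup>2) - (avg n w (layer_sum n c))\<^sup>2"

lemma finite_graph_cyl: "finite_graph (cyl_vertices VH n) (cyl_edges VH EH n)"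
  unfolding cyl_eq_slab by (rule finite_graph_slab[OF finite_simple]) simp

lemma card_cyl: "real (card (cyl_vertices VH n)) = real n * h"
  by (simp add: cyl_eq_slab card_cartesian_product)

lemma layer_var_eq:
  "layer_var n c w = finite_graph.gibbs_variance (cyl_vertices VH n) (cyl_edges VH EH n) (nu n w) (om n w)
     (tilt_sum (\<lambda>v. c (fst v)) (cyl_vertices VH n))"
  by (simp add: layer_var_def layer_sum_def cyl_average_def finite_graph.gibbs_variance_def[OF finite_graph_cyl])

lemma layer_var_bounds:
  assumes "\<And>i. \<bar>c i\<bar> \<le> 1"
  shows "0 \<le> layer_var n c w" "layer_var n c w \<le> 4 * (real n * h)"
    "layer_var n c w = avg n w (\<lambda>m. (layer_sum n c m - avg n w (layer_sum n c))\<^sup>2)"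
  using finite_graph.gibbs_variance_bounds[OF finite_graph_cyl, where c = "\<lambda>v. c (fst v)" and nu = "nu n w" and om = "om n w"] assms
  unfolding layer_var_eq card_cyl layer_sum_def cyl_average_def by blast+

lemma measurable_avg:
  assumes n: "n \<ge> 1" and X: "\<And>m. m \<in> matchings (cyl_edges VH EH n) \<Longrightarrow> (\<lambda>w. X w m) \<in> borel_measurable (P n)"
  shows "(\<lambda>w. avg n w (X w)) \<in> borel_measurable (P n)"
proof -
  interpret R: random_cylinder VH EH n "P n" "nu n" "om n" Lnu Lom by (rule cylinder[OF n])
  have ham: "(\<lambda>w. hamiltonian (cyl_vertices VH n) (nu n w) (om n w) m) \<in> borel_measurable (P n)"
    if "m \<in> matchings (cyl_edges VH EH n)" for m
    unfolding hamiltonian_def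
    by (intro borel_measurable_add borel_measurable_sum R.measurable_nu R.measurable_om)
      (use that in \<open>auto simp: unpaired_def matchings_def cyl_eq_slab\<close>)
  show ?thesis
    unfolding cyl_average_def gibbs_average_def gibbs_weight_def partition_function_def
    by (intro borel_measurable_sum borel_measurable_times borel_measurable_divide
        measurable_compose[OF ham borel_measurable_exp] X)
qed

lemma measurable_layer_var: "n \<ge> 1 \<Longrightarrow> layer_var n c \<in> borel_measurable (P n)"
  unfolding layer_var_def[abs_def]
  by (intro borel_measurable_diff borel_measurable_power measurable_avg) auto

text \<open>Dividing by \<open>n * s^2\<close> turns the cubic error \<open>64 * n * h * s^3\<close>
  into \<open>64 * h * s\<close>, the same for all n and all weights.\<close>

lemma layer_var_approx:
  assumes c: "\<And>i. \<bar>c i\<bar> \<le> 1" and s: "0 < s" "s \<le> 1/2" and n: "n \<ge> 1"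
  shows "\<bar>layer_var n c w / real n - (gain n (\<lambda>i. s * c i) 0 (int n) w / real n
       + gain n (\<lambda>i. - s * c i) 0 (int n) w / real n) / s\<^sup>2\<bar> \<le> 64 * h * s"
proof -
  let ?g = "gain n (\<lambda>i. s * c i) 0 (int n) w + gain n (\<lambda>i. - s * c i) 0 (int n) w"
  have "\<bar>s\<bar> \<le> 1/2" using s by simp
  from finite_graph.log_partition_second_difference[OF finite_graph_cyl[of n] _ this,
      where c = "\<lambda>v. c (fst v)" and nu = "nu n w" and om = "om n w"] c
  have "\<bar>?g - layer_var n c w * s\<^sup>2\<bar> \<le> 64 * (real n * h) * \<bar>s\<bar> ^ 3"
    unfolding layer_var_eq card_cyl tilt_gain_def cyl_eq_slab[symmetric] by blast
  then have "\<bar>?g - layer_var n c w * s\<^sup>2\<bar> / (real n * s\<^sup>2) \<le> (64 * (real n * h) * \<bar>s\<bar> ^ 3) / (real n * s\<^sup>2)"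
    by (rule divide_right_mono) simp
  also have "(64 * (real n * h) * \<bar>s\<bar> ^ 3) / (real n * s\<^sup>2) = 64 * h * s"
    using s n by (simp add: power2_eq_square power3_eq_cube)
  also have "\<bar>?g - layer_var n c w * s\<^sup>2\<bar> / (real n * s\<^sup>2) = \<bar>(?g - layer_var n c w * s\<^sup>2) / (real n * s\<^sup>2)\<bar>"
    by (simp add: abs_divide abs_mult)
  also have "(?g - layer_var n c w * s\<^sup>2) / (real n * s\<^sup>2)
     = - (layer_var n c w / real n - (gain n (\<lambda>i. s * c i) 0 (int n) w / real n
       + gain n (\<lambda>i. - s * c i) 0 (int n) w / real n) / s\<^sup>2)"
    using s n by (simp add: field_simps)
  finally show ?thesis by (simp only: abs_minus_cancel)
qed

text \<open>For fixed \<open>s\<close> the second difference converges to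
  \<open>(rate s + rate (- s)) / s^2\<close>, and \<open>ex_tends_of_approx\<close> extracts the
  limit as \<open>s\<close> tends to 0. The estimate on \<open>rate\<close> is exported because it
  lets the same number be recognised in each half separately.\<close>

lemma ex_variance_limit:
  obtains \<sigma>2 where "\<sigma>2 \<ge> 0" "tends (\<lambda>n w. layer_var n (\<lambda>_. 1) w / real n) \<sigma>2"
    "\<And>v. \<bar>v\<bar> \<le> 1/2 \<Longrightarrow> \<bar>rate v + rate (- v) - \<sigma>2 * v\<^sup>2\<bar> \<le> 64 * h * \<bar>v\<bar> ^ 3"
proof -
  let ?Y = "\<lambda>s n w. (gain n (\<lambda>i. s * 1) 0 (int n) w / real n + gain n (\<lambda>i. - s * 1) 0 (int n) w / real n) / s\<^sup>2"
  let ?y = "\<lambda>s. (rate s + rate (- s)) / s\<^sup>2"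
  have meas: "(\<lambda>w. layer_var n (\<lambda>_. 1) w / real n) \<in> borel_measurable (P n)" if "n \<ge> 1" for n
    using measurable_layer_var[OF that] by (rule borel_measurable_divide) simp
  have Y: "tends (?Y s) (?y s)" if s: "0 < s" "s \<le> 1/2" for s
    using tends_cmult[OF tends_add[OF tends_gain_const[of s] tends_gain_const[of "- s"]], of "1 / s\<^sup>2"] s by simp
  have app: "\<forall>\<^sub>F n in sequentially. \<forall>w\<in>space (P n). \<bar>layer_var n (\<lambda>_. 1) w / real n - ?Y s n w\<bar> \<le> (64 * h) * s"
    if s: "0 < s" "s \<le> 1/2" for s
    using eventually_ge_at_top[of 1] by eventually_elim (use layer_var_approx[of "\<lambda>_. 1" s] s in simp)
  have "64 * h \<ge> 0" by simp
  from ex_tends_of_approx[OF meas this Y app] obtain \<sigma>2 where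
    lim: "tends (\<lambda>n w. layer_var n (\<lambda>_. 1) w / real n) \<sigma>2"
    and y: "\<And>s. 0 < s \<Longrightarrow> s \<le> 1/2 \<Longrightarrow> \<bar>?y s - \<sigma>2\<bar> \<le> 64 * h * s" by blast
  have pos: "\<bar>rate s + rate (- s) - \<sigma>2 * s\<^sup>2\<bar> \<le> 64 * h * s ^ 3" if s: "0 < s" "s \<le> 1/2" for s
  proof -
    have "\<bar>?y s - \<sigma>2\<bar> * s\<^sup>2 \<le> 64 * h * s * s\<^sup>2" by (rule mult_right_mono[OF y[OF s]]) simp
    moreover have "\<bar>?y s - \<sigma>2\<bar> * s\<^sup>2 = \<bar>(?y s - \<sigma>2) * s\<^sup>2\<bar>" by (simp add: abs_mult)
    moreover have "(?y s - \<sigma>2) * s\<^sup>2 = rate s + rate (- s) - \<sigma>2 * s\<^sup>2"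
      using s by (simp add: field_simps)
    ultimately show ?thesis by (simp add: power2_eq_square power3_eq_cube mult.assoc)
  qed
  have "\<bar>rate v + rate (- v) - \<sigma>2 * v\<^sup>2\<bar> \<le> 64 * h * \<bar>v\<bar> ^ 3" if v: "\<bar>v\<bar> \<le> 1/2" for v
  proof (cases v "0 :: real" rule: linorder_cases)
    case less
    then show ?thesis using pos[of "- v"] v by (simp add: add.commute)
  next
    case equal
    then show ?thesis by (simp add: rate_0)
  next
    case greater
    then show ?thesis using pos[of v] v by simp
  qed
  moreover have "\<sigma>2 \<ge> 0"
    by (rule tends_nonneg[OF lim]) (use layer_var_bounds(1)[of "\<lambda>_. 1"] in simp)
  ultimately show ?thesis using that lim by blast
qed

context
  fixes \<sigma>2 t :: real and k :: "nat \<Rightarrow> int"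
  assumes \<sigma>2: "\<And>v. \<bar>v\<bar> \<le> 1/2 \<Longrightarrow> \<bar>rate v + rate (- v) - \<sigma>2 * v\<^sup>2\<bar> \<le> 64 * h * \<bar>v\<bar> ^ 3"
    and t: "0 < t" "t < 1" and k: "(\<lambda>n. real_of_int (k n) / real n) \<longlonglongrightarrow> t"
begin

text \<open>Each half contributes \<open>rate x + rate (- x)\<close>, at \<open>s * u\<close> or at
  \<open>s * v\<close>, in proportion to its length. The quadratic approximation produces
  \<open>u^2\<close> and \<open>v^2\<close> but no \<open>u * v\<close>: here the covariance of the
  halves disappears.\<close>

lemma tends_layer_var:
  assumes u: "\<bar>u\<bar> \<le> 1" and v: "\<bar>v\<bar> \<le> 1"
  shows "tends (\<lambda>n w. layer_var n (two_tilt (k n) u v) w / real n) (\<sigma>2 * (t * u\<^sup>2 + (1 - t) * v\<^sup>2))"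
proof (rule tends_approx, goal_cases)
  case (1 n)
  show ?case using measurable_layer_var[OF 1] by (rule borel_measurable_divide) simp
next
  case e: (2 e)
  have c: "\<bar>two_tilt j u v i\<bar> \<le> 1" for i j using u v by (simp add: two_tilt_def)
  \<comment> \<open>Makes the error \<open>64 * h * s\<close> at most \<open>e\<close>; the summand
    1 covers \<open>h = 0\<close>.\<close>
  define s where "s = min (1/2) (e / (64 * h + 1))"
  have s0: "0 < s" using e by (simp add: s_def add_nonneg_pos)
  have s2: "s \<le> 1/2" unfolding s_def by (rule min.cobounded1)
  have "64 * h * s \<le> 64 * h * (e / (64 * h + 1))" by (intro mult_left_mono) (auto simp: s_def)
  also have "\<dots> \<le> e" using e by (simp add: divide_le_eq add_nonneg_pos algebra_simps)
  finally have se: "64 * h * s \<le> e" .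
  let ?A = "\<lambda>r n w. gain n (two_tilt (k n) (r * u) (r * v)) 0 (int n) w / real n"
  let ?Y = "\<lambda>n w. (?A s n w + ?A (- s) n w) / s\<^sup>2"
  let ?G = "\<lambda>x. rate x + rate (- x)"
  let ?y = "(t * ?G (s * u) + (1 - t) * ?G (s * v)) / s\<^sup>2"
  have su: "\<bar>s * u\<bar> \<le> 1/2" "\<bar>s * v\<bar> \<le> 1/2"
    using mult_mono[OF s2 u] mult_mono[OF s2 v] s0 by (auto simp: abs_mult)
  show ?case
  proof (intro exI[of _ ?Y] exI[of _ ?y] conjI)
    have "tends (?A s) (t * rate (s * u) + (1 - t) * rate (s * v))"
      "tends (?A (- s)) (t * rate (- s * u) + (1 - t) * rate (- s * v))"
      by (rule tends_gain[OF _ _ t k], use su in simp, use su in simp)+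
    from tends_add[OF this]
    have "tends (\<lambda>n w. ?A s n w + ?A (- s) n w) (t * ?G (s * u) + (1 - t) * ?G (s * v))"
      by (simp add: algebra_simps)
    from tends_cmult[OF this, of "1 / s\<^sup>2"] show "tends ?Y ?y" by simp
    have tilt: "(\<lambda>i. r * two_tilt j u v i) = two_tilt j (r * u) (r * v)" for r j
      by (auto simp: two_tilt_def)
    show "\<forall>\<^sub>F n in sequentially. \<forall>w\<in>space (P n). \<bar>layer_var n (two_tilt (k n) u v) w / real n - ?Y n w\<bar> \<le> e"
      using eventually_ge_at_top[of 1]
    proof eventually_elim
      case (elim n)
      show ?case
        using layer_var_approx[where c = "two_tilt (k n) u v", OF c s0 s2 elim] se
        unfolding tilt by (meson order_trans)
    qed
    have *: "\<bar>?G (s * x) - \<sigma>2 * (s * x)\<^sup>2\<bar> \<le> 64 * h * s ^ 3" if "\<bar>x\<bar> \<le> 1" "\<bar>s * x\<bar> \<le> 1/2" for x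
    proof -
      have "\<bar>s * x\<bar> ^ 3 \<le> s ^ 3"
        using mult_left_mono[OF that(1), of s] s0 by (intro power_mono) (auto simp: abs_mult)
      then have "64 * h * \<bar>s * x\<bar> ^ 3 \<le> 64 * h * s ^ 3" by (intro mult_left_mono) auto
      then show ?thesis using \<sigma>2[OF that(2)] by linarith
    qed
    have "?y - \<sigma>2 * (t * u\<^sup>2 + (1 - t) * v\<^sup>2)
      = (t * (?G (s * u) - \<sigma>2 * (s * u)\<^sup>2) + (1 - t) * (?G (s * v) - \<sigma>2 * (s * v)\<^sup>2)) / s\<^sup>2"
      using s0 by (simp add: field_simps power_mult_distrib)
    also have "\<bar>\<dots>\<bar> \<le> (t * (64 * h * s ^ 3) + (1 - t) * (64 * h * s ^ 3)) / s\<^sup>2"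
    proof -
      have "\<bar>t * (?G (s * u) - \<sigma>2 * (s * u)\<^sup>2) + (1 - t) * (?G (s * v) - \<sigma>2 * (s * v)\<^sup>2)\<bar>
        \<le> t * \<bar>?G (s * u) - \<sigma>2 * (s * u)\<^sup>2\<bar> + (1 - t) * \<bar>?G (s * v) - \<sigma>2 * (s * v)\<^sup>2\<bar>"
        using t by (intro order_trans[OF abs_triangle_ineq]) (simp add: abs_mult)
      also have "\<dots> \<le> t * (64 * h * s ^ 3) + (1 - t) * (64 * h * s ^ 3)"
        using *[OF u su(1)] *[OF v su(2)] t by (intro add_mono mult_left_mono) auto
      finally show ?thesis by (simp add: abs_divide divide_right_mono)
    qed
    also have "(t * (64 * h * s ^ 3) + (1 - t) * (64 * h * s ^ 3)) / s\<^sup>2 = 64 * h * s"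
      using s0 by (simp add: field_simps power2_eq_square power3_eq_cube)
    finally show "\<bar>?y - \<sigma>2 * (t * u\<^sup>2 + (1 - t) * v\<^sup>2)\<bar> \<le> e" using se by linarith
  qed
qed

text \<open>Tilts stay bounded by 1 while the frequency \<open>T\<close> is free, which reaches
  every linear functional. At \<open>T / sqrt n\<close> the variance enters as
  \<open>layer_var / n\<close>, whose limit is known, and the error of order
  \<open>n * |T / sqrt n|^3\<close> vanishes.\<close>

lemma tends_char:
  assumes u: "\<bar>u\<bar> \<le> 1" and v: "\<bar>v\<bar> \<le> 1"
  defines "c \<equiv> \<lambda>n. two_tilt (k n) u v"
  shows "tends (\<lambda>n w. avg n w (\<lambda>m. cos (T / sqrt (real n) * (layer_sum n (c n) m - avg n w (layer_sum n (c n))))))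
            (exp (- (\<sigma>2 * (t * u\<^sup>2 + (1 - t) * v\<^sup>2) * T\<^sup>2 / 2)))" (is "tends ?C ?L")
    and "tends (\<lambda>n w. avg n w (\<lambda>m. sin (T / sqrt (real n) * (layer_sum n (c n) m - avg n w (layer_sum n (c n)))))) 0"
       (is "tends ?S _")
proof -
  have c: "\<bar>c n i\<bar> \<le> 1" for i n using u v by (simp add: c_def two_tilt_def)
  define \<tau> where "\<tau> n = T / sqrt (real n)" for n
  have tau0: "(\<lambda>n. \<bar>\<tau> n\<bar>) \<longlonglongrightarrow> 0"
  proof -
    have "(\<lambda>n. \<bar>T * sqrt (1 / real n)\<bar>) \<longlonglongrightarrow> \<bar>T * sqrt 0\<bar>"
      by (intro tendsto_rabs tendsto_mult tendsto_const tendsto_real_sqrt lim_1_over_n)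
    then show ?thesis by (simp add: \<tau>_def[abs_def] real_sqrt_divide)
  qed
  have cube: "real n * \<bar>\<tau> n\<bar> ^ 3 = T\<^sup>2 * \<bar>\<tau> n\<bar>" if "n \<ge> 1" for n
  proof -
    have "real n * (\<tau> n)\<^sup>2 = T\<^sup>2" using that by (simp add: \<tau>_def power_divide)
    then show ?thesis by (simp add: power3_eq_cube power2_eq_square flip: mult.assoc)
  qed
  have ev: "\<forall>\<^sub>F n in sequentially. a * \<bar>\<tau> n\<bar> < b" if "b > 0" for a b
    by (rule order_tendstoD(2)[OF tendsto_mult_right_zero[OF tau0] that])
  have approx: "\<forall>\<^sub>F n in sequentially. \<forall>w\<in>space (P n).
     \<bar>?C n w - exp (- (layer_var n (c n) w / real n) * T\<^sup>2 / 2)\<bar> \<le> e \<and> \<bar>?S n w\<bar> \<le> e" if e: "e > 0" for e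
  proof -
    have "\<forall>\<^sub>F n in sequentially. 1 * \<bar>\<tau> n\<bar> < 1/2" "\<forall>\<^sub>F n in sequentially. 32 * h * T\<^sup>2 * \<bar>\<tau> n\<bar> < 1"
      "\<forall>\<^sub>F n in sequentially. 96 * h * T\<^sup>2 * \<bar>\<tau> n\<bar> < e"
      by (rule ev, use e in simp)+
    then show ?thesis
      using eventually_ge_at_top[of 1]
    proof eventually_elim
      case (elim n)
      have 1: "\<bar>\<tau> n\<bar> \<le> 1/2" using elim by simp
      have 2: "32 * real (card (cyl_vertices VH n)) * \<bar>\<tau> n\<bar> ^ 3 = 32 * h * T\<^sup>2 * \<bar>\<tau> n\<bar>"
        "96 * real (card (cyl_vertices VH n)) * \<bar>\<tau> n\<bar> ^ 3 = 96 * h * T\<^sup>2 * \<bar>\<tau> n\<bar>"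
        using cube[of n] elim by (simp_all add: card_cyl mult_ac)
      have 3: "32 * real (card (cyl_vertices VH n)) * \<bar>\<tau> n\<bar> ^ 3 \<le> 1" unfolding 2 using elim by simp
      have 4: "layer_var n (c n) w * (\<tau> n)\<^sup>2 = layer_var n (c n) w / real n * T\<^sup>2" for w
        using elim by (simp add: \<tau>_def power_divide)
      show ?case
      proof
        fix w
        have cc: "\<bar>c n (fst v)\<bar> \<le> 1" for v :: "int \<times> 'a" by (rule c)
        have "\<bar>?C n w - exp (- layer_var n (c n) w * (\<tau> n)\<^sup>2 / 2)\<bar> \<le> 96 * real (card (cyl_vertices VH n)) * \<bar>\<tau> n\<bar> ^ 3"
          using finite_graph.gibbs_char_approx(1)[where c = "\<lambda>v. c n (fst v)" and nu = "nu n w" and om = "om n w", OF finite_graph_cyl cc 1 3]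
          unfolding layer_var_eq layer_sum_def cyl_average_def \<tau>_def .
        moreover have "- layer_var n (c n) w * (\<tau> n)\<^sup>2 / 2 = - (layer_var n (c n) w / real n) * T\<^sup>2 / 2"
          using 4[of w] by simp
        moreover have "\<bar>?S n w\<bar> \<le> 96 * real (card (cyl_vertices VH n)) * \<bar>\<tau> n\<bar> ^ 3"
          using finite_graph.gibbs_char_approx(2)[where c = "\<lambda>v. c n (fst v)" and nu = "nu n w" and om = "om n w", OF finite_graph_cyl cc 1 3]
          unfolding layer_sum_def cyl_average_def \<tau>_def .
        ultimately show "\<bar>?C n w - exp (- (layer_var n (c n) w / real n) * T\<^sup>2 / 2)\<bar> \<le> e \<and> \<bar>?S n w\<bar> \<le> e"
          unfolding 2 using elim by simp
      qed
    qed
  qed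
  have avg_meas: "(\<lambda>w. avg n w (layer_sum n (c n))) \<in> borel_measurable (P n)" if "n \<ge> 1" for n
    by (rule measurable_avg[OF that]) simp
  show "tends ?S 0"
  proof (rule tends_approx, goal_cases)
    case (1 n)
    show ?case using avg_meas[OF 1]
      by (intro measurable_avg[OF 1] measurable_compose[OF _ borel_measurable_continuous_onI[OF continuous_on_sin[OF continuous_on_id]]]
         borel_measurable_times borel_measurable_diff borel_measurable_const)
  next
    case e: (2 e)
    show ?case
      by (rule exI[of _ "\<lambda>n w. 0"], rule exI[of _ 0], intro conjI tends_const)
        (use e in simp, use approx[OF e] in eventually_elim, simp)
  qed
  show "tends ?C ?L"
  proof (rule tends_approx, goal_cases)
    case (1 n)
    show ?case using avg_meas[OF 1]
      by (intro measurable_avg[OF 1] measurable_compose[OF _ borel_measurable_continuous_onI[OF continuous_on_cos[OF continuous_on_id]]]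
         borel_measurable_times borel_measurable_diff borel_measurable_const)
  next
    case e: (2 e)
    let ?Y = "\<lambda>n w. exp (- (layer_var n (c n) w / real n) * T\<^sup>2 / 2)"
    have "tends ?Y (exp (- (\<sigma>2 * (t * u\<^sup>2 + (1 - t) * v\<^sup>2)) * T\<^sup>2 / 2))"
      unfolding c_def
      by (rule tends_continuous[OF tends_layer_var[OF u v], where f = "\<lambda>x. exp (- x * T\<^sup>2 / 2)"])
        (intro continuous_intros; simp)
    then show ?case
      by (intro exI[of _ ?Y] exI[of _ ?L] conjI)
        (simp, use e in simp, use approx[OF e] in eventually_elim, simp)
  qed
qed

end

end

section \<open>Gaussian laws and weak convergence in the plane\<close>

lemma prob_space_std_normal: "prob_space std_normal_distribution"
  by (rule prob_space_normal_density) simp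

text \<open>As an image of the standard normal law, the point mass at \<open>s2 = 0\<close> is
  included, so the facts below need no case distinction.\<close>

lemma normal_law_eq_distr:
  assumes "s2 \<ge> 0"
  shows "normal_law 0 s2 = distr std_normal_distribution borel (\<lambda>x. sqrt s2 * x)"
proof (cases "s2 = 0")
  case True
  interpret prob_space std_normal_distribution by (rule prob_space_std_normal)
  show ?thesis using True by (simp add: normal_law_def)
next
  case False
  interpret prob_space std_normal_distribution by (rule prob_space_std_normal)
  have "distributed std_normal_distribution lborel (\<lambda>x. x) std_normal_density"
    by (simp add: distributed_def distr_id2)
  from normal_density_affine[OF this, of "sqrt s2" 0] assms False
  have "distributed std_normal_distribution lborel (\<lambda>x. sqrt s2 * x) (normal_density 0 (sqrt s2))" by simp
  then have "density lborel (normal_density 0 (sqrt s2)) = distr std_normal_distribution lborel (\<lambda>x. sqrt s2 * x)"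
    by (simp add: distributed_distr_eq_density)
  also have "\<dots> = distr std_normal_distribution borel (\<lambda>x. sqrt s2 * x)"
    by (rule distr_cong) auto
  finally show ?thesis using False by (simp add: normal_law_def)
qed

lemma real_distribution_normal_law: "s2 \<ge> 0 \<Longrightarrow> real_distribution (normal_law 0 s2)"
  unfolding normal_law_eq_distr
  by (rule prob_space.real_distribution_distr[OF prob_space_std_normal]) simp

lemma char_distr_cmult:
  assumes "X \<in> borel_measurable M"
  shows "char (distr M borel (\<lambda>x. r * X x)) t = char (distr M borel X) (r * t)"
  using assms by (simp add: char_def integral_distr mult_ac)

lemma char_normal_law:
  assumes "s2 \<ge> 0"
  shows "char (normal_law 0 s2) t = of_real (exp (- s2 * t\<^sup>2 / 2))"
proof -
  have "distr std_normal_distribution borel (\<lambda>x. x) = std_normal_distribution"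
    by (rule distr_id2) simp
  then have "char (normal_law 0 s2) t = char std_normal_distribution (sqrt s2 * t)"
    using char_distr_cmult[of "\<lambda>x. x" std_normal_distribution "sqrt s2" t] normal_law_eq_distr[OF assms] by simp
  then show ?thesis using assms by (simp add: char_std_normal_distribution power_mult_distrib)
qed

lemma integrable_square_normal_law:
  assumes "s2 \<ge> 0"
  shows "integrable (normal_law 0 s2) (\<lambda>x. x\<^sup>2)"
proof -
  have "integrable std_normal_distribution (\<lambda>x. x\<^sup>2)"
    using integrable_std_normal_moment[of 2] by (subst integrable_density) auto
  then have "integrable std_normal_distribution (\<lambda>x. (sqrt s2 * x)\<^sup>2)"
    by (simp add: power_mult_distrib)
  then show ?thesis unfolding normal_law_eq_distr[OF assms] by (subst integrable_distr_eq) auto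
qed

lemma inner_diag_matrix: "u \<bullet> (diag_matrix d *v u) = (\<Sum>i\<in>UNIV. d $ i * (u $ i)\<^sup>2)"
proof -
  have "(diag_matrix d *v u) $ i = d $ i * u $ i" for i
    by (simp add: diag_matrix_def matrix_vector_mult_def if_distrib[of "\<lambda>x. x * _"] cong: if_cong)
  then show ?thesis by (simp add: inner_vec_def power2_eq_square mult_ac)
qed

lemma borel_measurable_vec_lambda:
  fixes f :: "'i::finite \<Rightarrow> 'w \<Rightarrow> real"
  assumes "\<And>i. f i \<in> borel_measurable M"
  shows "(\<lambda>w. \<chi> i. f i w) \<in> borel_measurable M"
proof (subst borel_measurable_euclidean_space, rule ballI)
  fix b :: "real^'i" assume "b \<in> Basis"
  then obtain i where "b = axis i 1" by (auto simp: Basis_vec_def)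
  then show "(\<lambda>w. (\<chi> i. f i w) \<bullet> b) \<in> borel_measurable M" using assms by (simp add: inner_axis)
qed

text \<open>Independent standard normal coordinates scaled by \<open>sqrt (d $ i)\<close>. Linear
  functionals are identified by their characteristic functions, which permits vanishing
  \<open>d $ i\<close>.\<close>

lemma ex_centered_gaussian_diag:
  fixes d :: "real^'n"
  assumes d: "\<And>i. d $ i \<ge> 0"
  shows "\<exists>N. centered_gaussian_law N (diag_matrix d)"
proof -
  let ?S = "std_normal_distribution"
  define Q where "Q = PiM (UNIV :: 'n set) (\<lambda>_. ?S)"
  define g where "g f = (\<chi> i. sqrt (d $ i) * f i)" for f :: "'n \<Rightarrow> real"
  interpret S: prob_space ?S by (rule prob_space_std_normal)
  interpret Q: prob_space Q unfolding Q_def by (rule prob_space_PiM) (rule prob_space_std_normal)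
  have sets_Q: "sets Q = sets (PiM (UNIV :: 'n set) (\<lambda>_. borel))"
    unfolding Q_def by (rule sets_PiM_cong) auto
  have comp: "(\<lambda>f. f i) \<in> borel_measurable Q" for i
    unfolding measurable_cong_sets[OF sets_Q refl] by (rule measurable_component_singleton) simp
  have comp_distr: "distr Q borel (\<lambda>f. f i) = ?S" for i
  proof -
    have "distr Q borel (\<lambda>f. f i) = distr Q ?S (\<lambda>f. f i)" by (rule distr_cong) auto
    also have "\<dots> = ?S"
      unfolding Q_def by (rule distr_PiM_component) (simp_all add: prob_space_std_normal)
    finally show ?thesis .
  qed
  have indep: "Q.indep_vars (\<lambda>_. borel) (\<lambda>i f. f i) UNIV"
  proof (subst Q.indep_vars_iff_distr_eq_PiM')
    have "distr Q (PiM (UNIV :: 'n set) (\<lambda>_. borel)) (\<lambda>x. x) = Q" by (rule distr_id2) (simp add: sets_Q)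
    then show "distr Q (PiM (UNIV :: 'n set) (\<lambda>_. borel)) (\<lambda>x. \<lambda>i\<in>UNIV. x i) = PiM UNIV (\<lambda>i. distr Q borel (\<lambda>f. f i))"
      by (simp add: comp_distr restrict_UNIV) (simp add: Q_def)
  qed (use comp in auto)
  have g: "g \<in> borel_measurable Q"
    unfolding g_def[abs_def] by (intro borel_measurable_vec_lambda borel_measurable_times borel_measurable_const comp)
  let ?N = "distr Q borel g"
  have "distr ?N borel (\<lambda>x. u \<bullet> x) = normal_law 0 (u \<bullet> (diag_matrix d *v u))" for u
  proof (rule Levy_uniqueness)
    let ?s = "u \<bullet> (diag_matrix d *v u)"
    have s: "?s \<ge> 0" unfolding inner_diag_matrix by (intro sum_nonneg mult_nonneg_nonneg d) auto
    have eq: "distr ?N borel (\<lambda>x. u \<bullet> x) = distr Q borel (\<lambda>f. \<Sum>i\<in>UNIV. (u $ i * sqrt (d $ i)) * f i)"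
      using g by (subst distr_distr) (auto simp: comp_def g_def inner_vec_def mult.assoc)
    have m: "(\<lambda>f. \<Sum>i\<in>UNIV. (u $ i * sqrt (d $ i)) * f i) \<in> borel_measurable Q"
      by (intro borel_measurable_sum borel_measurable_times borel_measurable_const comp)
    show "real_distribution (distr ?N borel (\<lambda>x. u \<bullet> x))"
      unfolding eq by (rule Q.real_distribution_distr[OF m])
    show "real_distribution (normal_law 0 ?s)" by (rule real_distribution_normal_law[OF s])
    show "char (distr ?N borel (\<lambda>x. u \<bullet> x)) = char (normal_law 0 ?s)"
    proof
      fix t
      have ind: "Q.indep_vars (\<lambda>_. borel) (\<lambda>i f. (u $ i * sqrt (d $ i)) * f i) UNIV"
        by (rule Q.indep_vars_compose2[OF indep]) simp
      have "char (distr ?N borel (\<lambda>x. u \<bullet> x)) t = (\<Prod>i\<in>UNIV. char (distr Q borel (\<lambda>f. (u $ i * sqrt (d $ i)) * f i)) t)"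
        unfolding eq by (rule Q.char_distr_sum[OF ind])
      also have "\<dots> = (\<Prod>i\<in>UNIV. of_real (exp (- (d $ i * (u $ i)\<^sup>2 * t\<^sup>2) / 2)))"
      proof (intro prod.cong refl)
        fix i
        show "char (distr Q borel (\<lambda>f. (u $ i * sqrt (d $ i)) * f i)) t = of_real (exp (- (d $ i * (u $ i)\<^sup>2 * t\<^sup>2) / 2))"
          unfolding char_distr_cmult[OF comp] comp_distr char_std_normal_distribution
          using d[of i] by (simp add: power_mult_distrib mult_ac)
      qed
      also have "\<dots> = of_real (exp (- ?s * t\<^sup>2 / 2))"
        by (simp add: inner_diag_matrix sum_distrib_right sum_negf sum_divide_distrib flip: of_real_prod exp_sum)
      finally show "char (distr ?N borel (\<lambda>x. u \<bullet> x)) t = char (normal_law 0 ?s) t"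
        by (simp add: char_normal_law[OF s])
    qed
  qed
  moreover have "prob_space ?N" by (rule Q.prob_space_distr[OF g])
  moreover have "transpose (diag_matrix d) = diag_matrix d"
    by (simp add: transpose_def diag_matrix_def vec_eq_iff)
  ultimately show ?thesis unfolding centered_gaussian_law_def by (intro exI[of _ ?N]) auto
qed

text \<open>All three follow from the one-dimensional law of \<open>u \<bullet> y\<close>: its
  characteristic function at 1 gives cosine and sine, and its second moment serves the tail
  estimate.\<close>

lemma centered_gaussian_law_integrals:
  assumes N: "centered_gaussian_law N S" and u: "u \<bullet> (S *v u) \<ge> 0"
  shows "(\<integral>y. cos (u \<bullet> y) \<partial>N) = exp (- (u \<bullet> (S *v u)) / 2)" "(\<integral>y. sin (u \<bullet> y) \<partial>N) = 0"
    and "integrable N (\<lambda>y. (u \<bullet> y)\<^sup>2)"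
proof -
  let ?s = "u \<bullet> (S *v u)"
  interpret prob_space N using N by (simp add: centered_gaussian_law_def)
  have d: "distr N borel (\<lambda>x. u \<bullet> x) = normal_law 0 ?s" and sets: "sets N = sets borel"
    using N by (auto simp: centered_gaussian_law_def)
  have m: "(\<lambda>x. u \<bullet> x) \<in> borel_measurable N"
    unfolding measurable_cong_sets[OF sets refl] by simp
  have m2: "(\<lambda>y. cos (u \<bullet> y)) \<in> borel_measurable N" "(\<lambda>y. sin (u \<bullet> y)) \<in> borel_measurable N"
    using m by measurable
  have int: "integrable N (\<lambda>y. cos (u \<bullet> y))" "integrable N (\<lambda>y. sin (u \<bullet> y))"
    using m2 by (auto intro!: integrable_const_bound[of _ 1])
  have "char (distr N borel (\<lambda>x. u \<bullet> x)) 1 = (CLINT y|N. iexp (u \<bullet> y))"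
    using m by (simp add: char_def integral_distr)
  then have c: "(CLINT y|N. iexp (u \<bullet> y)) = of_real (exp (- ?s / 2))"
    using char_normal_law[OF u, of 1] by (simp add: d)
  have i: "integrable N (\<lambda>y. iexp (u \<bullet> y))"
    by (rule integrable_const_bound[of _ 1]) (use m in auto)
  have "Re (CLINT y|N. iexp (u \<bullet> y)) = (\<integral>y. cos (u \<bullet> y) \<partial>N)"
    using integral_Re[OF i] by (simp add: Re_exp)
  then show "(\<integral>y. cos (u \<bullet> y) \<partial>N) = exp (- ?s / 2)" by (simp add: c)
  have "Im (CLINT y|N. iexp (u \<bullet> y)) = (\<integral>y. sin (u \<bullet> y) \<partial>N)"
    using integral_Im[OF i] by (simp add: Im_exp)
  then show "(\<integral>y. sin (u \<bullet> y) \<partial>N) = 0" by (simp add: c)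
  have "integrable (distr N borel (\<lambda>x. u \<bullet> x)) (\<lambda>x. x\<^sup>2)"
    unfolding d by (rule integrable_square_normal_law[OF u])
  then show "integrable N (\<lambda>y. (u \<bullet> y)\<^sup>2)" using m by (subst (asm) integrable_distr_eq) auto
qed

section \<open>Trigonometric sums as test functions\<close>

inductive trig_sum :: "(real^'n \<Rightarrow> real) \<Rightarrow> bool" where
  cos: "trig_sum (\<lambda>x. cos (\<theta> \<bullet> x))"
| sin: "trig_sum (\<lambda>x. sin (\<theta> \<bullet> x))"
| add: "trig_sum f \<Longrightarrow> trig_sum g \<Longrightarrow> trig_sum (\<lambda>x. f x + g x)"
| cmult: "trig_sum f \<Longrightarrow> trig_sum (\<lambda>x. r * f x)"

lemma trig_sum_const: "trig_sum (\<lambda>_. r)"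
  using trig_sum.cmult[OF trig_sum.cos[of 0], of r] by simp

lemma trig_sum_sum: "(\<And>i. i \<in> I \<Longrightarrow> trig_sum (f i)) \<Longrightarrow> trig_sum (\<lambda>x. \<Sum>i\<in>I. f i x)"
  by (induction I rule: infinite_finite_induct) (auto intro: trig_sum.add trig_sum_const)

text \<open>Product-to-sum formulas for two waves, extended by induction in each factor. With
  products available, polynomials in sines are trigonometric sums.\<close>

lemma trig_sum_mult:
  fixes f g :: "real^'n \<Rightarrow> real"
  assumes "trig_sum f" "trig_sum g"
  shows "trig_sum (\<lambda>x. f x * g x)"
proof -
  have cc: "cos a * cos b = 1/2 * cos (a - b) + 1/2 * cos (a + b)" and ss: "sin a * sin b = 1/2 * cos (a - b) + (-1/2) * cos (a + b)"
    and sc: "sin a * cos b = 1/2 * sin (a + b) + 1/2 * sin (a - b)" and cs: "cos a * sin b = 1/2 * sin (a + b) + (-1/2) * sin (a - b)"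
    for a b :: real by (simp_all add: cos_add cos_diff sin_add sin_diff field_simps)
  have base: "trig_sum (\<lambda>x. cos (\<theta> \<bullet> x) * g x) \<and> trig_sum (\<lambda>x. sin (\<theta> \<bullet> x) * g x)" for \<theta>
    using assms(2)
  proof induction
    case (cos \<eta>)
    show ?case unfolding cc sc inner_add_left[symmetric] inner_diff_left[symmetric]
      by (intro conjI trig_sum.intros)
  next
    case (sin \<eta>)
    show ?case unfolding cs ss inner_add_left[symmetric] inner_diff_left[symmetric]
      by (intro conjI trig_sum.intros)
  next
    case (add f g)
    then show ?case by (auto simp: distrib_left intro: trig_sum.add)
  next
    case (cmult f r)
    then show ?case using trig_sum.cmult by (auto simp: mult.left_commute)
  qed
  show ?thesis
    using assms(1)
  proof induction
    case (add f1 f2)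
    then show ?case by (auto simp: distrib_right intro: trig_sum.add)
  next
    case (cmult f r)
    then show ?case using trig_sum.cmult by (auto simp: mult.assoc)
  qed (use base in auto)
qed

lemma trig_sum_continuous_bounded:
  assumes "trig_sum f"
  shows "continuous_on UNIV f \<and> (\<exists>B. \<forall>x. \<bar>f x\<bar> \<le> B)"
  using assms
proof induction
  case (cos \<theta>)
  show ?case by (auto intro!: continuous_intros exI[of _ 1])
next
  case (sin \<theta>)
  show ?case by (auto intro!: continuous_intros exI[of _ 1])
next
  case (add f g)
  then obtain A B where AB: "\<And>x. \<bar>f x\<bar> \<le> A" "\<And>x. \<bar>g x\<bar> \<le> B" by auto
  have "\<bar>f x + g x\<bar> \<le> A + B" for x using AB(1)[of x] AB(2)[of x] by linarith
  then show ?case using add by (auto intro!: continuous_intros)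
next
  case (cmult f r)
  then obtain A where "\<And>x. \<bar>f x\<bar> \<le> A" by auto
  then have "\<bar>r * f x\<bar> \<le> \<bar>r\<bar> * A" for x by (simp add: abs_mult mult_left_mono)
  then show ?case using cmult by (auto intro!: continuous_intros)
qed

lemma trig_sum_polynomial:
  fixes p :: "real^'n \<Rightarrow> real"
  assumes "real_polynomial_function p"
  shows "trig_sum (\<lambda>x. p (\<chi> i. sin (b * x $ i)))"
  using assms
proof induction
  case (linear f)
  interpret f: bounded_linear f by fact
  have "f (\<chi> i. sin (b * x $ i)) = (\<Sum>i\<in>UNIV. f (axis i 1) * sin ((b *\<^sub>R axis i 1) \<bullet> x))" for x :: "real^'n"
  proof -
    have "(\<chi> i. sin (b * x $ i)) = (\<Sum>i\<in>UNIV. sin (b * x $ i) *\<^sub>R axis i 1)"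
      by (simp add: vec_eq_iff axis_def if_distrib cong: if_cong)
    then show ?thesis by (simp add: f.sum f.scaleR inner_axis' mult.commute)
  qed
  then show ?case by (simp only:) (intro trig_sum_sum trig_sum.intros)
qed (auto intro: trig_sum_const trig_sum.add trig_sum_mult)

text \<open>The map \<open>x \<mapsto> (2R/\<pi>) arcsin (sin (\<pi>x/(2R)))\<close> is continuous, periodic, and the identity on
  \<open>[-R, R]\<close>; composing with it makes \<open>\<phi>\<close> periodic, hence a uniform limit of trigonometric sums on
  the whole space and not only on a box.\<close>

lemma trig_sum_approx:
  fixes \<phi> :: "real^'n \<Rightarrow> real"
  assumes cont: "continuous_on UNIV \<phi>" and B: "\<And>x. \<bar>\<phi> x\<bar> \<le> B" and R: "R > 0" and e: "e > 0"
  shows "\<exists>p. trig_sum p \<and> (\<forall>x. \<bar>p x\<bar> \<le> B + e) \<and> (\<forall>x. norm x \<le> R \<longrightarrow> \<bar>\<phi> x - p x\<bar> \<le> e)"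
proof -
  let ?S = "cbox (\<chi> i. -1) (\<chi> i. 1) :: (real^'n) set"
  \<comment> \<open>\<open>\<phi>\<close> in the coordinates
    \<open>s = sin (pi * x / (2 * R))\<close>, which range over a compact cube. Stone-Weierstrass
    applies there, and the bound on the approximant is global because sines never leave the
    cube.\<close>
  define G where "G s = \<phi> (\<chi> i. 2 * R / pi * arcsin (s $ i))" for s :: "real^'n"
  have mem: "s \<in> ?S \<longleftrightarrow> (\<forall>i. -1 \<le> s $ i \<and> s $ i \<le> 1)" for s :: "real^'n"
    by (simp add: mem_box_cart)
  have "continuous_on ?S (\<lambda>s. \<chi> i. 2 * R / pi * arcsin (s $ i))"
    by (intro continuous_on_vec_lambda continuous_intros) (auto simp: mem)
  then have "continuous_on ?S G"
    unfolding G_def by (rule continuous_on_compose2[OF cont]) auto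
  then obtain p where p: "real_polynomial_function p" "\<And>s. s \<in> ?S \<Longrightarrow> \<bar>G s - p s\<bar> < e"
    using Stone_Weierstrass_real_polynomial_function[OF compact_cbox _ e] by metis
  define q where "q x = p (\<chi> i. sin (pi / (2 * R) * x $ i))" for x :: "real^'n"
  have close: "\<bar>G (\<chi> i. sin (pi / (2 * R) * x $ i)) - q x\<bar> < e" for x
    unfolding q_def by (rule p(2)) (simp add: mem)
  show ?thesis
  proof (intro exI[of _ q] conjI allI impI)
    show "trig_sum q" unfolding q_def by (rule trig_sum_polynomial[OF p(1)])
    show "\<bar>q x\<bar> \<le> B + e" for x
      using close[of x] B[of "\<chi> i. 2 * R / pi * arcsin ((\<chi> i. sin (pi / (2 * R) * x $ i)) $ i)"]
      unfolding G_def by linarith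
    fix x :: "real^'n" assume x: "norm x \<le> R"
    have "2 * R / pi * arcsin (sin (pi / (2 * R) * x $ i)) = x $ i" for i
    proof -
      have "\<bar>x $ i\<bar> \<le> R" using component_le_norm_cart[of x i] x by linarith
      then have "\<bar>pi / (2 * R) * x $ i\<bar> \<le> pi / 2"
        using R by (simp add: abs_mult field_simps)
      then have "- (pi / 2) \<le> pi / (2 * R) * x $ i" "pi / (2 * R) * x $ i \<le> pi / 2" by linarith+
      then have "arcsin (sin (pi / (2 * R) * x $ i)) = pi / (2 * R) * x $ i" by (rule arcsin_sin)
      then show ?thesis using R by simp
    qed
    then have "(\<chi> i. 2 * R / pi * arcsin (sin (pi / (2 * R) * x $ i))) = x"
      by (simp add: vec_eq_iff)
    then show "\<bar>\<phi> x - q x\<bar> \<le> e" using close[of x] by (simp add: G_def)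
  qed
qed

lemma norm_power2_vec2: "(norm x)\<^sup>2 = (x $ 1)\<^sup>2 + (x $ 2)\<^sup>2" for x :: "real^2"
  unfolding power2_norm_eq_inner inner_vec_def sum_2 by (simp add: power2_eq_square)

section \<open>Convergence of the fluctuation vector\<close>

context cylinder_family
begin

definition fluct :: "(nat \<Rightarrow> int) \<Rightarrow> nat \<Rightarrow> 'w \<Rightarrow> (int \<times> 'a) set set \<Rightarrow> real^2" where
  "fluct k n w m = (1 / sqrt (real n)) *\<^sub>R vector
     [num_unpaired_in VH n {1..k n} m - avg n w (num_unpaired_in VH n {1..k n}),
      num_unpaired_in VH n {k n + 1..int n} m - avg n w (num_unpaired_in VH n {k n + 1..int n})]"

context
  fixes \<sigma>2 t :: real and k :: "nat \<Rightarrow> int" and N :: "(real^2) measure"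
  assumes \<sigma>2: "\<And>v. \<bar>v\<bar> \<le> 1/2 \<Longrightarrow> \<bar>rate v + rate (- v) - \<sigma>2 * v\<^sup>2\<bar> \<le> 64 * h * \<bar>v\<bar> ^ 3"
    and \<sigma>2_nonneg: "\<sigma>2 \<ge> 0"
    and t: "0 < t" "t < 1" and k: "(\<lambda>n. real_of_int (k n) / real n) \<longlonglongrightarrow> t"
    and N: "centered_gaussian_law N (\<sigma>2 *\<^sub>R diag_matrix (vector [t, 1 - t]))"
begin

abbreviation "converges f \<equiv> tends (\<lambda>n w. avg n w (\<lambda>m. f (fluct k n w m))) (\<integral>y. f y \<partial>N)"

text \<open>Valid for every integer \<open>k n\<close>, also outside the range from 0 to n: the
  layer of a vertex lies between 1 and n and hence in exactly one of the two intervals.\<close>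

lemma layer_sum_two_tilt:
  "layer_sum n (two_tilt (k n) u v) m
     = u * num_unpaired_in VH n {1..k n} m + v * num_unpaired_in VH n {k n + 1..int n} m"
proof -
  let ?W = "unpaired (cyl_vertices VH n) m"
  have fin: "finite ?W" by (rule finite_graph.finite_unpaired[OF finite_graph_cyl])
  have ind: "(\<Sum>x\<in>?W. if fst x \<in> I then r else 0) = r * real (card {x \<in> ?W. fst x \<in> I})" for I and r :: real
  proof -
    have "(\<Sum>x\<in>?W. if fst x \<in> I then r else 0) = (\<Sum>x\<in>{x \<in> ?W. fst x \<in> I}. r)"
      by (rule sum.inter_filter[OF fin, symmetric])
    then show ?thesis by (simp add: mult.commute)
  qed
  have "(\<Sum>x\<in>?W. two_tilt (k n) u v (fst x))
    = (\<Sum>x\<in>?W. (if fst x \<in> {1..k n} then u else 0) + (if fst x \<in> {k n + 1..int n} then v else 0))"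
  proof (rule sum.cong[OF refl])
    fix x assume "x \<in> ?W"
    then have "x \<in> cyl_vertices VH n" by (simp add: unpaired_def)
    then have "1 \<le> fst x" "fst x \<le> int n" by (auto simp: cyl_vertices_def)
    then show "two_tilt (k n) u v (fst x)
      = (if fst x \<in> {1..k n} then u else 0) + (if fst x \<in> {k n + 1..int n} then v else 0)"
      by (simp add: two_tilt_def)
  qed
  also have "\<dots> = u * real (card {x \<in> ?W. fst x \<in> {1..k n}}) + v * real (card {x \<in> ?W. fst x \<in> {k n + 1..int n}})"
    unfolding sum.distrib ind ..
  finally show ?thesis by (simp add: layer_sum_def tilt_sum_def num_unpaired_in_def)
qed

lemma inner_fluct:
  "(\<chi> i. if i = 1 then T * u else T * v) \<bullet> fluct k n w m
     = T / sqrt (real n) * (layer_sum n (two_tilt (k n) u v) m - avg n w (layer_sum n (two_tilt (k n) u v)))"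
proof -
  have "avg n w (layer_sum n (two_tilt (k n) u v))
     = u * avg n w (num_unpaired_in VH n {1..k n}) + v * avg n w (num_unpaired_in VH n {k n + 1..int n})"
    unfolding layer_sum_two_tilt[abs_def] cyl_average_def
    by (simp add: finite_graph.gibbs_average_add[OF finite_graph_cyl] finite_graph.gibbs_average_cmult[OF finite_graph_cyl])
  then show ?thesis
    by (simp add: layer_sum_two_tilt fluct_def inner_vec_def sum_2 vector_2 algebra_simps add_divide_distrib diff_divide_distrib)
qed

abbreviation "Cov \<equiv> \<sigma>2 *\<^sub>R diag_matrix (vector [t, 1 - t]) :: real^2^2"

lemma quadratic_form: "u \<bullet> (Cov *v u) = \<sigma>2 * (t * (u $ 1)\<^sup>2 + (1 - t) * (u $ 2)\<^sup>2)"
  for u :: "real^2"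
  using inner_diag_matrix[of u "vector [t, 1 - t]"]
  by (simp add: scaleR_matrix_vector_assoc[symmetric] sum_2 vector_2)

lemma quadratic_form_nonneg: "u \<bullet> (Cov *v u) \<ge> 0"
  for u :: "real^2"
  unfolding quadratic_form using \<sigma>2_nonneg t by simp

lemma converges_cos_sin: "converges (\<lambda>x. cos (\<theta> \<bullet> x))" "converges (\<lambda>x. sin (\<theta> \<bullet> x))"
proof -
  \<comment> \<open>Any \<open>\<theta>\<close> is \<open>T\<close> times a vector with coordinates
    of modulus at most 1, as tilts must be; the summand 1 keeps \<open>T\<close> positive for
    \<open>\<theta> = 0\<close>.\<close>
  define T where "T = \<bar>\<theta> $ 1\<bar> + \<bar>\<theta> $ 2\<bar> + 1"
  define u where "u = \<theta> $ 1 / T"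
  define v where "v = \<theta> $ 2 / T"
  have T: "T > 0" by (simp add: T_def add_nonneg_pos)
  have uv: "\<bar>u\<bar> \<le> 1" "\<bar>v\<bar> \<le> 1" using T by (simp_all add: u_def v_def abs_divide divide_le_eq T_def)
  have \<theta>: "\<theta> = (\<chi> i. if i = 1 then T * u else T * v)"
    using T by (simp add: vec_eq_iff forall_2 u_def v_def)
  have q: "\<sigma>2 * (t * u\<^sup>2 + (1 - t) * v\<^sup>2) * T\<^sup>2 / 2 = (\<theta> \<bullet> (Cov *v \<theta>)) / 2"
    using T by (simp add: quadratic_form u_def v_def power_divide field_simps)
  have "tends (\<lambda>n w. avg n w (\<lambda>m. cos (\<theta> \<bullet> fluct k n w m))) (exp (- (\<sigma>2 * (t * u\<^sup>2 + (1 - t) * v\<^sup>2) * T\<^sup>2 / 2)))"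
    unfolding \<theta> inner_fluct by (rule tends_char(1)[OF \<sigma>2 t k uv])
  then show "converges (\<lambda>x. cos (\<theta> \<bullet> x))"
    unfolding q centered_gaussian_law_integrals(1)[OF N quadratic_form_nonneg] by simp
  have "tends (\<lambda>n w. avg n w (\<lambda>m. sin (\<theta> \<bullet> fluct k n w m))) 0"
    unfolding \<theta> inner_fluct by (rule tends_char(2)[OF \<sigma>2 t k uv])
  then show "converges (\<lambda>x. sin (\<theta> \<bullet> x))"
    unfolding centered_gaussian_law_integrals(2)[OF N quadratic_form_nonneg] by simp
qed

lemma measurable_N: "continuous_on UNIV f \<Longrightarrow> f \<in> borel_measurable N" for f :: "real^2 \<Rightarrow> real"
  using N borel_measurable_continuous_onI[of f] by (simp add: centered_gaussian_law_def cong: measurable_cong_sets)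

lemma integrable_N:
  fixes f :: "real^2 \<Rightarrow> real"
  assumes "continuous_on UNIV f" "\<And>x. \<bar>f x\<bar> \<le> B"
  shows "integrable N f"
proof -
  interpret N: prob_space N using N by (simp add: centered_gaussian_law_def)
  show ?thesis by (rule N.integrable_const_bound[of _ B]) (use assms measurable_N in auto)
qed

lemma converges_trig_sum: "trig_sum f \<Longrightarrow> converges f"
proof (induction rule: trig_sum.induct)
  case (add f g)
  have "integrable N f" "integrable N g"
    using add.hyps trig_sum_continuous_bounded integrable_N by blast+
  then show ?case
    using tends_add[OF add.IH]
    by (simp add: cyl_average_def finite_graph.gibbs_average_add[OF finite_graph_cyl])
next
  case (cmult f r)
  then show ?case
    using tends_cmult[OF cmult.IH, of r]
    by (simp add: cyl_average_def finite_graph.gibbs_average_cmult[OF finite_graph_cyl])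
qed (rule converges_cos_sin)+

text \<open>The coordinates belong to the tilts (1, 0) and (0, 1), each of quenched variance at most
  \<open>4 * n * h\<close>. This gives tightness for every realisation of the weights, not merely in
  probability.\<close>

lemma avg_norm_fluct_le:
  assumes "n \<ge> 1"
  shows "avg n w (\<lambda>m. (norm (fluct k n w m))\<^sup>2) \<le> 8 * h"
proof -
  have tilt: "\<bar>two_tilt (k n) u v i\<bar> \<le> 1" if "\<bar>u\<bar> \<le> 1" "\<bar>v\<bar> \<le> 1" for u v i
    using that by (simp add: two_tilt_def)
  let ?D = "\<lambda>u v m. (layer_sum n (two_tilt (k n) u v) m - avg n w (layer_sum n (two_tilt (k n) u v)))\<^sup>2"
  have le: "avg n w (?D u v) \<le> 4 * (real n * h)" if "\<bar>u\<bar> \<le> 1" "\<bar>v\<bar> \<le> 1" for u v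
    using layer_var_bounds(2)[where c = "two_tilt (k n) u v" and n = n and w = w, OF tilt[OF that]]
    by (simp only: layer_var_bounds(3)[where c = "two_tilt (k n) u v", OF tilt[OF that]])
  have "(norm (fluct k n w m))\<^sup>2 = 1 / real n * ?D 1 0 m + 1 / real n * ?D 0 1 m" for m
  proof -
    have "(\<chi> i. if i = 1 then 1 * 1 else 1 * 0) \<bullet> fluct k n w m = fluct k n w m $ 1"
      "(\<chi> i. if i = 1 then 1 * 0 else 1 * 1) \<bullet> fluct k n w m = fluct k n w m $ 2"
      by (simp_all add: inner_vec_def sum_2)
    then have "fluct k n w m $ 1 = 1 / sqrt (real n) * (layer_sum n (two_tilt (k n) 1 0) m - avg n w (layer_sum n (two_tilt (k n) 1 0)))"
      "fluct k n w m $ 2 = 1 / sqrt (real n) * (layer_sum n (two_tilt (k n) 0 1) m - avg n w (layer_sum n (two_tilt (k n) 0 1)))"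
      unfolding inner_fluct by simp_all
    moreover have "(norm (fluct k n w m))\<^sup>2 = (fluct k n w m $ 1)\<^sup>2 + (fluct k n w m $ 2)\<^sup>2"
      by (rule norm_power2_vec2)
    ultimately show ?thesis by (simp add: power_mult_distrib power_divide)
  qed
  then have "avg n w (\<lambda>m. (norm (fluct k n w m))\<^sup>2) = 1 / real n * avg n w (?D 1 0) + 1 / real n * avg n w (?D 0 1)"
    by (simp only: cyl_average_def finite_graph.gibbs_average_add[OF finite_graph_cyl]
        finite_graph.gibbs_average_cmult[OF finite_graph_cyl])
  also have "\<dots> \<le> 1 / real n * (4 * (real n * h)) + 1 / real n * (4 * (real n * h))"
    by (intro add_mono mult_left_mono le) auto
  finally show ?thesis using assms by simp
qed

lemma integrable_norm_N: "integrable N (\<lambda>y. (norm y)\<^sup>2)"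
proof -
  have "(norm y)\<^sup>2 = (axis 1 1 \<bullet> y)\<^sup>2 + (axis 2 1 \<bullet> y)\<^sup>2" for y :: "real^2"
    by (simp add: norm_power2_vec2 inner_axis')
  then show ?thesis
    using centered_gaussian_law_integrals(3)[OF N quadratic_form_nonneg] by simp
qed

text \<open>\<open>\<phi>\<close> is replaced by a bounded trigonometric sum close to it on a ball.
  Outside the ball the difference is at most \<open>b\<close>, hence at most
  \<open>b * |x|^2 / R^2\<close>, and \<open>K\<close> bounds the second moments of both the Gibbs
  measures and \<open>N\<close>.\<close>

lemma converges_continuous_bounded:
  assumes cont: "continuous_on UNIV \<phi>" and B: "\<And>x. \<bar>\<phi> x\<bar> \<le> B"
  shows "converges \<phi>"
proof (rule tends_approx, goal_cases)
  case n: (1 n)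
  show ?case
  proof (rule measurable_avg[OF n])
    fix m
    have [measurable]: "(\<lambda>w. avg n w (num_unpaired_in VH n I)) \<in> borel_measurable (P n)" for I
      by (rule measurable_avg[OF n]) simp
    have "(\<lambda>w. \<chi> i. fluct k n w m $ i) \<in> borel_measurable (P n)"
    proof (rule borel_measurable_vec_lambda)
      show "(\<lambda>w. fluct k n w m $ i) \<in> borel_measurable (P n)" for i
        using exhaust_2[of i] by (auto simp: fluct_def vector_2)
    qed
    then have "(\<lambda>w. fluct k n w m) \<in> borel_measurable (P n)" by simp
    then show "(\<lambda>w. \<phi> (fluct k n w m)) \<in> borel_measurable (P n)"
      using borel_measurable_continuous_onI[OF cont] by (rule measurable_compose)
  qed
next
  case e: (2 e)
  interpret N: prob_space N using N by (simp add: centered_gaussian_law_def)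
  define K where "K = 8 * h + (\<integral>y. (norm y)\<^sup>2 \<partial>N)"
  have K: "8 * h \<le> K" "(\<integral>y. (norm y)\<^sup>2 \<partial>N) \<le> K" "K \<ge> 0" by (simp_all add: K_def)
  have B0: "B \<ge> 0" using B[of 0] by linarith
  define b where "b = 2 * B + e / 2"
  have b: "b > 0" using B0 e by (simp add: b_def)
  \<comment> \<open>Solves \<open>b * (K + 1) / R^2 = e / 2\<close>; with \<open>K + 1\<close> the
    radius is positive even if \<open>K = 0\<close>.\<close>
  define R where "R = sqrt (b * (K + 1) / (e / 2))"
  have R: "R > 0" using b K e by (simp add: R_def)
  have R2: "b / R\<^sup>2 * K \<le> e / 2"
  proof -
    have "R\<^sup>2 = b * (K + 1) / (e / 2)" using b K e by (simp add: R_def)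
    then have "b / R\<^sup>2 * K = e / 2 * (K / (K + 1))" using b K e by (simp add: add_nonneg_eq_0_iff)
    moreover have "K / (K + 1) \<le> 1" using K by (simp add: divide_le_eq)
    ultimately show ?thesis using mult_left_mono[of "K / (K + 1)" 1 "e / 2"] e by simp
  qed
  have "e / 2 > 0" using e by simp
  then obtain p where "trig_sum p \<and> (\<forall>x. \<bar>p x\<bar> \<le> B + e / 2) \<and> (\<forall>x. norm x \<le> R \<longrightarrow> \<bar>\<phi> x - p x\<bar> \<le> e / 2)"
    using trig_sum_approx[OF cont B R] by blast
  then have p: "trig_sum p" "\<And>x. norm x \<le> R \<Longrightarrow> \<bar>\<phi> x - p x\<bar> \<le> e / 2" "\<And>x. \<bar>p x\<bar> \<le> B + e / 2"
    by blast+
  have diff: "\<bar>\<phi> x - p x\<bar> \<le> e / 2 + b / R\<^sup>2 * (norm x)\<^sup>2" for x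
  proof (cases "norm x \<le> R")
    case True
    have "0 \<le> b / R\<^sup>2 * (norm x)\<^sup>2" using b by simp
    then show ?thesis using p(2)[OF True] by linarith
  next
    case False
    then have "1 \<le> (norm x)\<^sup>2 / R\<^sup>2" using R by (simp add: power_mono)
    then have "b * 1 \<le> b * ((norm x)\<^sup>2 / R\<^sup>2)" using b by (intro mult_left_mono) auto
    moreover have "\<bar>\<phi> x - p x\<bar> \<le> b" using B[of x] p(3)[of x] unfolding b_def by linarith
    ultimately show ?thesis using e by simp
  qed
  have pc: "continuous_on UNIV p" using trig_sum_continuous_bounded[OF p(1)] by simp
  show ?case
  proof (intro exI conjI)
    show "converges p" by (rule converges_trig_sum[OF p(1)])
    have int: "integrable N p" "integrable N \<phi>"
      using integrable_N[OF pc p(3)] integrable_N[OF cont B] by auto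
    have "\<bar>(\<integral>y. p y \<partial>N) - (\<integral>y. \<phi> y \<partial>N)\<bar> = \<bar>\<integral>y. \<phi> y - p y \<partial>N\<bar>"
      using int by (simp add: abs_minus_commute)
    also have "\<dots> \<le> (\<integral>y. \<bar>\<phi> y - p y\<bar> \<partial>N)" by (rule integral_abs_bound)
    also have "\<dots> \<le> (\<integral>y. e / 2 + b / R\<^sup>2 * (norm y)\<^sup>2 \<partial>N)"
      by (rule integral_mono) (use int integrable_norm_N diff in auto)
    also have "\<dots> = e / 2 + b / R\<^sup>2 * (\<integral>y. (norm y)\<^sup>2 \<partial>N)"
      using integrable_norm_N by (simp add: N.prob_space)
    also have "\<dots> \<le> e / 2 + b / R\<^sup>2 * K"
      using K(2) b by (intro add_left_mono mult_left_mono) auto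
    finally show "\<bar>(\<integral>y. p y \<partial>N) - (\<integral>y. \<phi> y \<partial>N)\<bar> \<le> e" using R2 by linarith
    show "\<forall>\<^sub>F n in sequentially. \<forall>w\<in>space (P n).
        \<bar>avg n w (\<lambda>m. \<phi> (fluct k n w m)) - avg n w (\<lambda>m. p (fluct k n w m))\<bar> \<le> e"
      using eventually_ge_at_top[of 1]
    proof eventually_elim
      case (elim n)
      show ?case
      proof
        fix w
        interpret G: finite_graph "cyl_vertices VH n" "cyl_edges VH EH n" by (rule finite_graph_cyl)
        let ?A = "gibbs_average (cyl_vertices VH n) (cyl_edges VH EH n) (nu n w) (om n w)"
        have "\<bar>?A (\<lambda>m. \<phi> (fluct k n w m)) - ?A (\<lambda>m. p (fluct k n w m))\<bar> = \<bar>?A (\<lambda>m. \<phi> (fluct k n w m) - p (fluct k n w m))\<bar>"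
          using G.gibbs_average_add[of "nu n w" "om n w" "\<lambda>m. \<phi> (fluct k n w m)" "\<lambda>m. (-1) * p (fluct k n w m)"]
          unfolding G.gibbs_average_cmult by simp
        also have "\<dots> \<le> ?A (\<lambda>m. \<bar>\<phi> (fluct k n w m) - p (fluct k n w m)\<bar>)" by (rule G.gibbs_average_abs_le)
        also have "\<dots> \<le> ?A (\<lambda>m. e / 2 + b / R\<^sup>2 * (norm (fluct k n w m))\<^sup>2)"
          by (rule G.gibbs_average_mono) (rule diff)
        also have "\<dots> = e / 2 + b / R\<^sup>2 * ?A (\<lambda>m. (norm (fluct k n w m))\<^sup>2)"
          unfolding G.gibbs_average_add G.gibbs_average_cmult G.gibbs_average_const ..
        also have "\<dots> \<le> e / 2 + b / R\<^sup>2 * K"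
          using avg_norm_fluct_le[OF elim, of w] K(1) b
          by (intro add_left_mono mult_left_mono) (auto simp: cyl_average_def)
        finally show "\<bar>avg n w (\<lambda>m. \<phi> (fluct k n w m)) - avg n w (\<lambda>m. p (fluct k n w m))\<bar> \<le> e"
          using R2 unfolding cyl_average_def by linarith
      qed
    qed
  qed
qed

end

end

lemma integrable_abs_of_moment:
  assumes "prob_space L" "sets L = sets borel" "\<epsilon> > 0" "integrable L (\<lambda>x::real. \<bar>x\<bar> powr (2 + \<epsilon>))"
  shows "integrable L (\<lambda>x. \<bar>x\<bar>)"
proof (rule Bochner_Integration.integrable_bound)
  interpret prob_space L by fact
  show "integrable L (\<lambda>x. 1 + \<bar>x\<bar> powr (2 + \<epsilon>))" using assms(4) by simp
  show "(\<lambda>x. \<bar>x\<bar>) \<in> borel_measurable L" using assms(2) by (simp cong: measurable_cong_sets)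
  show "AE x in L. norm \<bar>x\<bar> \<le> norm (1 + \<bar>x\<bar> powr (2 + \<epsilon>))"
  proof (rule AE_I2)
    fix x :: real
    show "norm \<bar>x\<bar> \<le> norm (1 + \<bar>x\<bar> powr (2 + \<epsilon>))"
    proof (cases "\<bar>x\<bar> \<le> 1")
      case False
      then have "\<bar>x\<bar> powr 1 \<le> \<bar>x\<bar> powr (2 + \<epsilon>)" using assms(3) by (intro powr_mono) auto
      then show ?thesis using False by simp
    qed (simp add: add_increasing2)
  qed
qed

theorem theorem1p5:
  fixes VH :: "'a set" and EH :: "'a set set"
    and P :: "nat \<Rightarrow> 'w measure"
    and nu :: "nat \<Rightarrow> 'w \<Rightarrow> int \<times> 'a \<Rightarrow> real"
    and om :: "nat \<Rightarrow> 'w \<Rightarrow> (int \<times> 'a) set \<Rightarrow> real"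
    and Lnu Lom :: "real measure"
    and \<epsilon> :: real
  assumes "finite_simple_graph VH EH" and "VH \<noteq> {}"
    and "\<And>n. n \<ge> 1 \<Longrightarrow>
      iid_weights (P n) (cyl_vertices VH n) (cyl_edges VH EH n) (nu n) (om n) Lnu Lom"
    and "\<epsilon> > 0"
    and "integrable Lnu (\<lambda>x. \<bar>x\<bar> powr (2 + \<epsilon>))"
    and "integrable Lom (\<lambda>x. \<bar>x\<bar> powr (2 + \<epsilon>))"
  shows "\<exists>\<sigma>Q2 :: real.
    tendsto_in_probability P
      (\<lambda>n w. (cyl_average VH EH n (nu n w) (om n w) (\<lambda>m. (num_unpaired VH n m)\<^sup>2)
              - (cyl_average VH EH n (nu n w) (om n w) (num_unpaired VH n))\<^sup>2) / real n) \<sigma>Q2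
    \<and> (\<forall>(k :: nat \<Rightarrow> int) (t :: real).
        0 < t \<and> t < 1 \<and> (\<lambda>n. real_of_int (k n) / real n) \<longlonglongrightarrow> t \<longrightarrow>
        (\<exists>N :: (real^2) measure.
          centered_gaussian_law N (\<sigma>Q2 *\<^sub>R diag_matrix (vector [t, 1 - t]))
          \<and> (\<forall>\<phi> :: real^2 \<Rightarrow> real. continuous_on UNIV \<phi> \<and> bounded (range \<phi>) \<longrightarrow>
              tendsto_in_probability P
                (\<lambda>n w. cyl_average VH EH n (nu n w) (om n w)
                  (\<lambda>m. \<phi> ((1 / sqrt (real n)) *\<^sub>R vector
                    [num_unpaired_in VH n {1..k n} m
                       - cyl_average VH EH n (nu n w) (om n w) (num_unpaired_in VH n {1..k n}),
                     num_unpaired_in VH n {k n + 1..int n} m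
                       - cyl_average VH EH n (nu n w) (om n w)
                           (num_unpaired_in VH n {k n + 1..int n})])))
                (\<integral>y. \<phi> y \<partial>N))))"
proof -
  obtain j where j: "j \<in> VH" using assms(2) by auto
  \<comment> \<open>That \<open>Lnu\<close> and \<open>Lom\<close> are Borel probability laws is
    read off from actual weights. The cylinder of length 2 has a vertex and a path edge even if
    \<open>EH\<close> is empty, so both laws occur there.\<close>
  have iid2: "iid_weights (P 2) (cyl_vertices VH 2) (cyl_edges VH EH 2) (nu 2) (om 2) Lnu Lom"
    by (rule assms(3)) simp
  have v: "(1, j) \<in> cyl_vertices VH 2" using j by (simp add: cyl_vertices_def)
  have e: "{(1, j), (2, j)} \<in> cyl_edges VH EH 2"
    unfolding cyl_eq_slab by (rule slab_edgesI) (use j in auto)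
  interpret P2: prob_space "P 2" using iid2 by (simp add: iid_weights_def)
  have rv: "\<forall>x\<in>Inl ` cyl_vertices VH 2 \<union> Inr ` cyl_edges VH EH 2.
      (\<lambda>w. case x of Inl v \<Rightarrow> nu 2 w v | Inr e \<Rightarrow> om 2 w e) \<in> borel_measurable (P 2)"
    using iid2 unfolding iid_weights_def P2.indep_vars_def by blast
  have mv: "(\<lambda>w. nu 2 w (1, j)) \<in> borel_measurable (P 2)"
    using bspec[OF rv, of "Inl (1, j)"] v by simp
  have me: "(\<lambda>w. om 2 w {(1, j), (2, j)}) \<in> borel_measurable (P 2)"
    using bspec[OF rv, of "Inr {(1, j), (2, j)}"] e by simp
  have dv: "distr (P 2) borel (\<lambda>w. nu 2 w (1, j)) = Lnu"
    using iid2 v unfolding iid_weights_def by blast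
  have de: "distr (P 2) borel (\<lambda>w. om 2 w {(1, j), (2, j)}) = Lom"
    using iid2 e unfolding iid_weights_def by blast
  have "prob_space Lnu" "sets Lnu = sets borel" "prob_space Lom" "sets Lom = sets borel"
    using P2.prob_space_distr[OF mv] P2.prob_space_distr[OF me] by (simp_all flip: dv de)
  then have int: "integrable Lnu (\<lambda>x. \<bar>x\<bar>)" "integrable Lom (\<lambda>x. \<bar>x\<bar>)"
    using integrable_abs_of_moment assms(4,5,6) by auto
  interpret cylinder_family VH EH P nu om Lnu Lom
    by unfold_locales (use assms(1,3) int in auto)
  \<comment> \<open>The limit is fixed before \<open>k\<close> and \<open>t\<close>, together with
    the estimate on \<open>rate\<close> that ties it to every later cut.\<close>
  obtain \<sigma>2 where \<sigma>2: "\<sigma>2 \<ge> 0" "tends (\<lambda>n w. layer_var n (\<lambda>_. 1) w / real n) \<sigma>2"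
    "\<And>v. \<bar>v\<bar> \<le> 1/2 \<Longrightarrow> \<bar>rate v + rate (- v) - \<sigma>2 * v\<^sup>2\<bar> \<le> 64 * h * \<bar>v\<bar> ^ 3"
    by (rule ex_variance_limit) blast
  have total: "layer_sum n (\<lambda>_. 1) = num_unpaired VH n" for n
    by (simp add: fun_eq_iff layer_sum_def tilt_sum_def num_unpaired_def)
  show ?thesis
  proof (intro exI[of _ \<sigma>2] conjI allI impI, goal_cases)
    case 1
    show ?case using \<sigma>2(2) by (simp add: layer_var_def total)
  next
    case (2 k t)
    then have t: "0 < t" "t < 1" and k: "(\<lambda>n. real_of_int (k n) / real n) \<longlonglongrightarrow> t" by auto
    let ?S = "\<sigma>2 *\<^sub>R diag_matrix (vector [t, 1 - t]) :: real^2^2"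
    have S: "?S = diag_matrix (\<sigma>2 *\<^sub>R vector [t, 1 - t])"
      by (simp add: diag_matrix_def vec_eq_iff)
    have "(\<sigma>2 *\<^sub>R vector [t, 1 - t] :: real^2) $ i \<ge> 0" for i
      using exhaust_2[of i] \<sigma>2(1) t by (auto simp: vector_2)
    then obtain N where N: "centered_gaussian_law N ?S"
      using ex_centered_gaussian_diag unfolding S by blast
    show ?case
    proof (intro exI[of _ N] conjI N allI impI, goal_cases)
      case (1 \<phi>)
      then obtain B where B: "\<And>x. \<bar>\<phi> x\<bar> \<le> B" by (auto simp: bounded_iff)
      show ?case
        unfolding fluct_def[symmetric]
        by (rule converges_continuous_bounded[OF \<sigma>2(3) \<sigma>2(1) t k N _ B]) (use 1 in simp_all)
    qed
  qed
qed

end
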